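(* Let $L$ and $L'$ be classical links with two components each. Then the medial quandles $\mathrm{MQ}(L)$ and $\mathrm{MQ}(L')$ are isomorphic (as quandles) if and only if the reduced Alexander invariants $\ker\phi_L^{\mathrm{red}}$ and $\ker\phi_{L'}^{\mathrm{red}}$ are isomorphic (as $\Lambda$-modules, $\Lambda=\mathbb Z[t^{\pm1}]$).
   Context: Links. A classical link $L=K_1\cup\dots\cup K_\mu$ is an oriented link in 3-space, represented by a diagram $D$: $\mu$ oriented circles immersed in the plane with only transverse double points (crossings), at each of which one strand is overpassing and the other is underpassing; short subsegments of the underpassing strand are removed on the two sides of the crossing. Diagrams are considered up to Reidemeister moves. The removals cut the circles into arcs (a circle that never underpasses is a single arc). $A(D)$ is the set of arcs and $C(D)$ the set of crossings. At $c\in C(D)$, $a(c)$ denotes the overpassing arc, and $b_1(c),b_2(c)$ the two underpassing arcs, with $b_1(c)$ on the right of the oriented arc $a(c)$ and $b_2(c)$ on the left. All structures below are defined from a diagram $D$ of $L$ and are independent of $D$ up to isomorphism. Medial quandle. A quandle is a set with a binary operation $\triangleright$ such that $x\triangleright x=x$, each map $x\mapsto x\triangleright y$ is a bijection, and $(x\triangleright y)\triangleright z=(x\triangleright z)\triangleright(y\triangleright z)$. It is medial if $(w\triangleright x)\triangleright(y\triangleright z)=(w\triangleright y)\triangleright(x\triangleright z)$ for all $w,x,y,z$. $\mathrm{MQ}(L)$ is the medial quandle presented (in the class of medial quandles) by a generator $q_a$ for each $a\in A(D)$ and a relation $q_{b_1(c)}\triangleright q_{a(c)}=q_{b_2(c)}$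 for each $c\in C(D)$. Reduced Alexander invariant. Let $\Lambda=\mathbb Z[t^{\pm1}]$. The reduced Alexander module $M_A^{\mathrm{red}}(L)$ is the cokernel of the $\Lambda$-linear map $\Lambda^{C(D)}\to\Lambda^{A(D)}$ of free modules given by $c\mapsto(1-t)a(c)+t\,b_1(c)-b_2(c)$. Write $\varsigma_D(a)$ for the image of $a\in A(D)$ in $M_A^{\mathrm{red}}(L)$. The reduced Crowell map $\phi_L^{\mathrm{red}}:M_A^{\mathrm{red}}(L)\to\Lambda$ is the $\Lambda$-linear epimorphism with $\phi_L^{\mathrm{red}}(\varsigma_D(a))=1$ for all $a\in A(D)$. The reduced Alexander invariant of $L$ is the $\Lambda$-module $\ker\phi_L^{\mathrm{red}}$. *)

theory Defs
  imports "HOL-Analysis.Analysis" "HOL-Algebra.Module" "HOL-Algebra.AbelCoset"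
    "HOL-Library.Poly_Mapping"
begin

section \<open>Classical link diagrams\<close>

text \<open>
  The plane is the type of complex numbers. Component \<open>i\<close> of a diagram is the image of the unit
  circle, oriented counterclockwise, under \<open>curve D i\<close>. A pair \<open>(i, z)\<close> with \<open>i < ncomp D\<close> and
  \<open>cmod z = 1\<close> is a point of the abstract union of circles; \<open>under D\<close> is the set of those
  points at which a strand passes under another one.
\<close>

record diagram =
  ncomp :: nat
  curve :: "nat \<Rightarrow> complex \<Rightarrow> complex"
  under :: "(nat \<times> complex) set"

definition circles :: "diagram \<Rightarrow> (nat \<times> complex) set" where
  "circles D = {..<ncomp D} \<times> sphere 0 1"

definition pos :: "diagram \<Rightarrow> nat \<times> complex \<Rightarrow> complex" where
  "pos D x = curve D (fst x) (snd x)"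

definition velocity :: "diagram \<Rightarrow> nat \<times> complex \<Rightarrow> complex" where
  "velocity D x = vector_derivative (\<lambda>s. curve D (fst x) (snd x * cis s)) (at 0)"

definition cross :: "complex \<Rightarrow> complex \<Rightarrow> real" where
  "cross v w = Im (cnj v * w)"
  \<comment> \<open>the determinant of the real plane vectors \<open>v\<close>, \<open>w\<close>: positive iff \<open>w\<close> points to the left of \<open>v\<close>\<close>

definition crossings :: "diagram \<Rightarrow> complex set" where
  "crossings D = {c. \<exists>x\<in>circles D. \<exists>y\<in>circles D. x \<noteq> y \<and> pos D x = c \<and> pos D y = c}"

definition link_diagram :: "diagram \<Rightarrow> bool" where
  "link_diagram D \<longleftrightarrow>
     \<comment> \<open>immersed circles\<close>
     (\<forall>i<ncomp D. (\<lambda>s. curve D i (cis s)) C1_differentiable_on UNIV) \<and>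
     (\<forall>x\<in>circles D. velocity D x \<noteq> 0) \<and>
     \<comment> \<open>the only singularities are finitely many transverse double points\<close>
     finite (crossings D) \<and>
     (\<forall>x\<in>circles D. \<forall>y\<in>circles D. \<forall>z\<in>circles D.
        pos D x = pos D y \<and> pos D y = pos D z \<longrightarrow> x = y \<or> y = z \<or> x = z) \<and>
     (\<forall>x\<in>circles D. \<forall>y\<in>circles D.
        x \<noteq> y \<and> pos D x = pos D y \<longrightarrow> cross (velocity D x) (velocity D y) \<noteq> 0) \<and>
     \<comment> \<open>at each crossing exactly one of the two strands is the underpassing one\<close>
     under D \<subseteq> {x \<in> circles D. pos D x \<in> crossings D} \<and>
     (\<forall>x\<in>circles D. \<forall>y\<in>circles D.
        x \<noteq> y \<and> pos D x = pos D y \<longrightarrow> (x \<in> under D \<longleftrightarrow> y \<notin> under D))"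

definition over_point :: "diagram \<Rightarrow> complex \<Rightarrow> nat \<times> complex" where
  "over_point D c = (THE x. x \<in> circles D \<and> pos D x = c \<and> x \<notin> under D)"

definition under_point :: "diagram \<Rightarrow> complex \<Rightarrow> nat \<times> complex" where
  "under_point D c = (THE x. x \<in> circles D \<and> pos D x = c \<and> x \<in> under D)"

text \<open>
  An arc is recorded as its component together with its preimage in the unit circle, a connected
  component of the circle minus the underpassing points. (Removing the points themselves or short
  segments around them yields the same set of pieces.)
\<close>

type_synonym arc = "nat \<times> complex set"

definition arcs :: "diagram \<Rightarrow> arc set" where
  "arcs D = {(i, B). i < ncomp D \<and> B \<in> components (sphere 0 1 - {z. (i, z) \<in> under D})}"

definition arc_containing :: "diagram \<Rightarrow> nat \<times> complex \<Rightarrow> arc" where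
  "arc_containing D x = (THE a. a \<in> arcs D \<and> fst a = fst x \<and> snd x \<in> snd a)"

definition arc_into :: "diagram \<Rightarrow> nat \<times> complex \<Rightarrow> arc" where
  "arc_into D x = (THE a. a \<in> arcs D \<and> fst a = fst x \<and>
     (\<forall>\<^sub>F s in at_left 0. snd x * cis s \<in> snd a))"

definition arc_out_of :: "diagram \<Rightarrow> nat \<times> complex \<Rightarrow> arc" where
  "arc_out_of D x = (THE a. a \<in> arcs D \<and> fst a = fst x \<and>
     (\<forall>\<^sub>F s in at_right 0. snd x * cis s \<in> snd a))"

definition over_arc :: "diagram \<Rightarrow> complex \<Rightarrow> arc" where
  "over_arc D c = arc_containing D (over_point D c)"

text \<open>
  If the underpassing strand moves from the right of the overpassing strand to its left, the
  underpassing arc on the right is the incoming one; otherwise it is the outgoing one.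
\<close>

definition under_right_to_left :: "diagram \<Rightarrow> complex \<Rightarrow> bool" where
  "under_right_to_left D c \<longleftrightarrow>
     cross (velocity D (over_point D c)) (velocity D (under_point D c)) > 0"

definition right_arc :: "diagram \<Rightarrow> complex \<Rightarrow> arc" where
  "right_arc D c = (if under_right_to_left D c then arc_into D (under_point D c)
     else arc_out_of D (under_point D c))"

definition left_arc :: "diagram \<Rightarrow> complex \<Rightarrow> arc" where
  "left_arc D c = (if under_right_to_left D c then arc_out_of D (under_point D c)
     else arc_into D (under_point D c))"


section \<open>Medial quandles\<close>

record 'a quandle = "'a partial_object" +
  qop :: "'a \<Rightarrow> 'a \<Rightarrow> 'a" (infixl "\<triangleright>\<index>" 70)

locale medial_quandle =
  fixes Q :: "('a, 'm) quandle_scheme" (structure)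
  assumes closed: "\<lbrakk>x \<in> carrier Q; y \<in> carrier Q\<rbrakk> \<Longrightarrow> x \<triangleright> y \<in> carrier Q"
    and idem: "x \<in> carrier Q \<Longrightarrow> x \<triangleright> x = x"
    and bij: "y \<in> carrier Q \<Longrightarrow> bij_betw (\<lambda>x. x \<triangleright> y) (carrier Q) (carrier Q)"
    and distrib: "\<lbrakk>x \<in> carrier Q; y \<in> carrier Q; z \<in> carrier Q\<rbrakk>
      \<Longrightarrow> (x \<triangleright> y) \<triangleright> z = (x \<triangleright> z) \<triangleright> (y \<triangleright> z)"
    and medial: "\<lbrakk>w \<in> carrier Q; x \<in> carrier Q; y \<in> carrier Q; z \<in> carrier Q\<rbrakk>
      \<Longrightarrow> (w \<triangleright> x) \<triangleright> (y \<triangleright> z) = (w \<triangleright> y) \<triangleright> (x \<triangleright> z)"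

definition quandle_isomorphic ::
    "('a, 'm) quandle_scheme \<Rightarrow> ('b, 'n) quandle_scheme \<Rightarrow> bool" where
  "quandle_isomorphic Q Q' \<longleftrightarrow> (\<exists>f. bij_betw f (carrier Q) (carrier Q') \<and>
     (\<forall>x\<in>carrier Q. \<forall>y\<in>carrier Q. f (x \<triangleright>\<^bsub>Q\<^esub> y) = f x \<triangleright>\<^bsub>Q'\<^esub> f y))"

text \<open>
  Presentations: terms in the generators, built with the quandle operation and its right inverse,
  modulo the least congruence that enforces the medial quandle axioms and the given relations. A
  triple \<open>(x, y, z)\<close> of generators stands for the relation \<open>x \<triangleright> y = z\<close>.
\<close>

datatype 'a qterm = Gen 'a | Op "'a qterm" "'a qterm" | Inv "'a qterm" "'a qterm"

definition qterms :: "'a set \<Rightarrow> 'a qterm set" where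
  "qterms A = {s. set_qterm s \<subseteq> A}"

inductive mq_eq :: "'a set \<Rightarrow> ('a \<times> 'a \<times> 'a) set \<Rightarrow> 'a qterm \<Rightarrow> 'a qterm \<Rightarrow> bool"
  for A R where
  refl: "s \<in> qterms A \<Longrightarrow> mq_eq A R s s"
| sym: "mq_eq A R s u \<Longrightarrow> mq_eq A R u s"
| trans: "mq_eq A R s u \<Longrightarrow> mq_eq A R u v \<Longrightarrow> mq_eq A R s v"
| Op_cong: "mq_eq A R s s' \<Longrightarrow> mq_eq A R u u' \<Longrightarrow> mq_eq A R (Op s u) (Op s' u')"
| Inv_cong: "mq_eq A R s s' \<Longrightarrow> mq_eq A R u u' \<Longrightarrow> mq_eq A R (Inv s u) (Inv s' u')"
| idem: "s \<in> qterms A \<Longrightarrow> mq_eq A R (Op s s) s"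
| Inv_Op: "\<lbrakk>s \<in> qterms A; u \<in> qterms A\<rbrakk> \<Longrightarrow> mq_eq A R (Inv (Op s u) u) s"
| Op_Inv: "\<lbrakk>s \<in> qterms A; u \<in> qterms A\<rbrakk> \<Longrightarrow> mq_eq A R (Op (Inv s u) u) s"
| distrib: "\<lbrakk>s \<in> qterms A; u \<in> qterms A; v \<in> qterms A\<rbrakk>
    \<Longrightarrow> mq_eq A R (Op (Op s u) v) (Op (Op s v) (Op u v))"
| medial: "\<lbrakk>r \<in> qterms A; s \<in> qterms A; u \<in> qterms A; v \<in> qterms A\<rbrakk>
    \<Longrightarrow> mq_eq A R (Op (Op r s) (Op u v)) (Op (Op r u) (Op s v))"
| rel: "\<lbrakk>(x, y, z) \<in> R; x \<in> A; y \<in> A; z \<in> A\<rbrakk>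
    \<Longrightarrow> mq_eq A R (Op (Gen x) (Gen y)) (Gen z)"

definition presented_mq :: "'a set \<Rightarrow> ('a \<times> 'a \<times> 'a) set \<Rightarrow> 'a qterm set quandle" where
  "presented_mq A R =
     \<lparr>carrier = qterms A // {(s, u). mq_eq A R s u},
      qop = (\<lambda>X Y. \<Union>s\<in>X. \<Union>u\<in>Y. {v. mq_eq A R (Op s u) v})\<rparr>"

lemma Gen_qterms: "Gen x \<in> qterms A \<longleftrightarrow> x \<in> A"
  and Op_qterms: "Op s u \<in> qterms A \<longleftrightarrow> s \<in> qterms A \<and> u \<in> qterms A"
  and Inv_qterms: "Inv s u \<in> qterms A \<longleftrightarrow> s \<in> qterms A \<and> u \<in> qterms A"
  by (auto simp: qterms_def)

lemmas qterms_iffs = Gen_qterms Op_qterms Inv_qterms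

lemma mq_eq_qterms: "mq_eq A R s u \<Longrightarrow> s \<in> qterms A \<and> u \<in> qterms A"
  by (induction rule: mq_eq.induct) (auto simp: qterms_iffs)

lemma equiv_mq_eq: "equiv (qterms A) {(s, u). mq_eq A R s u}"
proof (rule equivI)
  show "{(s, u). mq_eq A R s u} \<subseteq> qterms A \<times> qterms A"
    by (auto dest: mq_eq_qterms)
  show "refl_on (qterms A) {(s, u). mq_eq A R s u}"
    by (auto simp: refl_on_def intro: mq_eq.refl)
  show "Relation.sym {(s, u). mq_eq A R s u}"
    by (auto intro!: symI intro: mq_eq.sym)
  show "Relation.trans {(s, u). mq_eq A R s u}"
    by (auto intro!: transI intro: mq_eq.trans)
qed

definition mq_class :: "'a set \<Rightarrow> ('a \<times> 'a \<times> 'a) set \<Rightarrow> 'a qterm \<Rightarrow> 'a qterm set" where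
  "mq_class A R s = {u. mq_eq A R s u}"

lemma carrier_presented_mq: "carrier (presented_mq A R) = mq_class A R ` qterms A"
  by (auto simp: presented_mq_def quotient_def mq_class_def)

lemma mq_class_eq_iff:
  assumes "s \<in> qterms A" "u \<in> qterms A"
  shows "mq_class A R s = mq_class A R u \<longleftrightarrow> mq_eq A R s u"
  using assms unfolding mq_class_def by (auto intro: mq_eq.refl mq_eq.sym mq_eq.trans)

lemma mq_eq_imp_class: "mq_eq A R s u \<Longrightarrow> mq_class A R s = mq_class A R u"
  using mq_eq_qterms[of A R s u] by (simp add: mq_class_eq_iff)

lemma qop_mq_class:
  assumes "s \<in> qterms A" "u \<in> qterms A"
  shows "mq_class A R s \<triangleright>\<^bsub>presented_mq A R\<^esub> mq_class A R u = mq_class A R (Op s u)"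
proof -
  have "mq_eq A R (Op s' u') v \<longleftrightarrow> mq_eq A R (Op s u) v"
    if "mq_eq A R s s'" "mq_eq A R u u'" for s' u' v
    using mq_eq.Op_cong[OF that] by (meson mq_eq.sym mq_eq.trans)
  then show ?thesis
    using assms by (auto simp: presented_mq_def mq_class_def intro: mq_eq.refl)
qed

lemma medial_quandle_presented_mq: "medial_quandle (presented_mq A R)"
proof
  fix y assume "y \<in> carrier (presented_mq A R)"
  then obtain u where u: "u \<in> qterms A" "y = mq_class A R u"
    by (auto simp: carrier_presented_mq)
  let ?f = "\<lambda>x. x \<triangleright>\<^bsub>presented_mq A R\<^esub> y"
  show "bij_betw ?f (carrier (presented_mq A R)) (carrier (presented_mq A R))"
    unfolding bij_betw_def
  proof
    have "mq_eq A R s s'" if "s \<in> qterms A" "s' \<in> qterms A" "mq_eq A R (Op s u) (Op s' u)" for s s'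
      using mq_eq.Inv_cong[OF that(3) mq_eq.refl[OF u(1)]] mq_eq.Inv_Op[OF that(1) u(1)]
        mq_eq.Inv_Op[OF that(2) u(1)] by (meson mq_eq.sym mq_eq.trans)
    then show "inj_on ?f (carrier (presented_mq A R))"
      using u by (auto simp: inj_on_def carrier_presented_mq qop_mq_class mq_class_eq_iff qterms_iffs)
    have "mq_class A R s \<in> ?f ` carrier (presented_mq A R)" if "s \<in> qterms A" for s
    proof
      show "mq_class A R s = mq_class A R (Inv s u) \<triangleright>\<^bsub>presented_mq A R\<^esub> y"
        using that u by (simp add: qop_mq_class qterms_iffs mq_class_eq_iff mq_eq.Op_Inv mq_eq.sym)
    qed (use that u in \<open>auto simp: carrier_presented_mq qterms_iffs\<close>)
    then show "?f ` carrier (presented_mq A R) = carrier (presented_mq A R)"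
      using u by (auto simp: carrier_presented_mq qop_mq_class qterms_iffs)
  qed
next
  fix x y assume "x \<in> carrier (presented_mq A R)" "y \<in> carrier (presented_mq A R)"
  then show "x \<triangleright>\<^bsub>presented_mq A R\<^esub> y \<in> carrier (presented_mq A R)"
    by (auto simp: carrier_presented_mq qop_mq_class qterms_iffs)
next
  fix x assume "x \<in> carrier (presented_mq A R)"
  then obtain s where s: "s \<in> qterms A" "x = mq_class A R s"
    by (auto simp: carrier_presented_mq)
  show "x \<triangleright>\<^bsub>presented_mq A R\<^esub> x = x"
    unfolding s(2) qop_mq_class[OF s(1) s(1)]
    by (rule mq_eq_imp_class[OF mq_eq.idem[OF s(1)]])
next
  fix x y z assume "x \<in> carrier (presented_mq A R)" "y \<in> carrier (presented_mq A R)"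
    "z \<in> carrier (presented_mq A R)"
  then obtain s u v where "s \<in> qterms A" "u \<in> qterms A" "v \<in> qterms A"
    "x = mq_class A R s" "y = mq_class A R u" "z = mq_class A R v"
    by (auto simp: carrier_presented_mq)
  then show "(x \<triangleright>\<^bsub>presented_mq A R\<^esub> y) \<triangleright>\<^bsub>presented_mq A R\<^esub> z
      = (x \<triangleright>\<^bsub>presented_mq A R\<^esub> z) \<triangleright>\<^bsub>presented_mq A R\<^esub> (y \<triangleright>\<^bsub>presented_mq A R\<^esub> z)"
    by (simp only: qop_mq_class qterms_iffs simp_thms) (rule mq_eq_imp_class[OF mq_eq.distrib])
next
  fix w x y z assume "w \<in> carrier (presented_mq A R)" "x \<in> carrier (presented_mq A R)"
    "y \<in> carrier (presented_mq A R)" "z \<in> carrier (presented_mq A R)"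
  then obtain r s u v where "r \<in> qterms A" "s \<in> qterms A" "u \<in> qterms A" "v \<in> qterms A"
    "w = mq_class A R r" "x = mq_class A R s" "y = mq_class A R u" "z = mq_class A R v"
    by (auto simp: carrier_presented_mq)
  then show "(w \<triangleright>\<^bsub>presented_mq A R\<^esub> x) \<triangleright>\<^bsub>presented_mq A R\<^esub> (y \<triangleright>\<^bsub>presented_mq A R\<^esub> z)
      = (w \<triangleright>\<^bsub>presented_mq A R\<^esub> y) \<triangleright>\<^bsub>presented_mq A R\<^esub> (x \<triangleright>\<^bsub>presented_mq A R\<^esub> z)"
    by (simp only: qop_mq_class qterms_iffs simp_thms) (rule mq_eq_imp_class[OF mq_eq.medial])
qed

lemma presented_mq_relation:
  assumes "(x, y, z) \<in> R" "x \<in> A" "y \<in> A" "z \<in> A"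
  shows "mq_class A R (Gen x) \<triangleright>\<^bsub>presented_mq A R\<^esub> mq_class A R (Gen y) = mq_class A R (Gen z)"
  using assms by (simp add: qop_mq_class qterms_iffs mq_class_eq_iff mq_eq.rel)

primrec qeval :: "('b, 'm) quandle_scheme \<Rightarrow> ('a \<Rightarrow> 'b) \<Rightarrow> 'a qterm \<Rightarrow> 'b" where
  "qeval Q g (Gen x) = g x"
| "qeval Q g (Op s u) = qeval Q g s \<triangleright>\<^bsub>Q\<^esub> qeval Q g u"
| "qeval Q g (Inv s u) = inv_into (carrier Q) (\<lambda>x. x \<triangleright>\<^bsub>Q\<^esub> qeval Q g u) (qeval Q g s)"

lemma presented_mq_universal:
  assumes "medial_quandle Q" and g: "\<And>x. x \<in> A \<Longrightarrow> g x \<in> carrier Q"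
    and R: "\<And>x y z. (x, y, z) \<in> R \<Longrightarrow> x \<in> A \<Longrightarrow> y \<in> A \<Longrightarrow> z \<in> A \<Longrightarrow> g x \<triangleright>\<^bsub>Q\<^esub> g y = g z"
  shows "\<exists>f. (\<forall>X\<in>carrier (presented_mq A R). f X \<in> carrier Q) \<and>
    (\<forall>X\<in>carrier (presented_mq A R). \<forall>Y\<in>carrier (presented_mq A R).
       f (X \<triangleright>\<^bsub>presented_mq A R\<^esub> Y) = f X \<triangleright>\<^bsub>Q\<^esub> f Y) \<and>
    (\<forall>x\<in>A. f (mq_class A R (Gen x)) = g x)"
proof -
  interpret medial_quandle Q by fact
  let ?e = "qeval Q g"
  have inv1: "inv_into (carrier Q) (\<lambda>x. x \<triangleright>\<^bsub>Q\<^esub> y) (x \<triangleright>\<^bsub>Q\<^esub> y) = x"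
    if "x \<in> carrier Q" "y \<in> carrier Q" for x y
    using inv_into_f_f[of "\<lambda>x. x \<triangleright>\<^bsub>Q\<^esub> y"] bij that by (simp add: bij_betw_def)
  have inv2: "inv_into (carrier Q) (\<lambda>x. x \<triangleright>\<^bsub>Q\<^esub> y) x \<triangleright>\<^bsub>Q\<^esub> y = x"
    if "x \<in> carrier Q" "y \<in> carrier Q" for x y
    using f_inv_into_f[of x "\<lambda>x. x \<triangleright>\<^bsub>Q\<^esub> y"] bij[of y] that by (simp add: bij_betw_def)
  have inv3: "inv_into (carrier Q) (\<lambda>x. x \<triangleright>\<^bsub>Q\<^esub> y) x \<in> carrier Q"
    if "x \<in> carrier Q" "y \<in> carrier Q" for x y
    using inv_into_into[of x "\<lambda>x. x \<triangleright>\<^bsub>Q\<^esub> y"] bij[of y] that by (simp add: bij_betw_def)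
  have e: "?e s \<in> carrier Q" if "s \<in> qterms A" for s
    using that by (induction s) (auto simp: qterms_iffs g closed inv3)
  have eq: "?e s = ?e u" if "mq_eq A R s u" for s u
    using that
    by (induction rule: mq_eq.induct)
      (simp_all add: e idem inv1 inv2 R, (metis distrib medial e)+)
  define f where "f X = ?e (SOME s. s \<in> X)" for X
  have f: "f (mq_class A R s) = ?e s" if "s \<in> qterms A" for s
  proof -
    have "(SOME u. u \<in> mq_class A R s) \<in> mq_class A R s"
      by (rule someI[of _ s]) (use that in \<open>simp add: mq_class_def mq_eq.refl\<close>)
    then show ?thesis
      unfolding f_def using eq by (auto simp: mq_class_def)
  qed
  show ?thesis
    by (rule exI[of _ f]) (auto simp: carrier_presented_mq f qop_mq_class qterms_iffs e)
qed

definition MQ :: "diagram \<Rightarrow> arc qterm set quandle" where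
  "MQ D = presented_mq (arcs D) ((\<lambda>c. (right_arc D c, over_arc D c, left_arc D c)) ` crossings D)"


section \<open>The reduced Alexander invariant\<close>

text \<open>
  The group ring of the integers, i.e. the ring of integer Laurent polynomials in \<open>tvar\<close>.
\<close>

type_synonym laurent = "int \<Rightarrow>\<^sub>0 int"

definition tvar :: laurent where
  "tvar = Poly_Mapping.single 1 1"

definition Lambda :: "laurent ring" where
  "Lambda = \<lparr>carrier = UNIV, mult = (*), one = 1, zero = 0, add = (+)\<rparr>"

definition lscale :: "laurent \<Rightarrow> ('x \<Rightarrow>\<^sub>0 laurent) \<Rightarrow> ('x \<Rightarrow>\<^sub>0 laurent)" where
  "lscale r f = Poly_Mapping.map ((*) r) f"

text \<open>The \<open>mult\<close> and \<open>one\<close> fields of a module record carry no meaning.\<close>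

definition free_module :: "'x set \<Rightarrow> (laurent, 'x \<Rightarrow>\<^sub>0 laurent) module" where
  "free_module X = \<lparr>carrier = {f. Poly_Mapping.keys f \<subseteq> X}, mult = undefined, one = undefined,
     zero = 0, add = (+), smult = lscale\<rparr>"

definition linear_extension ::
    "('x \<Rightarrow> ('y \<Rightarrow>\<^sub>0 laurent)) \<Rightarrow> ('x \<Rightarrow>\<^sub>0 laurent) \<Rightarrow> ('y \<Rightarrow>\<^sub>0 laurent)" where
  "linear_extension h f = (\<Sum>x\<in>Poly_Mapping.keys f. lscale (Poly_Mapping.lookup f x) (h x))"

definition quotient_module :: "(laurent, 'b) module \<Rightarrow> 'b set \<Rightarrow> (laurent, 'b set) module" where
  "quotient_module M N = \<lparr>carrier = a_rcosets\<^bsub>M\<^esub> N, mult = undefined, one = undefined,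
     zero = N, add = set_add M, smult = (\<lambda>r X. \<Union>x\<in>X. N +>\<^bsub>M\<^esub> (r \<odot>\<^bsub>M\<^esub> x))\<rparr>"

definition module_isomorphic :: "(laurent, 'b) module \<Rightarrow> (laurent, 'c) module \<Rightarrow> bool" where
  "module_isomorphic M M' \<longleftrightarrow> (\<exists>f. bij_betw f (carrier M) (carrier M') \<and>
     (\<forall>x\<in>carrier M. \<forall>y\<in>carrier M. f (x \<oplus>\<^bsub>M\<^esub> y) = f x \<oplus>\<^bsub>M'\<^esub> f y) \<and>
     (\<forall>r. \<forall>x\<in>carrier M. f (r \<odot>\<^bsub>M\<^esub> x) = r \<odot>\<^bsub>M'\<^esub> f x))"

definition relator :: "diagram \<Rightarrow> complex \<Rightarrow> arc \<Rightarrow>\<^sub>0 laurent" where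
  "relator D c = Poly_Mapping.single (over_arc D c) (1 - tvar)
     + Poly_Mapping.single (right_arc D c) tvar - Poly_Mapping.single (left_arc D c) 1"

definition relations :: "diagram \<Rightarrow> (arc \<Rightarrow>\<^sub>0 laurent) set" where
  "relations D = linear_extension (relator D) ` carrier (free_module (crossings D))"

definition reduced_alexander_module :: "diagram \<Rightarrow> (laurent, (arc \<Rightarrow>\<^sub>0 laurent) set) module" where
  "reduced_alexander_module D = quotient_module (free_module (arcs D)) (relations D)"

definition arc_class :: "diagram \<Rightarrow> arc \<Rightarrow> (arc \<Rightarrow>\<^sub>0 laurent) set" where
  "arc_class D a = relations D +>\<^bsub>free_module (arcs D)\<^esub> Poly_Mapping.single a 1"

definition coeff_sum :: "('x \<Rightarrow>\<^sub>0 laurent) \<Rightarrow> laurent" where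
  "coeff_sum f = (\<Sum>x\<in>Poly_Mapping.keys f. Poly_Mapping.lookup f x)"

text \<open>
  The reduced Crowell map is the linear map that sends the class of every arc to 1, so the class of
  \<open>f\<close> goes to the sum of the coefficients of \<open>f\<close> (see \<open>crowell_coset\<close> and \<open>crowell_arc_class\<close> below).
\<close>

definition crowell :: "diagram \<Rightarrow> (arc \<Rightarrow>\<^sub>0 laurent) set \<Rightarrow> laurent" where
  "crowell D X = the_elem (coeff_sum ` X)"

definition reduced_alexander_invariant ::
    "diagram \<Rightarrow> (laurent, (arc \<Rightarrow>\<^sub>0 laurent) set) module" where
  "reduced_alexander_invariant D = (reduced_alexander_module D)
     \<lparr>carrier := a_kernel (reduced_alexander_module D) Lambda (crowell D)\<rparr>"

lemma cring_Lambda: "cring Lambda"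
proof (rule cringI)
  show "abelian_group Lambda"
  proof (rule abelian_groupI)
    fix x assume "x \<in> carrier Lambda"
    show "\<exists>y\<in>carrier Lambda. y \<oplus>\<^bsub>Lambda\<^esub> x = \<zero>\<^bsub>Lambda\<^esub>"
      by (rule bexI[of _ "- x"]) (simp_all add: Lambda_def)
  qed (simp_all add: Lambda_def add.assoc add.commute)
  show "Group.comm_monoid Lambda"
    by (rule Group.comm_monoidI) (simp_all add: Lambda_def mult.assoc mult.commute)
qed (simp add: Lambda_def distrib_right)

lemma lookup_lscale [simp]: "Poly_Mapping.lookup (lscale r f) x = r * Poly_Mapping.lookup f x"
  by (simp add: lscale_def Poly_Mapping.map.rep_eq when_def)

lemma keys_lscale_subset: "Poly_Mapping.keys (lscale r f) \<subseteq> Poly_Mapping.keys f"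
  by (auto simp: in_keys_iff)

lemma module_free_module: "module Lambda (free_module X)"
proof (rule moduleI)
  show "cring Lambda" by (rule cring_Lambda)
  show "abelian_group (free_module X)"
  proof (rule abelian_groupI)
    fix f g assume "f \<in> carrier (free_module X)" "g \<in> carrier (free_module X)"
    then show "f \<oplus>\<^bsub>free_module X\<^esub> g \<in> carrier (free_module X)"
      using Poly_Mapping.keys_add[of f g] by (auto simp: free_module_def)
  next
    fix f assume "f \<in> carrier (free_module X)"
    then show "\<exists>g\<in>carrier (free_module X). g \<oplus>\<^bsub>free_module X\<^esub> f = \<zero>\<^bsub>free_module X\<^esub>"
      by (intro bexI[of _ "- f"]) (simp_all add: free_module_def)
  qed (simp_all add: free_module_def algebra_simps)
next
  fix r f assume "f \<in> carrier (free_module X)"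
  then show "r \<odot>\<^bsub>free_module X\<^esub> f \<in> carrier (free_module X)"
    using keys_lscale_subset[of r f] by (auto simp: free_module_def)
qed (simp_all add: free_module_def Lambda_def poly_mapping_eq_iff fun_eq_iff
      plus_poly_mapping.rep_eq algebra_simps)

lemma coeff_sum_superset:
  assumes "finite X" "Poly_Mapping.keys f \<subseteq> X"
  shows "coeff_sum f = (\<Sum>x\<in>X. Poly_Mapping.lookup f x)"
  unfolding coeff_sum_def using assms by (intro sum.mono_neutral_left) (auto simp: in_keys_iff)

lemma coeff_sum_add: "coeff_sum (f + g) = coeff_sum f + coeff_sum g"
proof -
  let ?X = "Poly_Mapping.keys f \<union> Poly_Mapping.keys g"
  have "coeff_sum (f + g) = (\<Sum>x\<in>?X. Poly_Mapping.lookup (f + g) x)"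
    by (rule coeff_sum_superset) (simp_all add: Poly_Mapping.keys_add)
  then show ?thesis
    by (simp add: coeff_sum_superset[of ?X f] coeff_sum_superset[of ?X g]
        plus_poly_mapping.rep_eq sum.distrib)
qed

lemma coeff_sum_lscale: "coeff_sum (lscale r f) = r * coeff_sum f"
proof -
  have "coeff_sum (lscale r f) = (\<Sum>x\<in>Poly_Mapping.keys f. Poly_Mapping.lookup (lscale r f) x)"
    by (rule coeff_sum_superset) (auto simp: in_keys_iff)
  then show ?thesis
    by (simp add: coeff_sum_def sum_distrib_left)
qed

lemma coeff_sum_single: "coeff_sum (Poly_Mapping.single x r) = r"
  using coeff_sum_superset[of "{x}" "Poly_Mapping.single x r"] by simp

lemma coeff_sum_sum: "coeff_sum (sum h X) = (\<Sum>x\<in>X. coeff_sum (h x))"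
  by (induction X rule: infinite_finite_induct) (simp_all add: coeff_sum_add, simp_all add: coeff_sum_def)

lemma coeff_sum_relator: "coeff_sum (relator D c) = 0"
proof -
  have "relator D c + Poly_Mapping.single (left_arc D c) 1
      = Poly_Mapping.single (over_arc D c) (1 - tvar) + Poly_Mapping.single (right_arc D c) tvar"
    by (simp add: relator_def)
  from arg_cong[OF this, of coeff_sum] show ?thesis
    by (simp add: coeff_sum_add coeff_sum_single)
qed

lemma coeff_sum_relations: "f \<in> relations D \<Longrightarrow> coeff_sum f = 0"
  by (auto simp: relations_def linear_extension_def coeff_sum_sum coeff_sum_lscale coeff_sum_relator)

lemma zero_in_relations: "0 \<in> relations D"
  unfolding relations_def
  by (rule image_eqI[of _ _ 0]) (simp_all add: free_module_def linear_extension_def)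

lemma crowell_coset: "crowell D (relations D +>\<^bsub>free_module (arcs D)\<^esub> g) = coeff_sum g"
proof -
  have "relations D +>\<^bsub>free_module (arcs D)\<^esub> g = (\<lambda>f. f + g) ` relations D"
    unfolding a_r_coset_def' by (auto simp: free_module_def)
  moreover have "coeff_sum ` (\<lambda>f. f + g) ` relations D = (\<lambda>f. coeff_sum g) ` relations D"
    unfolding image_image by (rule image_cong) (simp_all add: coeff_sum_add coeff_sum_relations)
  moreover have "(\<lambda>f. coeff_sum g) ` relations D = {coeff_sum g}"
    using zero_in_relations[of D] by (simp add: image_constant)
  ultimately show ?thesis
    by (simp add: crowell_def)
qed

lemma crowell_arc_class: "crowell D (arc_class D a) = 1"
  by (simp add: arc_class_def crowell_coset coeff_sum_single)

end

theory Submission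
  imports Defs "HOL-Algebra.Free_Abelian_Groups"
begin

text \<open>
  A quandle isomorphism between presented medial quandles induces mutually inverse linear maps
  between the Alexander modules, because a quandle homomorphism into a \<open>\<Lambda>\<close>-module with
  \<open>x \<triangleright> y = t x + (1 - t) y\<close> is the same as a linear map on the Alexander module. These maps
  respect the Crowell maps, so this direction holds for any number of components.

  For the converse, the kernel \<open>K\<close> of the Crowell map acts on the medial quandle by displacements:
  the difference of the classes of two arcs \<open>a\<close>, \<open>b\<close> acts as \<open>\<beta>\<^sub>a \<beta>\<^sub>b\<inverse>\<close>, where \<open>\<beta>\<^sub>a x = x \<triangleright> a\<close>. The orbits are the components, and
  in the Alexander module an element \<open>k\<close> acts as translation by \<open>(1 - t) k\<close>. The stabilizer of an arc of component \<open>i\<close>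
  contains the longitude \<open>\<lambda>\<^sub>i\<close>, whereas the elements annihilated by \<open>1 - t\<close> are the integer
  combinations of all longitudes. As the diagram is planar, the longitudes add up to zero; so for two components
  each of them generates the annihilator, and the medial quandle embeds into the Alexander
  module. Its image is the union of two cosets of \<open>(1 - t) K\<close> that differ by a generator of
  \<open>K / (1 - t) K \<cong> \<int>\<close>, which any isomorphism of the kernels preserves up to sign.

  The sum of the longitudes vanishes because the relators, weighted by powers of \<open>t\<close>, add up to
  zero. The exponents are the indices of the diagram along its strands. They are expressed as degrees of difference
  quotients of the curves, which jump by one at a crossing.
\<close>

section \<open>Degrees of loops\<close>

text \<open>The obstacle is planarity: for two longitudes with no relation between them, neither
  would have to generate the annihilator of 1 - t, and the quandle could not be recovered from the
  module. The relation comes from a closed-loop argument. While a point runs once around a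
  component, its arc is weighted by t to the minus index, the index being the winding number of the
  diagram about the point. The jumps of this weighted arc add up to zero, and the two jumps at a
  crossing make up a unit times its relator.

  A point of a curve has no winding number with respect to that curve, because
  \<open>\<gamma> w - \<gamma> z\<close> vanishes at w = z. Dividing by w - z removes exactly this
  zero, and the value on the diagonal is a derivative, nonzero by immersion.

  The weighted dependence becomes a statement about longitudes since powers of t are 1 modulo 1 - t
  and the remaining factor 1 - t can be cancelled in a free module.

  The sign left open by an isomorphism of the kernels is harmless: if it is negative, the affine
  extension to the Alexander modules sends the base arc to an arc of the other component, so that
  the two cosets are exchanged.\<close>

definition has_degree :: "(complex \<Rightarrow> complex) \<Rightarrow> int \<Rightarrow> bool" where
  "has_degree f n \<longleftrightarrow> (\<exists>h. continuous_on {0..2*pi} h \<and> (\<forall>u\<in>{0..2*pi}. f (cis u) = exp (h u)) \<and>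
     h (2*pi) - h 0 = 2 * of_real pi * \<i> * of_int n)"

definition loop_degree :: "(complex \<Rightarrow> complex) \<Rightarrow> int" where
  "loop_degree f = (THE n. has_degree f n)"

text \<open>Two continuous logarithms of the same loop differ by a continuous function with values
  in the discrete set of multiples of 2 pi i, hence by a constant, which cancels in the
  increment.\<close>

lemma has_degree_unique:
  assumes "has_degree f m" "has_degree f n"
  shows "m = n"
proof -
  obtain g where g: "continuous_on {0..2*pi} g" "\<And>u. u \<in> {0..2*pi} \<Longrightarrow> f (cis u) = exp (g u)"
    "g (2*pi) - g 0 = 2 * of_real pi * \<i> * of_int m"
    using assms(1) unfolding has_degree_def by blast
  obtain h where h: "continuous_on {0..2*pi} h" "\<And>u. u \<in> {0..2*pi} \<Longrightarrow> f (cis u) = exp (h u)"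
    "h (2*pi) - h 0 = 2 * of_real pi * \<i> * of_int n"
    using assms(2) unfolding has_degree_def by blast
  have ints: "\<exists>k::int. g u - h u = 2 * of_real pi * \<i> * of_int k" if "u \<in> {0..2*pi}" for u
  proof -
    have "exp (g u) = exp (h u)" using g(2) h(2) that by metis
    then obtain k :: int where "g u = h u + of_int (2 * k) * of_real pi * \<i>"
      by (auto simp: exp_eq)
    then show ?thesis by (intro exI[of _ k]) (simp add: mult_ac)
  qed
  have "(\<lambda>u. g u - h u) constant_on {0..2*pi}"
  proof (rule continuous_discrete_range_constant)
    fix u assume u: "u \<in> {0..2*pi}"
    show "\<exists>e>0. \<forall>y. y \<in> {0..2*pi} \<and> g y - h y \<noteq> g u - h u \<longrightarrow> e \<le> norm ((g y - h y) - (g u - h u))"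
    proof (intro exI[of _ "2*pi"] conjI allI impI)
      fix y assume y: "y \<in> {0..2*pi} \<and> g y - h y \<noteq> g u - h u"
      obtain k l :: int where kl: "g u - h u = 2 * of_real pi * \<i> * of_int k"
        "g y - h y = 2 * of_real pi * \<i> * of_int l"
        using ints y u by meson
      then have "(g y - h y) - (g u - h u) = 2 * of_real pi * \<i> * of_int (l - k)"
        by (simp add: algebra_simps)
      moreover have "l \<noteq> k" using kl y by auto
      moreover have "1 \<le> norm (of_int (l - k) :: complex)"
        unfolding norm_of_int using \<open>l \<noteq> k\<close> by linarith
      ultimately show "2*pi \<le> norm ((g y - h y) - (g u - h u))"
        by (simp add: norm_mult del: of_int_diff)
    qed simp
  qed (use g h in \<open>auto intro!: continuous_intros\<close>)
  then have "g (2*pi) - h (2*pi) = g 0 - h 0"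
    unfolding constant_on_def by (metis atLeastAtMost_iff order_refl mult_nonneg_nonneg pi_ge_zero zero_le_numeral)
  then have "g (2*pi) - g 0 = h (2*pi) - h 0" by (simp add: algebra_simps)
  then show ?thesis using g(3) h(3) by simp
qed

lemma degree_eqI: "has_degree f n \<Longrightarrow> loop_degree f = n"
  unfolding loop_degree_def by (rule the_equality) (auto intro: has_degree_unique)

lemma has_degree_mult:
  assumes "has_degree f m" "has_degree g n"
  shows "has_degree (\<lambda>z. f z * g z) (m + n)"
proof -
  obtain h k where "continuous_on {0..2*pi} h" "\<And>u. u \<in> {0..2*pi} \<Longrightarrow> f (cis u) = exp (h u)"
    "h (2*pi) - h 0 = 2 * of_real pi * \<i> * of_int m"
    "continuous_on {0..2*pi} k" "\<And>u. u \<in> {0..2*pi} \<Longrightarrow> g (cis u) = exp (k u)"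
    "k (2*pi) - k 0 = 2 * of_real pi * \<i> * of_int n"
    using assms unfolding has_degree_def by blast
  then show ?thesis unfolding has_degree_def
    by (intro exI[of _ "\<lambda>u. h u + k u"])
      (auto intro!: continuous_intros simp: exp_add algebra_simps add_diff_add)
qed

lemma continuous_on_cis_circle:
  assumes "continuous_on (sphere 0 1) f"
  shows "continuous_on S (\<lambda>u. f (cis u))"
  by (rule continuous_on_compose2[OF assms]) (auto intro!: continuous_intros)

text \<open>An interval is contractible, so a nonvanishing function on it has a continuous
  logarithm; both ends of the interval map to the same point of the circle, which makes the
  increment a multiple of 2 pi i.\<close>

lemma has_degree_exists:
  assumes "continuous_on (sphere 0 1) f" "\<And>z. norm z = 1 \<Longrightarrow> f z \<noteq> 0"
  obtains n where "has_degree f n"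
proof -
  obtain h where h: "continuous_on {0..2*pi} h" "\<And>u. u \<in> {0..2*pi} \<Longrightarrow> f (cis u) = exp (h u)"
    using continuous_logarithm_on_contractible[of "{0..2*pi}" "\<lambda>u. f (cis u)"]
      continuous_on_cis_circle[OF assms(1)] assms(2) convex_imp_contractible[of "{0..2*pi}"]
    by (metis convex_real_interval(5) norm_cis)
  have "exp (h (2*pi)) = exp (h 0)"
    using h(2)[of 0] h(2)[of "2*pi"] by simp
  then obtain n :: int where "h (2*pi) = h 0 + of_int (2 * n) * of_real pi * \<i>"
    by (auto simp: exp_eq)
  then have "has_degree f n"
    unfolding has_degree_def using h by (intro exI[of _ h]) (auto simp: mult_ac)
  then show ?thesis using that by blast
qed

lemma has_degree_degree:
  assumes "continuous_on (sphere 0 1) f" "\<And>z. norm z = 1 \<Longrightarrow> f z \<noteq> 0"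
  shows "has_degree f (loop_degree f)"
  using has_degree_exists[OF assms] degree_eqI by metis

text \<open>Rouche: the quotient of the two loops stays in the domain of the principal logarithm.\<close>

lemma has_degree_near:
  assumes g: "has_degree g n" and cont: "continuous_on (sphere 0 1) f" "continuous_on (sphere 0 1) g"
    and near: "\<And>z. norm z = 1 \<Longrightarrow> norm (f z - g z) < norm (g z)"
  shows "has_degree f n"
proof -
  have g0: "g (cis u) \<noteq> 0" for u using near[of "cis u"] by auto
  let ?q = "\<lambda>u. f (cis u) / g (cis u)"
  have "norm (?q u - 1) < 1" for u
  proof -
    have "?q u - 1 = (f (cis u) - g (cis u)) / g (cis u)"
      using g0[of u] by (simp add: diff_divide_distrib)
    then show ?thesis using near[of "cis u"] g0[of u] by (simp add: norm_divide)
  qed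
  then have "\<bar>Re (?q u - 1)\<bar> < 1" for u
    using abs_Re_le_cmod order_le_less_trans by blast
  then have re: "Re (?q u) > 0" for u
    unfolding minus_complex.simps one_complex.simps abs_less_iff by (smt (verit))
  have q: "?q u \<notin> \<real>\<^sub>\<le>\<^sub>0" for u
    using re[of u] unfolding complex_nonpos_Reals_iff by linarith
  have qn: "?q u \<noteq> 0" for u
    using re[of u] by (metis less_irrefl zero_complex.simps(1))
  obtain h where h: "continuous_on {0..2*pi} h" "\<And>u. u \<in> {0..2*pi} \<Longrightarrow> g (cis u) = exp (h u)"
    "h (2*pi) - h 0 = 2 * of_real pi * \<i> * of_int n"
    using g unfolding has_degree_def by blast
  have "continuous_on {0..2*pi} (\<lambda>u. Ln (?q u))"
    by (rule continuous_on_Ln'[OF continuous_on_divide[OF continuous_on_cis_circle[OF cont(1)]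
            continuous_on_cis_circle[OF cont(2)]]]) (use q(1) g0 in blast)+
  moreover have "f (cis u) = exp (h u + Ln (?q u))" if "u \<in> {0..2*pi}" for u
    using h(2)[OF that] g0[of u] qn[of u] by (simp add: exp_add exp_Ln)
  ultimately show ?thesis unfolding has_degree_def using h
    by (intro exI[of _ "\<lambda>u. h u + Ln (?q u)"]) (auto intro!: continuous_intros)
qed

text \<open>An inner zero is compared with the identity and an outer one with the constant
  \<open>- \<rho>\<close>. This case distinction is the source of every jump by one below.\<close>

lemma has_degree_linear:
  assumes "norm \<rho> \<noteq> 1"
  shows "has_degree (\<lambda>z. z - \<rho>) (if norm \<rho> < 1 then 1 else 0)"
proof (cases "norm \<rho> < 1")
  case True
  have "has_degree (\<lambda>z. z) 1"
    unfolding has_degree_def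
    by (intro exI[of _ "\<lambda>u. \<i> * of_real u"]) (auto intro!: continuous_intros simp: cis_conv_exp)
  then show ?thesis
    using True by (auto intro!: has_degree_near[of "\<lambda>z. z"] continuous_intros)
next
  case False
  then have "norm \<rho> > 1" using assms by simp
  then have "\<rho> \<noteq> 0" by auto
  then have "has_degree (\<lambda>z. - \<rho>) 0"
    unfolding has_degree_def
    by (intro exI[of _ "\<lambda>u. Ln (- \<rho>)"]) (auto simp: exp_Ln)
  then show ?thesis
    using False \<open>norm \<rho> > 1\<close> by (auto intro!: has_degree_near[of "\<lambda>z. - \<rho>"] continuous_intros)
qed

lemma nonzero_circle_bound:
  fixes f :: "complex \<Rightarrow> complex"
  assumes "continuous_on (sphere 0 1) f" "\<And>z. norm z = 1 \<Longrightarrow> f z \<noteq> 0"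
  obtains m where "m > 0" "\<And>z. norm z = 1 \<Longrightarrow> m \<le> norm (f z)"
proof -
  have "continuous_on (sphere 0 1) (\<lambda>z. norm (f z))" by (intro continuous_intros assms)
  then obtain w where w: "w \<in> sphere (0::complex) 1" "\<And>z. z \<in> sphere 0 1 \<Longrightarrow> norm (f w) \<le> norm (f z)"
    using continuous_attains_inf[of "sphere (0::complex) 1" "\<lambda>z. norm (f z)"] by auto
  show ?thesis by (rule that[of "norm (f w)"]) (use w assms in auto)
qed

text \<open>The limit loop is bounded away from zero on the compact circle, so uniformly close loops
  satisfy the Rouche inequality. That they do not vanish is a consequence, not an
  assumption.\<close>

lemma degree_eventually:
  assumes cont: "continuous_on (sphere 0 1) f" "\<And>z. norm z = 1 \<Longrightarrow> f z \<noteq> 0"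
    and contg: "\<forall>\<^sub>F s in F. continuous_on (sphere 0 1) (g s)"
    and unif: "uniform_limit (sphere 0 1) g f F"
  shows "\<forall>\<^sub>F s in F. has_degree (g s) (loop_degree f)"
proof -
  obtain m where m: "m > 0" "\<And>z. norm z = 1 \<Longrightarrow> m \<le> norm (f z)"
    using nonzero_circle_bound[OF cont] by blast
  show ?thesis
    using contg uniform_limitD[OF unif m(1)]
  proof eventually_elim
    case (elim s)
    show ?case
    proof (rule has_degree_near[OF has_degree_degree[OF cont] elim(1) cont(1)])
      fix z :: complex assume "norm z = 1"
      then show "norm (g s z - f z) < norm (f z)"
        using bspec[OF elim(2), of z] m(2)[of z] by (simp add: dist_norm)
    qed
  qed
qed

lemma circle_bound:
  fixes f :: "complex \<Rightarrow> complex"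
  assumes "continuous_on (sphere 0 1) f"
  obtains M where "M > 0" "\<And>z. norm z = 1 \<Longrightarrow> norm (f z) \<le> M"
proof -
  have "bounded (f ` sphere 0 1)"
    by (intro compact_imp_bounded compact_continuous_image assms) simp
  then obtain M where "\<forall>x\<in>sphere 0 1. norm (f x) \<le> M" unfolding bounded_iff by auto
  then show ?thesis by (intro that[of "max M 1"]) (auto intro: max.coboundedI1)
qed

text \<open>
  A zero of a family of loops passes through the circle at \<open>p\<close>, moving at velocity \<open>w\<close>
  transversal to the circle; the family is compared with \<open>(z - (p + \<eta> s)) * q z\<close>.
\<close>

lemma degree_zero_crossing:
  fixes \<eta> :: "real \<Rightarrow> complex"
  assumes p: "norm p = 1" and q: "continuous_on (sphere 0 1) q" "\<And>z. norm z = 1 \<Longrightarrow> q z \<noteq> 0"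
    and contf: "\<forall>\<^sub>F s in at_right 0. continuous_on (sphere 0 1) (f s)"
    and unif: "uniform_limit (sphere 0 1) f (\<lambda>z. (z - p) * q z) (at_right 0)"
    and local: "\<And>e. e > 0 \<Longrightarrow> \<exists>d>0. \<forall>\<^sub>F s in at_right 0. \<forall>z. norm z = 1 \<and> norm (z - p) < d \<longrightarrow>
       norm (f s z - (z - p) * q z + \<eta> s * q p) \<le> e * norm (\<eta> s)"
    and \<eta>: "((\<lambda>s. \<eta> s /\<^sub>R s) \<longlongrightarrow> w) (at_right 0)"
    and w: "Re (w * cnj p) \<noteq> 0"
  shows "\<forall>\<^sub>F s in at_right 0. has_degree (f s) (loop_degree q + (if Re (w * cnj p) < 0 then 1 else 0))"
proof -
  obtain m where m: "m > 0" "\<And>z. norm z = 1 \<Longrightarrow> m \<le> norm (q z)"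
    using nonzero_circle_bound[OF q] by blast
  obtain M where M: "M > 0" "\<And>z. norm z = 1 \<Longrightarrow> norm (q z) \<le> M"
    using circle_bound[OF q(1)] by blast
  \<comment> \<open>\<open>b\<close> is the sign of the radial velocity of the moving zero and
    \<open>r\<close> its absolute value; negative \<open>b\<close> means motion into the
    disc.\<close>
  define b where "b = (if Re (w * cnj p) < 0 then -1 else 1 :: real)"
  define r where "r = b * Re (w * cnj p)"
  have r: "r > 0" using w by (auto simp: r_def b_def)
  define W where "W = norm w + 1"
  have W: "W > 0" by (simp add: W_def add_nonneg_pos)
  \<comment> \<open>A cone constant: r / 2 bounds the radial speed from below and \<open>W\<close>
    the total speed from above, so the radial part of \<open>\<eta> s\<close> is at least
    \<open>k\<close> times its length.\<close>
  define k where "k = min 1 (r / (2 * W))"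
  have k: "k > 0" "k \<le> 1" "k * W \<le> r / 2"
  proof -
    have "k * W \<le> r / (2 * W) * W" using W by (intro mult_right_mono) (auto simp: k_def)
    then show "k * W \<le> r / 2" using W by simp
  qed (use r W in \<open>auto simp: k_def\<close>)
  have "((\<lambda>s. b * Re ((\<eta> s /\<^sub>R s) * cnj p)) \<longlongrightarrow> r) (at_right 0)"
    unfolding r_def by (intro tendsto_intros \<eta>)
  then have e1: "\<forall>\<^sub>F s in at_right 0. b * Re ((\<eta> s /\<^sub>R s) * cnj p) > r / 2"
    by (rule order_tendstoD) (use r in simp)
  have e2: "\<forall>\<^sub>F s in at_right 0. norm (\<eta> s /\<^sub>R s) < W"
    by (rule order_tendstoD(2)[OF tendsto_norm[OF \<eta>]]) (simp add: W_def)
  have e3: "\<forall>\<^sub>F s in at_right (0::real). s > 0" by (simp add: eventually_at_right_less)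
  have cone: "\<forall>\<^sub>F s in at_right 0. b * Re (\<eta> s * cnj p) \<ge> k * norm (\<eta> s) \<and> \<eta> s \<noteq> 0"
    using e1 e2 e3
  proof eventually_elim
    case (elim s)
    have n: "norm (\<eta> s) / s \<le> W" using elim(2,3) by (simp add: divide_inverse mult.commute)
    have "k * (norm (\<eta> s) / s) \<le> k * W" using n k by (intro mult_left_mono) auto
    also have "\<dots> \<le> r / 2" by (rule k)
    also have "\<dots> < b * (Re (\<eta> s * cnj p) / s)"
    proof -
      have "Re ((\<eta> s /\<^sub>R s) * cnj p) = Re (\<eta> s * cnj p) / s"
        by (simp add: divide_inverse algebra_simps)
      then show ?thesis using elim(1) by simp
    qed
    finally have "s * (k * (norm (\<eta> s) / s)) < s * (b * (Re (\<eta> s * cnj p) / s))"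
      using elim(3) by (rule mult_strict_left_mono)
    then have "k * norm (\<eta> s) < b * Re (\<eta> s * cnj p)" using elim(3) by simp
    moreover from this have "\<eta> s \<noteq> 0" by auto
    ultimately show ?case by simp
  qed
  have "((\<lambda>s. s *\<^sub>R (\<eta> s /\<^sub>R s)) \<longlongrightarrow> 0 *\<^sub>R w) (at_right 0)" by (intro tendsto_intros \<eta>)
  then have "((\<lambda>s. s *\<^sub>R (\<eta> s /\<^sub>R s)) \<longlongrightarrow> 0) (at_right 0)" by simp
  then have \<eta>0: "(\<eta> \<longlongrightarrow> 0) (at_right 0)"
    by (rule Lim_transform_eventually) (use e3 in eventually_elim, simp)
  \<comment> \<open>Near \<open>p\<close> there are two error terms of size \<open>e\<close> times
    the length of \<open>\<eta> s\<close>. Together they stay below m k / 2 times that length, the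
    lower bound for the comparison loop.\<close>
  define e where "e = m * k / 8"
  have e: "e > 0" using m k by (simp add: e_def)
  obtain d1 where d1: "d1 > 0" "\<forall>\<^sub>F s in at_right 0. \<forall>z. norm z = 1 \<and> norm (z - p) < d1 \<longrightarrow>
       norm (f s z - (z - p) * q z + \<eta> s * q p) \<le> e * norm (\<eta> s)"
    using local[OF e] by blast
  obtain d2 where d2: "d2 > 0" "\<And>z. norm z = 1 \<Longrightarrow> norm (z - p) < d2 \<Longrightarrow> norm (q z - q p) < e"
    using q(1) p e unfolding continuous_on_iff by (force simp: dist_norm)
  define d where "d = min d1 d2"
  have d: "d > 0" using d1 d2 by (simp add: d_def)
  \<comment> \<open>The three bounds absorb the quadratic term in the norm of
    \<open>p + \<eta> s\<close>, keep the zero within d / 2 of \<open>p\<close>, and make the error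
    small away from \<open>p\<close>.\<close>
  define \<epsilon> where "\<epsilon> = min (k / 2) (min (d / 2) (m * d / (8 * M)))"
  have \<epsilon>: "\<epsilon> > 0" using k d m M by (simp add: \<epsilon>_def)
  have small: "\<forall>\<^sub>F s in at_right 0. norm (\<eta> s) < \<epsilon>"
    using order_tendstoD(2)[OF tendsto_norm[OF \<eta>0], of \<epsilon>] \<epsilon> by simp
  have far: "\<forall>\<^sub>F s in at_right 0. \<forall>z\<in>sphere 0 1. dist (f s z) ((z - p) * q z) < m * d / 8"
    by (rule uniform_limitD[OF unif]) (use m d in simp)
  show ?thesis
    using cone small far d1(2) contf
  proof eventually_elim
    case (elim s)
    let ?\<eta> = "\<eta> s"
    have \<eta>1: "norm ?\<eta> < k / 2" "norm ?\<eta> < d / 2" "norm ?\<eta> * M < m * d / 8"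
      using elim(2) M by (auto simp: \<epsilon>_def field_simps)
    have \<eta>pos: "norm ?\<eta> > 0" using elim(1) by simp
    have sq: "(norm (p + ?\<eta>))\<^sup>2 = 1 + 2 * Re (?\<eta> * cnj p) + (norm ?\<eta>)\<^sup>2"
    proof -
      have "(norm (p + ?\<eta>))\<^sup>2 = (norm p)\<^sup>2 + 2 * Re (?\<eta> * cnj p) + (norm ?\<eta>)\<^sup>2"
        unfolding cmod_power2 by (simp add: power2_eq_square algebra_simps)
      then show ?thesis using p by simp
    qed
    \<comment> \<open>In the squared norm the radial part enters linearly and outweighs the
      quadratic term, so the zero leaves the circle on the side given by \<open>b\<close>, at a
      distance proportional to the displacement.\<close>
    have off: "\<bar>norm (p + ?\<eta>) - 1\<bar> \<ge> k / 2 * norm ?\<eta> \<and> (norm (p + ?\<eta>) < 1 \<longleftrightarrow> b < 0) \<and> norm (p + ?\<eta>) \<noteq> 1"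
    proof (cases "b < 0")
      case True
      then have "b = -1" by (auto simp: b_def split: if_splits)
      then have "Re (?\<eta> * cnj p) \<le> - (k * norm ?\<eta>)" using elim(1) by simp
      moreover have "norm ?\<eta> * norm ?\<eta> \<le> norm ?\<eta> * (k / 2)"
        using \<eta>1 by (intro mult_left_mono) auto
      ultimately have "(norm (p + ?\<eta>))\<^sup>2 \<le> 1 - 2 * (k * norm ?\<eta>) + norm ?\<eta> * (k / 2)"
        unfolding sq power2_eq_square[of "norm ?\<eta>"] by linarith
      also have "\<dots> \<le> (1 - k / 2 * norm ?\<eta>)\<^sup>2"
        using k \<eta>pos by (simp add: power2_eq_square algebra_simps)
      finally have "norm (p + ?\<eta>) \<le> 1 - k / 2 * norm ?\<eta>"
        by (rule power2_le_imp_le) (use k \<eta>1 mult_mono[of "k/2" 1 "norm ?\<eta>" 1] in auto)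
      moreover have "k / 2 * norm ?\<eta> > 0" using k \<eta>pos by simp
      ultimately show ?thesis using True by auto
    next
      case False
      then have "b = 1" by (auto simp: b_def split: if_splits)
      then have "(norm (p + ?\<eta>))\<^sup>2 \<ge> 1 + 2 * k * norm ?\<eta> + (norm ?\<eta>)\<^sup>2"
        unfolding sq using elim(1) by simp
      moreover have "(k * norm ?\<eta>)\<^sup>2 \<le> (norm ?\<eta>)\<^sup>2"
        using k by (intro power_mono) (auto intro: mult_left_le_one_le)
      moreover have "(1 + k / 2 * norm ?\<eta>)\<^sup>2 = 1 + k * norm ?\<eta> + (k * norm ?\<eta>)\<^sup>2 / 4"
        by (simp add: power2_eq_square algebra_simps)
      moreover have "0 \<le> k * norm ?\<eta>" "0 \<le> (norm ?\<eta>)\<^sup>2" using k by simp_all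
      ultimately have "(1 + k / 2 * norm ?\<eta>)\<^sup>2 \<le> (norm (p + ?\<eta>))\<^sup>2"
        using k by linarith
      then have "1 + k / 2 * norm ?\<eta> \<le> norm (p + ?\<eta>)" by (rule power2_le_imp_le) simp
      moreover have "k / 2 * norm ?\<eta> > 0" using k \<eta>pos by simp
      ultimately show ?thesis using False by auto
    qed
    have "has_degree (\<lambda>z. q z * (z - (p + ?\<eta>))) (loop_degree q + (if norm (p + ?\<eta>) < 1 then 1 else 0))"
      by (rule has_degree_mult[OF has_degree_degree[OF q] has_degree_linear]) (use off in auto)
    moreover have "(if norm (p + ?\<eta>) < 1 then 1 else 0) = (if Re (w * cnj p) < 0 then 1 else 0 :: int)"
      using off by (simp add: b_def)
    ultimately have deg: "has_degree (\<lambda>z. q z * (z - (p + ?\<eta>))) (loop_degree q + (if Re (w * cnj p) < 0 then 1 else 0))"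
      by simp
    show ?case
    proof (rule has_degree_near[OF deg elim(5)])
      show "continuous_on (sphere 0 1) (\<lambda>z. q z * (z - (p + ?\<eta>)))"
        by (intro continuous_intros q)
      fix z :: complex assume z: "norm z = 1"
      have diff: "f s z - q z * (z - (p + ?\<eta>)) = (f s z - (z - p) * q z + ?\<eta> * q p) + ?\<eta> * (q z - q p)"
        by (simp add: algebra_simps)
      show "norm (f s z - q z * (z - (p + ?\<eta>))) < norm (q z * (z - (p + ?\<eta>)))"
      \<comment> \<open>Within \<open>d\<close> of \<open>p\<close> the comparison loop may be as
        small as the displacement, and the local hypothesis is needed; elsewhere it is bounded below
        and uniform convergence suffices.\<close>
      proof (cases "norm (z - p) < d")
        case True
        have "norm (f s z - q z * (z - (p + ?\<eta>))) \<le> e * norm ?\<eta> + norm ?\<eta> * e"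
          unfolding diff
        proof (rule order_trans[OF norm_triangle_ineq add_mono])
          show "norm (f s z - (z - p) * q z + ?\<eta> * q p) \<le> e * norm ?\<eta>"
            using elim(4) z True by (simp add: d_def)
          show "norm (?\<eta> * (q z - q p)) \<le> norm ?\<eta> * e"
            using d2(2)[of z] z True by (auto simp: norm_mult d_def intro!: mult_left_mono)
        qed
        also have "\<dots> < m * (k / 2 * norm ?\<eta>)" using m k \<eta>pos by (simp add: e_def field_simps)
        also have "\<dots> \<le> norm (q z) * norm (z - (p + ?\<eta>))"
        proof (rule mult_mono[OF m(2)[OF z]])
          have "\<bar>norm (p + ?\<eta>) - 1\<bar> \<le> norm (z - (p + ?\<eta>))"
            using norm_triangle_ineq3[of z "p + ?\<eta>"] z by (simp add: norm_minus_commute abs_minus_commute)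
          then show "k / 2 * norm ?\<eta> \<le> norm (z - (p + ?\<eta>))" using off by linarith
        qed (use k m in auto)
        finally show ?thesis by (simp add: norm_mult)
      next
        case False
        have eq: "f s z - q z * (z - (p + ?\<eta>)) = (f s z - (z - p) * q z) + ?\<eta> * q z"
          by (simp add: algebra_simps)
        have "norm (f s z - q z * (z - (p + ?\<eta>))) \<le> norm (f s z - (z - p) * q z) + norm ?\<eta> * norm (q z)"
          unfolding eq by (rule order_trans[OF norm_triangle_ineq]) (simp add: norm_mult)
        also have "\<dots> \<le> m * d / 8 + norm ?\<eta> * M"
          using elim(3) z M(2)[OF z] by (intro add_mono mult_left_mono) (auto simp: dist_norm less_imp_le)
        also have "\<dots> < m * (d / 2)" using \<eta>1(3) mult_pos_pos[OF m(1) d] by (simp only: times_divide_eq_right)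
        also have "\<dots> \<le> norm (q z) * norm (z - (p + ?\<eta>))"
        proof (rule mult_mono[OF m(2)[OF z]])
          have "norm (z - p) \<le> norm (z - (p + ?\<eta>)) + norm ?\<eta>"
            using norm_triangle_ineq[of "z - (p + ?\<eta>)" ?\<eta>] by simp
          then show "d / 2 \<le> norm (z - (p + ?\<eta>))" using False \<eta>1 by linarith
        qed (use d m in auto)
        finally show ?thesis by (simp add: norm_mult)
      qed
    qed
  qed
qed

section \<open>Difference quotients of closed curves\<close>

text \<open>Only the values on the circle matter, so this is the limit of chord quotients along the
  circle: the angular derivative divided by i z, the angular derivative of the circle
  itself.\<close>

definition circle_deriv :: "(complex \<Rightarrow> complex) \<Rightarrow> complex \<Rightarrow> complex" where
  "circle_deriv \<gamma> z = vector_derivative (\<lambda>s. \<gamma> (z * cis s)) (at 0) / (\<i> * z)"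

text \<open>The diagonal value is the continuous extension for a continuously differentiable curve.
  The quotient has no zero at w = z when the curve is immersed.\<close>

definition dquot :: "(complex \<Rightarrow> complex) \<Rightarrow> complex \<Rightarrow> complex \<Rightarrow> complex" where
  "dquot \<gamma> z w = (if w = z then circle_deriv \<gamma> z else (\<gamma> w - \<gamma> z) / (w - z))"

lemma circle_point_near:
  assumes "norm z0 = 1" "\<delta> > 0"
  obtains d where "d > 0"
    "\<And>z. norm z = 1 \<Longrightarrow> norm (z - z0) < d \<Longrightarrow> \<exists>a. z = z0 * cis a \<and> \<bar>a\<bar> < \<delta>"
proof -
  have "isCont Arg 1" by (rule continuous_at_Arg) (simp add: complex_nonpos_Reals_iff)
  then obtain d where d: "d > 0" "\<And>z. norm (z - 1) < d \<Longrightarrow> \<bar>Arg z\<bar> < \<delta>"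
    using assms(2) unfolding continuous_at_eps_delta by (auto simp: dist_norm)
  have nz: "z0 \<noteq> 0" using assms by auto
  show ?thesis
  proof (rule that[OF d(1)])
    fix z assume z: "norm z = 1" "norm (z - z0) < d"
    have "z / z0 - 1 = (z - z0) / z0" using nz by (simp add: diff_divide_distrib)
    then have "norm (z / z0 - 1) < d" using z assms(1) by (simp add: norm_divide)
    then have "\<bar>Arg (z / z0)\<bar> < \<delta>" using d by blast
    moreover have "cis (Arg (z / z0)) = z / z0"
    proof -
      have "z \<noteq> 0" using z by auto
      then show ?thesis using z nz assms(1) cis_Arg[of "z / z0"] by (simp add: sgn_eq norm_divide)
    qed
    ultimately show "\<exists>a. z = z0 * cis a \<and> \<bar>a\<bar> < \<delta>" using nz by (intro exI[of _ "Arg (z / z0)"]) simp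
  qed
qed

lemma has_vector_derivative_cis: "((\<lambda>x. c * cis x) has_vector_derivative c * (\<i> * cis x)) (at x within S)"
proof -
  have "((\<lambda>x. (\<lambda>w. c * exp (\<i> * w)) (complex_of_real x)) has_vector_derivative c * (\<i> * exp (\<i> * complex_of_real x))) (at x within S)"
    by (rule has_vector_derivative_real_field) (auto intro!: derivative_eq_intros)
  then show ?thesis by (simp add: cis_conv_exp)
qed

lemma isCont_cis: "isCont cis x"
  using has_vector_derivative_continuous[OF has_vector_derivative_cis[of 1 x UNIV]] by simp

context
  fixes \<gamma> :: "complex \<Rightarrow> complex"
  assumes C1: "(\<lambda>s. \<gamma> (cis s)) C1_differentiable_on UNIV"
begin

lemma circle_vector_derivative:
  assumes "norm z = 1"
  shows "((\<lambda>s. \<gamma> (z * cis s)) has_vector_derivative circle_deriv \<gamma> z * (\<i> * z)) (at 0)"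
proof -
  obtain t where t: "z = cis t" using assms by (metis cis_Arg norm_one norm_zero sgn_eq zero_neq_one div_by_1 of_real_1)
  have "(\<lambda>s. \<gamma> (cis s)) differentiable (at t)"
    using C1 by (simp add: C1_differentiable_on_eq)
  then obtain v where "((\<lambda>s. \<gamma> (cis s)) has_vector_derivative v) (at t)"
    using vector_derivative_works by blast
  then have "((\<lambda>s. \<gamma> (cis s)) has_vector_derivative v) (at (t + 0))" by simp
  then have "((\<lambda>s. \<gamma> (cis s)) \<circ> (\<lambda>s. t + s) has_vector_derivative 1 *\<^sub>R v) (at 0)"
    by (intro vector_diff_chain_at) (auto intro!: derivative_eq_intros)
  then have *: "((\<lambda>s. \<gamma> (z * cis s)) has_vector_derivative v) (at 0)"
    by (simp add: o_def t cis_mult)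
  have "z \<noteq> 0" using assms by auto
  then show ?thesis
    using * vector_derivative_at[OF *] by (simp add: circle_deriv_def)
qed

text \<open>Differentiability with both points moving: the derivative is continuous, so the mean
  value inequality applies near the point. It yields a bound by angles, which has to be converted
  into one by chords.\<close>

lemma circle_strict_deriv:
  assumes z0: "norm z0 = 1" and e: "e > 0"
  obtains d where "d > 0" "\<And>z w. norm z = 1 \<Longrightarrow> norm w = 1 \<Longrightarrow> norm (z - z0) < d \<Longrightarrow> norm (w - z0) < d \<Longrightarrow>
    norm (\<gamma> w - \<gamma> z - circle_deriv \<gamma> z0 * (w - z)) \<le> e * norm (w - z)"
proof -
  let ?c = "circle_deriv \<gamma> z0"
  obtain t where t: "z0 = cis t" using z0 by (metis cis_Arg norm_one norm_zero sgn_eq zero_neq_one div_by_1 of_real_1)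
  obtain G where G: "\<And>x. ((\<lambda>s. \<gamma> (cis s)) has_vector_derivative G x) (at x)" "continuous_on UNIV G"
    using C1 unfolding C1_differentiable_on_def by auto
  have Gt: "G t = ?c * (\<i> * z0)"
  proof -
    have "((\<lambda>s. \<gamma> (cis s)) has_vector_derivative G t) (at (t + 0))" using G by simp
    then have "((\<lambda>s. \<gamma> (cis s)) \<circ> (\<lambda>s. t + s) has_vector_derivative 1 *\<^sub>R G t) (at 0)"
      by (intro vector_diff_chain_at) (auto intro!: derivative_eq_intros)
    then have "((\<lambda>s. \<gamma> (z0 * cis s)) has_vector_derivative G t) (at 0)"
      by (simp add: o_def t cis_mult)
    from vector_derivative_unique_at[OF this circle_vector_derivative[OF z0]] show ?thesis .
  qed
  \<comment> \<open>\<open>F\<close> is the error, with small derivative near \<open>t\<close>.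
    \<open>H\<close> is the deviation of the chord from its linear approximation; its slope of at
    most 1/2 bounds an angle by twice the chord.\<close>
  define F where "F x = \<gamma> (cis x) - ?c * cis x" for x
  define H where "H x = 1 * cis x - of_real x * (\<i> * z0)" for x
  have F': "(F has_vector_derivative (G x - ?c * (\<i> * cis x))) (at x within S)" for x S
    unfolding F_def by (intro derivative_intros has_vector_derivative_at_within[OF G(1)] has_vector_derivative_cis)
  have H': "(H has_vector_derivative (1 * (\<i> * cis x) - 1 * (\<i> * z0))) (at x within S)" for x S
    unfolding H_def
    by (intro derivative_intros has_vector_derivative_cis) (auto intro!: derivative_eq_intros)
  have "continuous_on UNIV (\<lambda>x. norm (G x - ?c * (\<i> * cis x)))"
    by (intro continuous_intros G)
  then have "isCont (\<lambda>x. norm (G x - ?c * (\<i> * cis x))) t" by (simp add: continuous_on_eq_continuous_at)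
  moreover have "norm (G t - ?c * (\<i> * cis t)) < e / 2" using e by (simp add: Gt t)
  ultimately have "\<forall>\<^sub>F x in at t. norm (G x - ?c * (\<i> * cis x)) < e / 2"
    unfolding isCont_def by (rule order_tendstoD(2))
  then obtain d1 where d1: "d1 > 0" "\<And>x. dist x t < d1 \<Longrightarrow> norm (G x - ?c * (\<i> * cis x)) \<le> e / 2"
    using \<open>norm (G t - ?c * (\<i> * cis t)) < e / 2\<close> unfolding eventually_at by (metis less_imp_le UNIV_I)
  have "isCont (\<lambda>x. norm (1 * (\<i> * cis x) - 1 * (\<i> * z0))) t" by (intro continuous_intros isCont_cis)
  moreover have "norm (1 * (\<i> * cis t) - 1 * (\<i> * z0)) < 1 / 2" by (simp add: t)
  ultimately have "\<forall>\<^sub>F x in at t. norm (1 * (\<i> * cis x) - 1 * (\<i> * z0)) < 1 / 2"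
    unfolding isCont_def by (rule order_tendstoD(2))
  then obtain d2 where d2: "d2 > 0" "\<And>x. dist x t < d2 \<Longrightarrow> norm (1 * (\<i> * cis x) - 1 * (\<i> * z0)) \<le> 1 / 2"
    using \<open>norm (1 * (\<i> * cis t) - 1 * (\<i> * z0)) < 1 / 2\<close> unfolding eventually_at by (metis less_imp_le UNIV_I)
  define \<delta> where "\<delta> = min d1 d2"
  have \<delta>: "\<delta> > 0" using d1 d2 by (simp add: \<delta>_def)
  have key: "norm (F b - F a) \<le> e * norm (cis b - cis a)" if "dist a t < \<delta>" "dist b t < \<delta>" for a b
  proof -
    have ab: "a \<in> ball t \<delta>" "b \<in> ball t \<delta>" using that by (auto simp: dist_commute)
    have 1: "norm (F b - F a) \<le> e / 2 * norm (b - a)"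
    proof (rule differentiable_bound[of "ball t \<delta>" F "\<lambda>x h. h *\<^sub>R (G x - ?c * (\<i> * cis x))" "e/2", OF convex_ball])
      fix x assume x: "x \<in> ball t \<delta>"
      show "(F has_derivative (\<lambda>h. h *\<^sub>R (G x - ?c * (\<i> * cis x)))) (at x within ball t \<delta>)"
        using F' unfolding has_vector_derivative_def .
      show "onorm (\<lambda>h. h *\<^sub>R (G x - ?c * (\<i> * cis x))) \<le> e / 2"
        using d1(2)[of x] x by (simp add: onorm_scaleR_left_lemma onorm_scaleR_left onorm_id \<delta>_def dist_commute)
    qed (use ab in auto)
    have 2: "norm (H b - H a) \<le> 1 / 2 * norm (b - a)"
    proof (rule differentiable_bound[of "ball t \<delta>" H "\<lambda>x h. h *\<^sub>R (1 * (\<i> * cis x) - 1 * (\<i> * z0))" "1/2", OF convex_ball])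
      fix x assume x: "x \<in> ball t \<delta>"
      show "(H has_derivative (\<lambda>h. h *\<^sub>R (1 * (\<i> * cis x) - 1 * (\<i> * z0)))) (at x within ball t \<delta>)"
        using H' unfolding has_vector_derivative_def .
      show "onorm (\<lambda>h. h *\<^sub>R (1 * (\<i> * cis x) - 1 * (\<i> * z0))) \<le> 1 / 2"
        using d2(2)[of x] x by (simp add: onorm_scaleR_left_lemma onorm_scaleR_left onorm_id \<delta>_def dist_commute)
    qed (use ab in auto)
    have "of_real (b - a) * (\<i> * z0) = (cis b - cis a) - (H b - H a)"
      by (simp add: H_def algebra_simps)
    then have "norm (of_real (b - a) * (\<i> * z0)) \<le> norm (cis b - cis a) + norm (H b - H a)"
      by (metis norm_triangle_ineq4)
    then have "norm (b - a) \<le> norm (cis b - cis a) + norm (H b - H a)"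
      using z0 by (simp add: norm_mult del: of_real_diff)
    then have "norm (b - a) \<le> 2 * norm (cis b - cis a)" using 2 by linarith
    then have "e / 2 * norm (b - a) \<le> e / 2 * (2 * norm (cis b - cis a))"
      using e by (intro mult_left_mono) auto
    then show ?thesis using 1 by simp
  qed
  obtain d where d: "d > 0" "\<And>z. norm z = 1 \<Longrightarrow> norm (z - z0) < d \<Longrightarrow> \<exists>a. z = z0 * cis a \<and> \<bar>a\<bar> < \<delta>"
    using circle_point_near[OF z0 \<delta>] by blast
  show ?thesis
  proof (rule that[OF d(1)])
    fix z w :: complex assume "norm z = 1" "norm w = 1" "norm (z - z0) < d" "norm (w - z0) < d"
    then obtain a b where ab: "z = cis (t + a)" "\<bar>a\<bar> < \<delta>" "w = cis (t + b)" "\<bar>b\<bar> < \<delta>"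
      using d(2) by (metis t cis_mult)
    have "norm (F (t + b) - F (t + a)) \<le> e * norm (cis (t + b) - cis (t + a))"
      by (rule key) (use ab in \<open>auto simp: dist_norm\<close>)
    then show "norm (\<gamma> w - \<gamma> z - ?c * (w - z)) \<le> e * norm (w - z)"
      unfolding F_def ab by (simp add: algebra_simps)
  qed
qed

lemma continuous_on_circle: "continuous_on (sphere 0 1) \<gamma>"
  unfolding continuous_on_iff
proof (intro ballI allI impI)
  fix z0 :: complex and e :: real assume z0: "z0 \<in> sphere 0 1" and e: "e > 0"
  let ?c = "circle_deriv \<gamma> z0"
  obtain d where d: "d > 0" "\<And>z w. norm z = 1 \<Longrightarrow> norm w = 1 \<Longrightarrow> norm (z - z0) < d \<Longrightarrow> norm (w - z0) < d \<Longrightarrow>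
    norm (\<gamma> w - \<gamma> z - ?c * (w - z)) \<le> 1 * norm (w - z)"
    using circle_strict_deriv[of z0 1] z0 by auto
  define K where "K = 1 + norm ?c"
  have K: "K > 0" by (simp add: K_def add_pos_nonneg)
  show "\<exists>d>0. \<forall>w\<in>sphere 0 1. dist w z0 < d \<longrightarrow> dist (\<gamma> w) (\<gamma> z0) < e"
  proof (intro exI[of _ "min d (e / K)"] conjI ballI impI)
    fix w :: complex assume w: "w \<in> sphere 0 1" "dist w z0 < min d (e / K)"
    have "norm (\<gamma> w - \<gamma> z0) \<le> norm (\<gamma> w - \<gamma> z0 - ?c * (w - z0)) + norm (?c * (w - z0))"
      using norm_triangle_ineq[of "\<gamma> w - \<gamma> z0 - ?c * (w - z0)" "?c * (w - z0)"] by simp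
    also have "\<dots> \<le> K * norm (w - z0)"
      using d(2)[of z0 w] w z0 d(1) by (simp add: K_def norm_mult dist_norm distrib_right)
    also have "\<dots> < e" using w K by (simp add: dist_norm field_simps)
    finally show "dist (\<gamma> w) (\<gamma> z0) < e" by (simp add: dist_norm)
  qed (use d e K in auto)
qed

text \<open>Off the diagonal this is strict differentiability divided by w - z. On the diagonal the
  derivatives at \<open>z\<close> and \<open>z0\<close> are compared through a single chord at
  \<open>z\<close>, short enough for the strict estimates at both points.\<close>

lemma dquot_near_diagonal:
  assumes z0: "norm z0 = 1" and e: "e > 0"
  obtains d where "d > 0" "\<And>z w. norm z = 1 \<Longrightarrow> norm w = 1 \<Longrightarrow> norm (z - z0) < d \<Longrightarrow> norm (w - z0) < d \<Longrightarrow>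
    norm (dquot \<gamma> z w - circle_deriv \<gamma> z0) \<le> e"
proof -
  have e2: "e / 2 > 0" using e by simp
  let ?c = "circle_deriv \<gamma>"
  obtain d where d: "d > 0" "\<And>z w. norm z = 1 \<Longrightarrow> norm w = 1 \<Longrightarrow> norm (z - z0) < d \<Longrightarrow> norm (w - z0) < d \<Longrightarrow>
    norm (\<gamma> w - \<gamma> z - ?c z0 * (w - z)) \<le> e / 2 * norm (w - z)"
    using circle_strict_deriv[OF z0 e2] by blast
  show ?thesis
  proof (rule that[OF d(1)])
    fix z w :: complex assume zw: "norm z = 1" "norm w = 1" "norm (z - z0) < d" "norm (w - z0) < d"
    show "norm (dquot \<gamma> z w - ?c z0) \<le> e"
    proof (cases "w = z")
      case False
      have "dquot \<gamma> z w - ?c z0 = (\<gamma> w - \<gamma> z - ?c z0 * (w - z)) / (w - z)"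
        using False by (simp add: dquot_def diff_divide_distrib)
      then have "norm (dquot \<gamma> z w - ?c z0) \<le> e / 2"
        using d(2)[OF zw] False by (simp add: norm_divide divide_le_eq)
      then show ?thesis using e by simp
    next
      case True
      define d' where "d' = d - norm (z - z0)"
      have d': "d' > 0" using zw by (simp add: d'_def)
      obtain r where r: "r > 0" "\<And>u w. norm u = 1 \<Longrightarrow> norm w = 1 \<Longrightarrow> norm (u - z) < r \<Longrightarrow> norm (w - z) < r \<Longrightarrow>
        norm (\<gamma> w - \<gamma> u - ?c z * (w - u)) \<le> e / 2 * norm (w - u)"
        using circle_strict_deriv[OF zw(1) e2] by blast
      obtain w' where w': "norm w' = 1" "w' \<noteq> z" "norm (w' - z) < min r d'"
      proof -
        have "isCont (\<lambda>s. norm (z * cis s - z)) 0" by (intro continuous_intros isCont_cis)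
        then have "((\<lambda>s. norm (z * cis s - z)) \<longlongrightarrow> 0) (at 0)" by (simp add: isCont_def)
        then have "\<forall>\<^sub>F s in at 0. norm (z * cis s - z) < min r d'"
          by (rule order_tendstoD(2)) (use r d' in simp)
        moreover have "\<forall>\<^sub>F s in at (0::real). s \<noteq> 0 \<and> \<bar>s\<bar> < pi"
          unfolding eventually_at by (intro exI[of _ pi]) auto
        ultimately have "\<forall>\<^sub>F s in at (0::real). norm (z * cis s - z) < min r d' \<and> s \<noteq> 0 \<and> \<bar>s\<bar> < pi"
          by eventually_elim auto
        then obtain s where s: "norm (z * cis s - z) < min r d'" "s \<noteq> 0" "\<bar>s\<bar> < pi"
          using eventually_happens[of _ "at (0::real)"] by auto
        have "cis s \<noteq> 1"
        proof
          assume "cis s = 1"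
          then have "Arg (cis s) = 0" by simp
          then show False using s Arg_cis[of s] by (auto simp: abs_less_iff)
        qed
        then show thesis
          using s zw(1) by (intro that[of "z * cis s"]) (auto simp: norm_mult)
      qed
      have "norm (w' - z0) < d"
        using w' norm_triangle_ineq[of "w' - z" "z - z0"] by (simp add: d'_def)
      then have 1: "norm (\<gamma> w' - \<gamma> z - ?c z0 * (w' - z)) \<le> e / 2 * norm (w' - z)"
        using d(2) zw w' by blast
      have 2: "norm (\<gamma> w' - \<gamma> z - ?c z * (w' - z)) \<le> e / 2 * norm (w' - z)"
        using r zw w' by simp
      have "(?c z - ?c z0) * (w' - z) = (\<gamma> w' - \<gamma> z - ?c z0 * (w' - z)) - (\<gamma> w' - \<gamma> z - ?c z * (w' - z))"
        by (simp add: algebra_simps)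
      then have "norm ((?c z - ?c z0) * (w' - z)) \<le> e / 2 * norm (w' - z) + e / 2 * norm (w' - z)"
        using 1 2 norm_triangle_ineq4 by (smt (verit))
      also have "\<dots> = e * norm (w' - z)" by simp
      finally have "norm (?c z - ?c z0) \<le> e" using w' by (simp add: norm_mult)
      then show ?thesis using True by (simp add: dquot_def)
    qed
  qed
qed

text \<open>Joint continuity is what the moving base point requires: by compactness the loops
  \<open>dquot \<gamma> z\<close> then depend uniformly on z.\<close>

lemma continuous_on_dquot: "continuous_on (sphere 0 1 \<times> sphere 0 1) (\<lambda>(z, w). dquot \<gamma> z w)"
  unfolding continuous_on_eq_continuous_within
proof
  fix p :: "complex \<times> complex" assume p: "p \<in> sphere 0 1 \<times> sphere 0 1"
  obtain z0 w0 where [simp]: "p = (z0, w0)" by force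
  have n: "norm z0 = 1" "norm w0 = 1" using p by auto
  let ?S = "sphere 0 1 \<times> sphere 0 1 :: (complex \<times> complex) set"
  show "continuous (at p within ?S) (\<lambda>(z, w). dquot \<gamma> z w)"
  proof (cases "z0 = w0")
    case True
    show ?thesis unfolding continuous_within_eps_delta
    proof (intro allI impI)
      fix e :: real assume e: "e > 0"
      have e2: "e / 2 > 0" using e by simp
      obtain d where d: "d > 0" "\<And>z w. norm z = 1 \<Longrightarrow> norm w = 1 \<Longrightarrow> norm (z - z0) < d \<Longrightarrow> norm (w - z0) < d \<Longrightarrow>
        norm (dquot \<gamma> z w - circle_deriv \<gamma> z0) \<le> e / 2"
        using dquot_near_diagonal[OF n(1) e2] by blast
      show "\<exists>d>0. \<forall>x'\<in>?S. dist x' p < d \<longrightarrow> dist (case x' of (z, w) \<Rightarrow> dquot \<gamma> z w) (case p of (z, w) \<Rightarrow> dquot \<gamma> z w) < e"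
      proof (intro exI[of _ d] conjI ballI impI d(1))
        fix x' assume x': "x' \<in> ?S" "dist x' p < d"
        obtain z w where [simp]: "x' = (z, w)" by force
        have "dist z z0 < d" "dist w z0 < d"
          using x'(2) dist_fst_le[of x' p] dist_snd_le[of x' p] True by auto
        then have "norm (dquot \<gamma> z w - circle_deriv \<gamma> z0) \<le> e / 2"
          using d(2)[of z w] x'(1) by (auto simp: dist_norm)
        then show "dist (case x' of (z, w) \<Rightarrow> dquot \<gamma> z w) (case p of (z, w) \<Rightarrow> dquot \<gamma> z w) < e"
          using True e by (simp add: dist_norm dquot_def)
      qed
    qed
  next
    case False
    let ?f = "\<lambda>(z, w). (\<gamma> w - \<gamma> z) / (w - z)"
    let ?U = "- {x :: complex \<times> complex. fst x = snd x}"
    have "continuous_on (?S \<inter> ?U) ?f"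
      unfolding case_prod_unfold
      by (intro continuous_intros continuous_on_compose2[OF continuous_on_circle]) auto
    then have "continuous_on (?S \<inter> ?U) (\<lambda>(z, w). dquot \<gamma> z w)"
      by (rule continuous_on_eq) (auto simp: dquot_def)
    then have "continuous (at p within ?S \<inter> ?U) (\<lambda>(z, w). dquot \<gamma> z w)"
      using p False by (auto simp: continuous_on_eq_continuous_within)
    moreover have "open ?U"
      by (intro open_Compl closed_Collect_eq continuous_intros)
    then have "at p within ?S \<inter> ?U = at p within ?S"
      by (rule at_within_nhd[rotated]) (use False in auto)
    ultimately show ?thesis by simp
  qed
qed

end

section \<open>Indices along the strands of a diagram\<close>

lemma has_vector_derivative_quotient:
  assumes "(f has_vector_derivative v) (at (0::real))"
  shows "((\<lambda>s. (f s - f 0) /\<^sub>R s) \<longlongrightarrow> v) (at 0)"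
proof (rule LIM_zero_cancel, rule tendsto_norm_zero_cancel)
  have "((\<lambda>h. norm (f (0 + h) - f 0 - h *\<^sub>R v) / norm h) \<longlongrightarrow> 0) (at 0)"
    using assms unfolding has_vector_derivative_def has_derivative_at by blast
  then show "((\<lambda>s. norm ((f s - f 0) /\<^sub>R s - v)) \<longlongrightarrow> 0) (at 0)"
  proof (rule Lim_transform_eventually)
    show "\<forall>\<^sub>F s in at 0. norm (f (0 + s) - f 0 - s *\<^sub>R v) / norm s = norm ((f s - f 0) /\<^sub>R s - v)"
      unfolding eventually_at
    proof (intro exI[of _ 1] conjI ballI impI)
      fix s :: real assume "s \<noteq> 0 \<and> dist s 0 < 1"
      then have "(f s - f 0) /\<^sub>R s - v = (f s - f 0 - s *\<^sub>R v) /\<^sub>R s"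
        by (simp add: scaleR_diff_right)
      then show "norm (f (0 + s) - f 0 - s *\<^sub>R v) / norm s = norm ((f s - f 0) /\<^sub>R s - v)"
        by (simp add: divide_inverse mult.commute)
    qed simp
  qed
qed

lemma uniform_limit_compact_product:
  fixes f :: "'a :: metric_space \<Rightarrow> 'b :: metric_space \<Rightarrow> 'c :: metric_space"
  assumes "compact S" "compact T" and cont: "continuous_on (S \<times> T) (\<lambda>(x, y). f x y)"
    and lim: "(x \<longlongrightarrow> x0) F" and S: "\<forall>\<^sub>F s in F. x s \<in> S" "x0 \<in> S"
  shows "uniform_limit T (\<lambda>s. f (x s)) (f x0) F"
proof (rule uniform_limitI)
  fix e :: real assume e: "e > 0"
  have "uniformly_continuous_on (S \<times> T) (\<lambda>(x, y). f x y)"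
    by (intro compact_uniformly_continuous cont compact_Times assms)
  then obtain d where d: "d > 0" "\<And>p q. p \<in> S \<times> T \<Longrightarrow> q \<in> S \<times> T \<Longrightarrow> dist q p < d \<Longrightarrow>
    dist (case q of (x, y) \<Rightarrow> f x y) (case p of (x, y) \<Rightarrow> f x y) < e"
    using e unfolding uniformly_continuous_on_def by meson
  show "\<forall>\<^sub>F s in F. \<forall>y\<in>T. dist (f (x s) y) (f x0 y) < e"
    using tendstoD[OF lim d(1)] S(1)
  proof eventually_elim
    case (elim s)
    show ?case
    proof
      fix y assume "y \<in> T"
      then show "dist (f (x s) y) (f x0 y) < e"
        using d(2)[of "(x0, y)" "(x s, y)"] elim S(2) by (simp add: dist_Pair_Pair)
    qed
  qed
qed

lemma tendsto_rotate: "((\<lambda>s. z * cis (\<sigma> * s)) \<longlongrightarrow> z) (at (0::real) within S)"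
proof -
  have "isCont (\<lambda>s. z * cis (\<sigma> * s)) 0"
    by (intro continuous_intros isCont_o2[OF _ isCont_cis])
  then have "((\<lambda>s. z * cis (\<sigma> * s)) \<longlongrightarrow> z * cis (\<sigma> * 0)) (at 0)" unfolding isCont_def .
  then show ?thesis by (auto intro: tendsto_within_subset)
qed

definition rotate_point :: "nat \<times> complex \<Rightarrow> real \<Rightarrow> nat \<times> complex" where
  "rotate_point x s = (fst x, snd x * cis s)"

text \<open>The winding number of the whole diagram about one of its points; for the component
  through the point, the degree of the difference quotient plays the role of the winding number just
  to the right of the strand. At a crossing one of the loops has a zero and the value is arbitrary,
  so that only one-sided values are used there.\<close>

definition index :: "diagram \<Rightarrow> nat \<times> complex \<Rightarrow> int" where
  "index D x = loop_degree (dquot (curve D (fst x)) (snd x)) +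
     (\<Sum>j\<in>{..<ncomp D} - {fst x}. loop_degree (\<lambda>w. curve D j w - pos D x))"

locale link =
  fixes D :: diagram
  assumes diagram: "link_diagram D"
begin

lemma C1: "i < ncomp D \<Longrightarrow> (\<lambda>s. curve D i (cis s)) C1_differentiable_on UNIV"
  using diagram by (simp add: link_diagram_def)

lemma circles_iff: "(i, z) \<in> circles D \<longleftrightarrow> i < ncomp D \<and> norm z = 1"
  by (auto simp: circles_def)

lemma pos_rotate_point: "pos D (rotate_point x s) = curve D (fst x) (snd x * cis s)"
  by (simp add: pos_def rotate_point_def)

lemma
  assumes "x \<in> circles D"
  shows velocity_eq: "velocity D x = circle_deriv (curve D (fst x)) (snd x) * (\<i> * snd x)"
    and circle_deriv_nonzero: "circle_deriv (curve D (fst x)) (snd x) \<noteq> 0"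
    and velocity_derivative:
      "((\<lambda>s. pos D (rotate_point x (\<sigma> * s))) has_vector_derivative \<sigma> *\<^sub>R velocity D x) (at 0)"
proof -
  have x: "fst x < ncomp D" "norm (snd x) = 1" using assms by (cases x; simp add: circles_iff)+
  have *: "((\<lambda>s. curve D (fst x) (snd x * cis s)) has_vector_derivative
      circle_deriv (curve D (fst x)) (snd x) * (\<i> * snd x)) (at 0)"
    by (rule circle_vector_derivative[OF C1 x(2)]) (rule x(1))
  then show v: "velocity D x = circle_deriv (curve D (fst x)) (snd x) * (\<i> * snd x)"
    unfolding velocity_def by (rule vector_derivative_at)
  moreover have "\<forall>x\<in>circles D. velocity D x \<noteq> 0"
    using diagram by (simp add: link_diagram_def)
  then have "velocity D x \<noteq> 0" using assms by (rule bspec)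
  ultimately show "circle_deriv (curve D (fst x)) (snd x) \<noteq> 0" by auto
  have "((\<lambda>s. curve D (fst x) (snd x * cis s)) has_vector_derivative velocity D x) (at (\<sigma> * 0))"
    using * v by simp
  then have "((\<lambda>s. curve D (fst x) (snd x * cis s)) \<circ> (\<lambda>s. \<sigma> * s) has_vector_derivative \<sigma> *\<^sub>R velocity D x) (at 0)"
    by (intro vector_diff_chain_at) (auto intro!: derivative_eq_intros)
  then show "((\<lambda>s. pos D (rotate_point x (\<sigma> * s))) has_vector_derivative \<sigma> *\<^sub>R velocity D x) (at 0)"
    by (simp add: o_def pos_rotate_point)
qed

lemma continuous_curve: "i < ncomp D \<Longrightarrow> continuous_on (sphere 0 1) (curve D i)"
  by (intro continuous_on_circle C1)

lemma continuous_dquot: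
  assumes "i < ncomp D" "norm z = 1"
  shows "continuous_on (sphere 0 1) (dquot (curve D i) z)"
proof -
  have "continuous_on (sphere 0 1) ((\<lambda>(z, w). dquot (curve D i) z w) \<circ> (\<lambda>w. (z, w)))"
    using assms
    by (intro continuous_on_compose continuous_on_subset[OF continuous_on_dquot[OF C1]] continuous_intros) auto
  then show ?thesis by (simp add: o_def)
qed

lemma uniform_limit_dquot:
  assumes "i < ncomp D" "norm z = 1"
  shows "uniform_limit (sphere 0 1) (\<lambda>s. dquot (curve D i) (z * cis (\<sigma> * s))) (dquot (curve D i) z) (at 0 within S)"
  by (rule uniform_limit_compact_product[OF compact_sphere compact_sphere continuous_on_dquot[OF C1[OF assms(1)]] tendsto_rotate])
    (use assms in \<open>auto simp: norm_mult\<close>)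

lemma tendsto_pos:
  assumes "x \<in> circles D"
  shows "((\<lambda>s. pos D (rotate_point x (\<sigma> * s))) \<longlongrightarrow> pos D x) (at 0 within S)"
proof -
  have "((\<lambda>s. pos D (rotate_point x (\<sigma> * s))) \<longlongrightarrow> pos D (rotate_point x (\<sigma> * 0))) (at 0)"
    using has_vector_derivative_continuous[OF velocity_derivative[OF assms]] by (simp add: isCont_def)
  then show ?thesis by (auto simp: rotate_point_def intro: tendsto_within_subset)
qed

lemma uniform_limit_diff:
  assumes "x \<in> circles D"
  shows "uniform_limit (sphere 0 1) (\<lambda>s w. curve D j w - pos D (rotate_point x (\<sigma> * s)))
    (\<lambda>w. curve D j w - pos D x) (at 0 within S)"
proof (rule uniform_limitI)
  fix e :: real assume "e > 0"
  from tendstoD[OF tendsto_pos[OF assms, of \<sigma> S] this]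
  show "\<forall>\<^sub>F s in at 0 within S. \<forall>w\<in>sphere 0 1. dist (curve D j w - pos D (rotate_point x (\<sigma> * s))) (curve D j w - pos D x) < e"
    by eventually_elim (simp add: dist_norm norm_minus_commute)
qed

lemma degree_diff_eventually:
  assumes "x \<in> circles D" "j < ncomp D" "\<And>w. norm w = 1 \<Longrightarrow> curve D j w \<noteq> pos D x"
  shows "\<forall>\<^sub>F s in at 0 within S. loop_degree (\<lambda>w. curve D j w - pos D (rotate_point x (\<sigma> * s))) = loop_degree (\<lambda>w. curve D j w - pos D x)"
proof -
  have "\<forall>\<^sub>F s in at 0 within S. has_degree (\<lambda>w. curve D j w - pos D (rotate_point x (\<sigma> * s))) (loop_degree (\<lambda>w. curve D j w - pos D x))"
    by (rule degree_eventually[OF _ _ _ uniform_limit_diff[OF assms(1)]])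
      (use assms in \<open>auto intro!: always_eventually continuous_intros continuous_curve\<close>)
  then show ?thesis by eventually_elim (rule degree_eqI)
qed

lemma dquot_nonzero:
  assumes "x \<in> circles D" "norm w = 1" "w \<noteq> snd x \<Longrightarrow> curve D (fst x) w \<noteq> pos D x"
  shows "dquot (curve D (fst x)) (snd x) w \<noteq> 0"
  using circle_deriv_nonzero[OF assms(1)] assms(3) by (auto simp: dquot_def pos_def)

lemma degree_dquot_eventually:
  assumes "x \<in> circles D" "\<And>w. norm w = 1 \<Longrightarrow> w \<noteq> snd x \<Longrightarrow> curve D (fst x) w \<noteq> pos D x"
  shows "\<forall>\<^sub>F s in at 0 within S. loop_degree (dquot (curve D (fst x)) (snd x * cis (\<sigma> * s))) = loop_degree (dquot (curve D (fst x)) (snd x))"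
proof -
  have x: "fst x < ncomp D" "norm (snd x) = 1" using assms(1) by (cases x; simp add: circles_iff)+
  have "\<forall>\<^sub>F s in at 0 within S. has_degree (dquot (curve D (fst x)) (snd x * cis (\<sigma> * s))) (loop_degree (dquot (curve D (fst x)) (snd x)))"
    by (rule degree_eventually[OF _ _ _ uniform_limit_dquot[OF x]])
      (use x assms dquot_nonzero[OF assms(1)] in \<open>auto intro!: always_eventually continuous_dquot simp: norm_mult\<close>)
  then show ?thesis by eventually_elim (rule degree_eqI)
qed

lemma not_crossing:
  assumes "x \<in> circles D" "pos D x \<notin> crossings D" "y \<in> circles D" "y \<noteq> x"
  shows "pos D y \<noteq> pos D x"
  using assms unfolding crossings_def by blast

text \<open>Away from the crossings none of the finitely many loops in \<open>index\<close> has a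
  zero, so every degree survives a small motion of the point.\<close>

lemma index_locally_constant:
  assumes "x \<in> circles D" "pos D x \<notin> crossings D"
  shows "\<forall>\<^sub>F s in at 0 within S. index D (rotate_point x s) = index D x"
proof -
  have "\<forall>\<^sub>F s in at 0 within S. loop_degree (dquot (curve D (fst x)) (snd x * cis (1 * s))) = loop_degree (dquot (curve D (fst x)) (snd x))"
  proof (rule degree_dquot_eventually[OF assms(1)])
    fix w :: complex assume "norm w = 1" "w \<noteq> snd x"
    then show "curve D (fst x) w \<noteq> pos D x"
      using not_crossing[OF assms, of "(fst x, w)"] assms(1) by (cases x) (auto simp: circles_iff pos_def)
  qed
  moreover have "\<forall>\<^sub>F s in at 0 within S. \<forall>j\<in>{..<ncomp D} - {fst x}.
     loop_degree (\<lambda>w. curve D j w - pos D (rotate_point x (1 * s))) = loop_degree (\<lambda>w. curve D j w - pos D x)"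
  proof (rule eventually_ball_finite, simp, intro ballI degree_diff_eventually[OF assms(1)])
    fix j w :: _ assume j: "j \<in> {..<ncomp D} - {fst x}" "norm (w::complex) = 1"
    show "curve D j w \<noteq> pos D x"
      using not_crossing[OF assms, of "(j, w)"] j by (cases x) (auto simp: circles_iff pos_def)
  qed auto
  ultimately show ?thesis
    by eventually_elim (simp add: index_def rotate_point_def)
qed

lemma displacement_quotient:
  assumes x: "x \<in> circles D" and y: "y \<in> circles D"
  shows "((\<lambda>s. ((pos D (rotate_point x (\<sigma> * s)) - pos D x) / circle_deriv (curve D (fst y)) (snd y)) /\<^sub>R s)
      \<longlongrightarrow> \<sigma> *\<^sub>R velocity D x / circle_deriv (curve D (fst y)) (snd y)) (at 0 within S)"
proof -
  have "((\<lambda>s. (pos D (rotate_point x (\<sigma> * s)) - pos D (rotate_point x (\<sigma> * 0))) /\<^sub>R s) \<longlongrightarrow> \<sigma> *\<^sub>R velocity D x) (at 0)"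
    by (rule has_vector_derivative_quotient[OF velocity_derivative[OF x]])
  then have "((\<lambda>s. (pos D (rotate_point x (\<sigma> * s)) - pos D x) /\<^sub>R s) \<longlongrightarrow> \<sigma> *\<^sub>R velocity D x) (at 0)"
    by (simp add: rotate_point_def)
  then have "((\<lambda>s. (pos D (rotate_point x (\<sigma> * s)) - pos D x) /\<^sub>R s / circle_deriv (curve D (fst y)) (snd y)) \<longlongrightarrow> \<sigma> *\<^sub>R velocity D x / circle_deriv (curve D (fst y)) (snd y)) (at 0)"
    by (intro tendsto_divide tendsto_const circle_deriv_nonzero y)
  then show ?thesis by (auto intro: tendsto_within_subset simp: scaleR_conv_of_real mult.assoc)
qed

text \<open>Dividing by the derivative at y pulls the motion of x back to the parameter circle of y,
  where the tangent direction is i times \<open>snd y\<close>. So the radial part is a determinant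
  of velocities; the minus sign says that moving to the left of a counterclockwise circle is moving
  inwards.\<close>

lemma displacement_sign:
  assumes y: "y \<in> circles D"
  shows "Re ((\<sigma> *\<^sub>R velocity D x / circle_deriv (curve D (fst y)) (snd y)) * cnj (snd y)) =
     - (\<sigma> * cross (velocity D y) (velocity D x)) / (norm (velocity D y))\<^sup>2"
proof -
  let ?d = "circle_deriv (curve D (fst y)) (snd y)"
  have n: "norm (snd y) = 1" using y by (cases y) (simp add: circles_iff)
  have "snd y * cnj (snd y) = 1" using n by (simp add: complex_norm_square[symmetric])
  then have cn: "cnj (snd y) = 1 / snd y" using n by (metis nonzero_eq_divide_eq mult.commute norm_zero zero_neq_one)
  have d: "?d \<noteq> 0" by (rule circle_deriv_nonzero[OF y])
  have v: "velocity D y = ?d * (\<i> * snd y)" by (rule velocity_eq[OF y])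
  have nv: "velocity D y \<noteq> 0" using d v n by auto
  have "(\<sigma> *\<^sub>R velocity D x / ?d) * cnj (snd y) = of_real \<sigma> * (\<i> * (velocity D x / velocity D y))"
    using d n unfolding cn v by (auto simp: scaleR_conv_of_real field_simps)
  also have "velocity D x / velocity D y = of_real (1 / (norm (velocity D y))\<^sup>2) * (cnj (velocity D y) * velocity D x)"
    using nv by (simp add: complex_div_cnj[of "velocity D x"] mult.commute)
  finally have fin: "(\<sigma> *\<^sub>R velocity D x / ?d) * cnj (snd y) = of_real \<sigma> * (\<i> *
     (of_real (1 / (norm (velocity D y))\<^sup>2) * (cnj (velocity D y) * velocity D x)))" .
  have "Re (of_real a * (\<i> * (of_real r * c))) = - (a * (r * Im c))" for a r c by simp
  then have "Re ((\<sigma> *\<^sub>R velocity D x / ?d) * cnj (snd y)) =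
     - (\<sigma> * (1 / (norm (velocity D y))\<^sup>2 * Im (cnj (velocity D y) * velocity D x)))"
    unfolding fin by (simp only:)
  then show ?thesis by (simp add: cross_def)
qed

lemma dquot_mult: "(w - z) * dquot \<gamma> z w = \<gamma> w - \<gamma> z"
  by (simp add: dquot_def)

lemma double_point:
  assumes "x \<in> circles D" "y \<in> circles D" "x \<noteq> y" "pos D x = pos D y"
    and "z \<in> circles D" "pos D z = pos D x"
  shows "z = x \<or> z = y"
proof -
  have "\<forall>x\<in>circles D. \<forall>y\<in>circles D. \<forall>z\<in>circles D.
        pos D x = pos D y \<and> pos D y = pos D z \<longrightarrow> x = y \<or> y = z \<or> x = z"
    using diagram unfolding link_diagram_def by (elim conjE) assumption
  then show ?thesis using assms by metis
qed

lemma cross_nonzero: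
  assumes "x \<in> circles D" "y \<in> circles D" "x \<noteq> y" "pos D x = pos D y"
  shows "cross (velocity D y) (velocity D x) \<noteq> 0"
proof -
  have "\<forall>x\<in>circles D. \<forall>y\<in>circles D. x \<noteq> y \<and> pos D x = pos D y \<longrightarrow> cross (velocity D x) (velocity D y) \<noteq> 0"
    using diagram unfolding link_diagram_def by (elim conjE) assumption
  then show ?thesis using assms by metis
qed

context
  fixes x y :: "nat \<times> complex" and \<sigma> :: real
  assumes x: "x \<in> circles D" and y: "y \<in> circles D" and neq: "x \<noteq> y" and pos_eq: "pos D x = pos D y"
    and \<sigma>: "\<sigma> = 1 \<or> \<sigma> = -1"
begin

text \<open>To first order, the offset from \<open>snd y\<close> of the zero that the perturbed loop
  has there: the shift of x, pulled back by the derivative of the strand through y.\<close>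

abbreviation (input) "displacement s \<equiv>
  (pos D (rotate_point x (\<sigma> * s)) - pos D x) / circle_deriv (curve D (fst y)) (snd y)"

lemma direction:
  defines "w \<equiv> \<sigma> *\<^sub>R velocity D x / circle_deriv (curve D (fst y)) (snd y)"
  shows "Re (w * cnj (snd y)) \<noteq> 0" "Re (w * cnj (snd y)) < 0 \<longleftrightarrow> \<sigma> * cross (velocity D y) (velocity D x) > 0"
proof -
  have v: "velocity D y \<noteq> 0"
    using circle_deriv_nonzero[OF y] velocity_eq[OF y] y by (cases y) (auto simp: circles_iff)
  have nz: "cross (velocity D y) (velocity D x) \<noteq> 0" by (rule cross_nonzero[OF x y neq pos_eq])
  show "Re (w * cnj (snd y)) \<noteq> 0" "Re (w * cnj (snd y)) < 0 \<longleftrightarrow> \<sigma> * cross (velocity D y) (velocity D x) > 0"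
    unfolding w_def displacement_sign[OF y] using v nz \<sigma> by (auto simp: divide_less_0_iff zero_less_divide_iff)
qed

text \<open>At the crossing the loop factors as (w - p) times the difference quotient at the
  parameter p of y. Moving x pushes the zero p off the circle, inwards exactly if x moves to the
  left of the strand of y.\<close>

lemma degree_crossing_other_component:
  assumes ne: "fst x \<noteq> fst y"
  shows "\<forall>\<^sub>F s in at_right 0. loop_degree (\<lambda>w. curve D (fst y) w - pos D (rotate_point x (\<sigma> * s))) =
     loop_degree (dquot (curve D (fst y)) (snd y)) + (if \<sigma> * cross (velocity D y) (velocity D x) > 0 then 1 else 0)"
proof -
  let ?\<gamma> = "curve D (fst y)" and ?p = "snd y"
  have y': "fst y < ncomp D" "norm ?p = 1" using y by (cases y; simp add: circles_iff)+
  have "\<forall>\<^sub>F s in at_right 0. has_degree (\<lambda>w. ?\<gamma> w - pos D (rotate_point x (\<sigma> * s)))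
     (loop_degree (dquot ?\<gamma> ?p) + (if Re ((\<sigma> *\<^sub>R velocity D x / circle_deriv ?\<gamma> ?p) * cnj ?p) < 0 then 1 else 0))"
  proof (rule degree_zero_crossing[OF y'(2), where \<eta> = "\<lambda>s. displacement s"])
    show "continuous_on (sphere 0 1) (dquot ?\<gamma> ?p)" by (rule continuous_dquot[OF y'])
    show "dquot ?\<gamma> ?p w \<noteq> 0" if "norm w = 1" for w
    proof (rule dquot_nonzero[OF y that])
      assume "w \<noteq> snd y"
      then show "curve D (fst y) w \<noteq> pos D y"
        using double_point[OF x y neq pos_eq, of "(fst y, w)"] y' that ne pos_eq
        by (cases x; cases y) (auto simp: circles_iff pos_def)
    qed
    show "\<forall>\<^sub>F s in at_right 0. continuous_on (sphere 0 1) (\<lambda>w. ?\<gamma> w - pos D (rotate_point x (\<sigma> * s)))"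
      by (intro always_eventually allI continuous_intros continuous_curve y')
    show "uniform_limit (sphere 0 1) (\<lambda>s w. ?\<gamma> w - pos D (rotate_point x (\<sigma> * s))) (\<lambda>z. (z - ?p) * dquot ?\<gamma> ?p z) (at_right 0)"
    proof -
      have "pos D x = ?\<gamma> ?p" using pos_eq by (simp add: pos_def)
      then show ?thesis using uniform_limit_diff[OF x, of "fst y"] by (simp add: dquot_mult)
    qed
    \<comment> \<open>The perturbation does not depend on the parameter, so the error is exactly
      zero and any radius works.\<close>
    show "\<exists>d>0. \<forall>\<^sub>F s in at_right 0. \<forall>z. norm z = 1 \<and> norm (z - ?p) < d \<longrightarrow>
       norm (?\<gamma> z - pos D (rotate_point x (\<sigma> * s)) - (z - ?p) * dquot ?\<gamma> ?p z + displacement s * dquot ?\<gamma> ?p ?p)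
         \<le> e * norm (displacement s)" if "e > 0" for e
      using that circle_deriv_nonzero[OF y] pos_eq
      by (intro exI[of _ 1] conjI always_eventually) (auto simp: dquot_mult, auto simp: dquot_def pos_def)
  qed (use displacement_quotient[OF x y] direction(1) in auto)
  then show ?thesis
    unfolding direction(2) by eventually_elim (rule degree_eqI)
qed

end

text \<open>At a self-crossing the difference quotient based at z1 has a zero at z2; here both
  factors are divided out. The two branches keep the value meaningful at z1 as well as at
  z2.\<close>

definition dquot2 :: "(complex \<Rightarrow> complex) \<Rightarrow> complex \<Rightarrow> complex \<Rightarrow> complex \<Rightarrow> complex" where
  "dquot2 \<gamma> z1 z2 w = (if w = z2 then dquot \<gamma> z2 w / (w - z1) else dquot \<gamma> z1 w / (w - z2))"

lemma
  assumes "z1 \<noteq> z2" "\<gamma> z1 = \<gamma> z2"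
  shows dquot2_mult: "(w - z2) * dquot2 \<gamma> z1 z2 w = dquot \<gamma> z1 w"
    and dquot2_commute: "dquot2 \<gamma> z1 z2 = dquot2 \<gamma> z2 z1"
  using assms by (auto simp: dquot2_def dquot_def fun_eq_iff)

text \<open>The two symmetric formulas are continuous away from z2 and away from z1 respectively,
  and these two open sets cover the circle.\<close>

lemma continuous_dquot2:
  assumes "i < ncomp D" "norm z1 = 1" "norm z2 = 1" "z1 \<noteq> z2" "curve D i z1 = curve D i z2"
  shows "continuous_on (sphere 0 1) (dquot2 (curve D i) z1 z2)"
proof -
  let ?Q = "dquot2 (curve D i) z1 z2" and ?S = "sphere 0 1 :: complex set"
  have eq: "?Q w = dquot (curve D i) z1 w / (w - z2)" if "w \<noteq> z2" for w
    using that by (simp add: dquot2_def)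
  have eq': "?Q w = dquot (curve D i) z2 w / (w - z1)" if "w \<noteq> z1" for w
    using that assms by (subst dquot2_commute) (auto simp: dquot2_def)
  have c1: "continuous_on (?S - {z2}) ?Q"
    by (subst continuous_on_cong[OF HOL.refl eq])
      (auto intro!: continuous_intros continuous_on_subset[OF continuous_dquot[OF assms(1,2)]])
  have c2: "continuous_on (?S - {z1}) ?Q"
    by (subst continuous_on_cong[OF HOL.refl eq'])
      (auto intro!: continuous_intros continuous_on_subset[OF continuous_dquot[OF assms(1,3)]])
  have "continuous_on ((?S - {z2}) \<union> (?S - {z1})) ?Q"
      proof (rule continuous_on_Un_local_open[OF _ _ c1 c2])
    have U: "(?S - {z2}) \<union> (?S - {z1}) = ?S" using assms(4) by auto
    show "openin (top_of_set ((?S - {z2}) \<union> (?S - {z1}))) (?S - {z2})"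
      "openin (top_of_set ((?S - {z2}) \<union> (?S - {z1}))) (?S - {z1})"
      unfolding U by (auto intro!: openin_delete)
  qed
  moreover have "(?S - {z2}) \<union> (?S - {z1}) = ?S" using assms(4) by auto
  ultimately show ?thesis by simp
qed

end

section \<open>Index jumps at crossings\<close>

context link
begin

context
  fixes x y :: "nat \<times> complex" and \<sigma> :: real
  assumes x: "x \<in> circles D" and y: "y \<in> circles D" and neq: "x \<noteq> y" and pos_eq: "pos D x = pos D y"
    and \<sigma>: "\<sigma> = 1 \<or> \<sigma> = -1"
begin

text \<open>The moving point is now the base point of the difference quotient, and the zero passing
  through the circle is the parameter of the other strand. The error term no longer vanishes, but
  near that parameter it is small relative to the displacement, which is all that
  \<open>degree_zero_crossing\<close> requires.\<close>

lemma degree_crossing_same_component: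
  assumes eq: "fst x = fst y"
  shows "\<forall>\<^sub>F s in at_right 0. loop_degree (dquot (curve D (fst x)) (snd x * cis (\<sigma> * s))) =
     loop_degree (dquot2 (curve D (fst x)) (snd x) (snd y)) + (if \<sigma> * cross (velocity D y) (velocity D x) > 0 then 1 else 0)"
proof -
  let ?\<gamma> = "curve D (fst x)" and ?u = "snd x" and ?p = "snd y" and ?c = "pos D x"
  let ?z = "\<lambda>s. ?u * cis (\<sigma> * s)"
  let ?Q = "dquot2 ?\<gamma> ?u ?p"
  let ?\<eta> = "\<lambda>s. (pos D (rotate_point x (\<sigma> * s)) - ?c) / circle_deriv ?\<gamma> ?p"
  have x': "fst x < ncomp D" "norm ?u = 1" using x by (cases x; simp add: circles_iff)+
  have y': "norm ?p = 1" using y by (cases y; simp add: circles_iff)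
  have up: "?u \<noteq> ?p" using eq neq by (auto simp: prod_eq_iff)
  have gu: "?\<gamma> ?u = ?c" "?\<gamma> ?p = ?c" using pos_eq eq by (simp_all add: pos_def)
  have d1: "circle_deriv ?\<gamma> ?u \<noteq> 0" by (rule circle_deriv_nonzero[OF x])
  have d2: "circle_deriv ?\<gamma> ?p \<noteq> 0" using circle_deriv_nonzero[OF y] eq by simp
  have only: "?\<gamma> w \<noteq> ?c" if "norm w = 1" "w \<noteq> ?u" "w \<noteq> ?p" for w
    using double_point[OF x y neq pos_eq, of "(fst x, w)"] x' that eq
    by (cases x; cases y) (auto simp: circles_iff pos_def)
  have qm: "(w - ?p) * ?Q w = dquot ?\<gamma> ?u w" for w
    by (rule dquot2_mult[OF up]) (simp add: gu)
  have qp: "?Q ?p = circle_deriv ?\<gamma> ?p / (?p - ?u)" by (simp add: dquot2_def dquot_def)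
  have "\<forall>\<^sub>F s in at_right 0. has_degree (dquot ?\<gamma> (?z s))
     (loop_degree ?Q + (if Re ((\<sigma> *\<^sub>R velocity D x / circle_deriv ?\<gamma> ?p) * cnj ?p) < 0 then 1 else 0))"
  proof (rule degree_zero_crossing[OF y', where \<eta> = ?\<eta>])
    show "continuous_on (sphere 0 1) ?Q"
      by (rule continuous_dquot2) (use x' y' up gu in auto)
    show "?Q w \<noteq> 0" if "norm w = 1" for w
    proof (cases "w = ?p")
      case True
      then show ?thesis using qp d2 up by simp
    next
      case False
      have "dquot ?\<gamma> ?u w \<noteq> 0"
        by (rule dquot_nonzero[OF x that]) (use only that False in auto)
      then show ?thesis using qm[of w] by auto
    qed
    show "\<forall>\<^sub>F s in at_right 0. continuous_on (sphere 0 1) (dquot ?\<gamma> (?z s))"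
      by (intro always_eventually allI continuous_dquot) (use x' in \<open>auto simp: norm_mult\<close>)
    show "uniform_limit (sphere 0 1) (\<lambda>s. dquot ?\<gamma> (?z s)) (\<lambda>z. (z - ?p) * ?Q z) (at_right 0)"
      unfolding qm by (rule uniform_limit_dquot[OF x'])
    show "\<exists>d>0. \<forall>\<^sub>F s in at_right 0. \<forall>w. norm w = 1 \<and> norm (w - ?p) < d \<longrightarrow>
       norm (dquot ?\<gamma> (?z s) w - (w - ?p) * ?Q w + ?\<eta> s * ?Q ?p) \<le> e * norm (?\<eta> s)" if e: "e > 0" for e
    proof -
      \<comment> \<open>The separation of the two parameters and the speeds of the two strands;
        positive because the preimages are distinct and the curve is immersed.\<close>
      define r where "r = norm (?p - ?u)"
      define A where "A = norm (circle_deriv ?\<gamma> ?p)"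
      define B where "B = norm (circle_deriv ?\<gamma> ?u)"
      have pos: "r > 0" "A > 0" "B > 0" using up d1 d2 by (auto simp: r_def A_def B_def)
      have B2: "B / 2 > 0" using pos by simp
      obtain d0 where d0: "d0 > 0" "\<And>z w. norm z = 1 \<Longrightarrow> norm w = 1 \<Longrightarrow> norm (z - ?u) < d0 \<Longrightarrow> norm (w - ?u) < d0 \<Longrightarrow>
          norm (?\<gamma> w - ?\<gamma> z - circle_deriv ?\<gamma> ?u * (w - z)) \<le> B / 2 * norm (w - z)"
        using circle_strict_deriv[OF C1[OF x'(1)] x'(2) B2] by blast
      \<comment> \<open>\<open>g\<close> and \<open>d\<close> are tuned so that each of the two
        error terms below is at most e / (2 A) times the norm of \<open>\<delta>\<close>.\<close>
      define g where "g = e * r\<^sup>2 * B / (16 * A)"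
      have "g > 0" using e pos by (simp add: g_def)
      then obtain d1 where d1: "d1 > 0" "\<And>w. norm w = 1 \<Longrightarrow> norm (w - ?p) < d1 \<Longrightarrow> norm (?\<gamma> w - ?c) < g"
        using continuous_curve[OF x'(1)] y' gu unfolding continuous_on_iff dist_norm by (metis mem_sphere_0)
      define d where "d = min d0 (min d1 (min (r / 4) (e * r\<^sup>2 / (8 * A))))"
      have d: "d > 0" "d \<le> d0" "d \<le> d1" "d \<le> r / 4" "d \<le> e * r\<^sup>2 / (8 * A)"
        using d0 d1 e pos by (auto simp: d_def)
      have "\<forall>\<^sub>F s in at_right 0. norm (?z s - ?u) < d"
        using tendstoD[OF tendsto_rotate[of ?u \<sigma>] d(1)] by (simp add: dist_norm)
      then show ?thesis
      proof (intro exI[of _ d] conjI d(1), eventually_elim, intro allI impI)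
        fix s w assume near: "norm (?z s - ?u) < d" and w: "norm w = 1 \<and> norm (w - ?p) < d"
        let ?z = "?z s"
        have nz: "norm ?z = 1" using x' by (simp add: norm_mult)
        define \<delta> where "\<delta> = ?\<gamma> ?z - ?c"
        have \<delta>: "pos D (rotate_point x (\<sigma> * s)) - ?c = \<delta>" by (simp add: \<delta>_def pos_rotate_point)
        \<comment> \<open>Immersion at the moving point bounds the parameter shift by the shift
          \<open>\<delta>\<close> in the plane.\<close>
        have lower: "B * norm (?z - ?u) \<le> 2 * norm \<delta>"
        proof -
          have "norm (\<delta> - circle_deriv ?\<gamma> ?u * (?z - ?u)) \<le> B / 2 * norm (?z - ?u)"
            using d0(2)[of ?u ?z] nz x' near d d0(1) gu by (simp add: \<delta>_def)
          moreover have "norm (circle_deriv ?\<gamma> ?u * (?z - ?u)) \<le> norm \<delta> + norm (\<delta> - circle_deriv ?\<gamma> ?u * (?z - ?u))"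
            using norm_triangle_ineq4[of \<delta> "\<delta> - circle_deriv ?\<gamma> ?u * (?z - ?u)"] by simp
          ultimately show ?thesis by (simp add: norm_mult B_def)
        qed
        have wz: "r / 2 \<le> norm (w - ?z)"
        proof -
          have "r = norm ((w - ?z) + (?z - ?u) - (w - ?p))" by (simp add: r_def)
          also have "\<dots> \<le> norm ((w - ?z) + (?z - ?u)) + norm (w - ?p)" by (rule norm_triangle_ineq4)
          also have "\<dots> \<le> norm (w - ?z) + norm (?z - ?u) + norm (w - ?p)"
            by (intro add_right_mono norm_triangle_ineq)
          finally have "r \<le> norm (w - ?z) + norm (?z - ?u) + norm (w - ?p)" .
          then show ?thesis using near w d by linarith
        qed
        have wu: "r / 2 \<le> norm (w - ?u)"
        proof -
          have "r = norm ((w - ?u) - (w - ?p))" by (simp add: r_def)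
          also have "\<dots> \<le> norm (w - ?u) + norm (w - ?p)" by (rule norm_triangle_ineq4)
          finally have "r \<le> norm (w - ?u) + norm (w - ?p)" .
          then show ?thesis using w d by linarith
        qed
        have ne: "w \<noteq> ?z" "w \<noteq> ?u" using wz wu pos by auto
        have "dquot ?\<gamma> ?z w - (w - ?p) * ?Q w + ?\<eta> s * ?Q ?p =
            (?\<gamma> w - ?\<gamma> ?z) / (w - ?z) - (?\<gamma> w - ?c) / (w - ?u) + \<delta> / (?p - ?u)"
          unfolding qm qp \<delta> using ne d2 by (simp add: dquot_def gu)
        also have "\<dots> = (?\<gamma> w - ?c - \<delta>) / (w - ?z) - (?\<gamma> w - ?c) / (w - ?u) + \<delta> / (?p - ?u)"
          by (simp add: \<delta>_def)
        \<comment> \<open>Partial fractions split the error into \<open>\<delta>\<close> times a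
          small parameter difference and a small value of the curve times the parameter shift, which
          is itself bounded by \<open>\<delta>\<close>.\<close>
        also have "\<dots> = \<delta> * (((w - ?p) - (?z - ?u)) / ((?p - ?u) * (w - ?z)))
            + (?\<gamma> w - ?c) * ((?z - ?u) / ((w - ?z) * (w - ?u)))"
        proof -
          have id: "(G - \<delta>) / (w - z) - G / (w - u) + \<delta> / (p - u) =
            \<delta> * (((w - p) - (z - u)) / ((p - u) * (w - z))) + G * ((z - u) / ((w - z) * (w - u)))"
            if "w - z \<noteq> 0" "w - u \<noteq> 0" "p - u \<noteq> 0" for G z u p :: complex
          proof -
            have "((w - p) - (z - u)) / ((p - u) * (w - z)) = 1 / (p - u) - 1 / (w - z)"
              using that by (simp add: diff_frac_eq)
            moreover have "(z - u) / ((w - z) * (w - u)) = 1 / (w - z) - 1 / (w - u)"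
              using that by (simp add: diff_frac_eq)
            ultimately show ?thesis by (simp only:) (simp add: diff_divide_distrib right_diff_distrib)
          qed
          show ?thesis by (rule id) (use ne up in auto)
        qed
        also have "norm \<dots> \<le> norm \<delta> * (2 * d / (r * (r / 2))) + g * (2 * norm \<delta> / B / (r / 2 * (r / 2)))"
        proof (rule order_trans[OF norm_triangle_ineq add_mono])
          have "norm ((w - ?p) - (?z - ?u)) \<le> 2 * d"
            using norm_triangle_ineq4[of "w - ?p" "?z - ?u"] near w by linarith
          then show "norm (\<delta> * (((w - ?p) - (?z - ?u)) / ((?p - ?u) * (w - ?z)))) \<le> norm \<delta> * (2 * d / (r * (r / 2)))"
            unfolding norm_mult norm_divide r_def[symmetric] using wz pos d
            by (intro mult_left_mono frac_le mult_mono) auto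
          have "norm (?z - ?u) \<le> 2 * norm \<delta> / B" using lower pos by (simp add: field_simps)
          then show "norm ((?\<gamma> w - ?c) * ((?z - ?u) / ((w - ?z) * (w - ?u)))) \<le> g * (2 * norm \<delta> / B / (r / 2 * (r / 2)))"
            unfolding norm_mult norm_divide using wz wu pos d d1(2)[of w] w \<open>g > 0\<close>
            by (intro mult_mono frac_le) auto
        qed
        also have "\<dots> = norm \<delta> * (4 * d / r\<^sup>2) + norm \<delta> * (8 * g / (B * r\<^sup>2))"
          using pos by (simp add: field_simps power2_eq_square)
        also have "\<dots> \<le> norm \<delta> * (e / (2 * A)) + norm \<delta> * (e / (2 * A))"
        proof (intro add_mono mult_left_mono)
          show "4 * d / r\<^sup>2 \<le> e / (2 * A)" using d(5) pos by (simp add: field_simps)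
          show "8 * g / (B * r\<^sup>2) \<le> e / (2 * A)" using pos by (simp add: g_def field_simps)
        qed auto
        also have "\<dots> = e * norm (?\<eta> s)" unfolding \<delta> using pos by (simp add: norm_divide A_def)
        finally show "norm (dquot ?\<gamma> ?z w - (w - ?p) * ?Q w + ?\<eta> s * ?Q ?p) \<le> e * norm (?\<eta> s)" .
      qed
    qed
  qed (use displacement_quotient[OF x y] direction(1)[OF x y neq pos_eq \<sigma>] eq in auto)
  then show ?thesis
    using direction(2)[OF x y neq pos_eq \<sigma>] eq by (auto elim!: eventually_mono intro!: degree_eqI)
qed

end

text \<open>The index on the part of either strand that lies to the right of the other strand, hence
  the smaller of the two one-sided values. Its symmetry allows one common power of t to be extracted
  at the crossing.\<close>

definition crossing_index :: "nat \<times> complex \<Rightarrow> nat \<times> complex \<Rightarrow> int" where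
  "crossing_index x y =
     (if fst x = fst y then loop_degree (dquot2 (curve D (fst x)) (snd x) (snd y))
      else loop_degree (dquot (curve D (fst x)) (snd x)) + loop_degree (dquot (curve D (fst y)) (snd y)))
     + (\<Sum>k\<in>{..<ncomp D} - {fst x, fst y}. loop_degree (\<lambda>w. curve D k w - pos D x))"

lemma crossing_index_commute:
  assumes "x \<noteq> y" "pos D x = pos D y"
  shows "crossing_index x y = crossing_index y x"
proof (cases "fst x = fst y")
  case True
  then have "snd x \<noteq> snd y" "curve D (fst x) (snd x) = curve D (fst x) (snd y)"
    using assms by (auto simp: prod_eq_iff pos_def)
  from dquot2_commute[OF this] True assms(2) show ?thesis by (simp add: crossing_index_def)
next
  case False
  then show ?thesis using assms(2) by (simp add: crossing_index_def insert_commute)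
qed

text \<open>Exactly one summand of \<open>index\<close> degenerates at the crossing: the difference
  quotient if both strands belong to one component, otherwise the term of the component of y. The
  remaining degrees are locally constant.\<close>

lemma index_near_crossing:
  assumes x: "x \<in> circles D" and y: "y \<in> circles D" and neq: "x \<noteq> y" and pos_eq: "pos D x = pos D y"
    and \<sigma>: "\<sigma> = 1 \<or> \<sigma> = -1"
  shows "\<forall>\<^sub>F s in at_right 0. index D (rotate_point x (\<sigma> * s)) =
    crossing_index x y + (if \<sigma> * cross (velocity D y) (velocity D x) > 0 then 1 else 0)"
proof -
  let ?J = "{..<ncomp D} - {fst x, fst y}"
  have xn: "fst x < ncomp D" and yn: "fst y < ncomp D" using x y by (cases x; cases y; simp add: circles_iff)+
  have only: "curve D j w \<noteq> pos D x" if "j < ncomp D" "norm w = 1" "(j, w) \<noteq> x" "(j, w) \<noteq> y" for j w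
    using double_point[OF x y neq pos_eq, of "(j, w)"] that by (auto simp: circles_iff pos_def)
  have rest: "\<forall>\<^sub>F s in at_right 0. \<forall>j\<in>?J.
     loop_degree (\<lambda>w. curve D j w - pos D (rotate_point x (\<sigma> * s))) = loop_degree (\<lambda>w. curve D j w - pos D x)"
  proof (rule eventually_ball_finite, simp, intro ballI degree_diff_eventually[OF x])
    fix j w :: _ assume "j \<in> ?J" "norm (w :: complex) = 1"
    then show "curve D j w \<noteq> pos D x" by (intro only) auto
  qed auto
  show ?thesis
  proof (cases "fst x = fst y")
    case True
    from degree_crossing_same_component[OF x y neq pos_eq \<sigma> True] rest
    show ?thesis
      by eventually_elim (use True in \<open>simp add: index_def crossing_index_def rotate_point_def\<close>)
  next
    case False
    have "\<forall>\<^sub>F s in at_right 0. loop_degree (dquot (curve D (fst x)) (snd x * cis (\<sigma> * s))) = loop_degree (dquot (curve D (fst x)) (snd x))"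
    proof (rule degree_dquot_eventually[OF x])
      fix w :: complex assume "norm w = 1" "w \<noteq> snd x"
      then show "curve D (fst x) w \<noteq> pos D x" using False xn by (intro only) (auto simp: prod_eq_iff)
    qed
    with degree_crossing_other_component[OF x y neq pos_eq \<sigma> False] rest
    show ?thesis
    proof eventually_elim
      case (elim s)
      have "{..<ncomp D} - {fst x} = insert (fst y) ?J" using False yn by auto
      then show ?case using elim False by (simp add: index_def crossing_index_def rotate_point_def)
    qed
  qed
qed

end

section \<open>Transport along circles\<close>

lemma eventually_at_left_0: "eventually P (at_left (0::real)) \<longleftrightarrow> eventually (\<lambda>s. P (- s)) (at_right 0)"
  using at_left_minus[of 0] by (simp add: eventually_filtermap)

lemma at_left_to_0: "at_left a = filtermap (\<lambda>x. x + a) (at_left (0::real))"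
  unfolding at_left_minus[of a] at_left_minus[of 0] at_right_to_0[of "- a"]
  by (simp add: filtermap_filtermap)

lemma eventually_at_left_less: "\<forall>\<^sub>F t in at_left (\<theta>::real). t < \<theta>"
  by (simp add: eventually_at_filter)

lemma finite_gap_right:
  fixes \<theta> :: real assumes "finite P" shows "\<forall>\<^sub>F t in at_right \<theta>. P \<inter> {\<theta><..t} = {}"
proof -
  have "\<forall>\<^sub>F t in at_right \<theta>. \<forall>p\<in>P. p > \<theta> \<longrightarrow> t < p"
    by (intro eventually_ball_finite ballI assms) (auto simp: eventually_at_right_less eventually_at_right_field)
  then show ?thesis by eventually_elim force
qed

lemma finite_gap_left:
  fixes \<theta> :: real assumes "finite P" shows "\<forall>\<^sub>F t in at_left \<theta>. P \<inter> {t..<\<theta>} = {}"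
proof -
  have "\<forall>\<^sub>F t in at_left \<theta>. \<forall>p\<in>P. p < \<theta> \<longrightarrow> p < t"
    by (intro eventually_ball_finite ballI assms) (auto simp: eventually_at_left_field)
  then show ?thesis by eventually_elim force
qed

text \<open>States are kept apart from the group so that one transport argument serves formal sums
  under addition, pairs of a quandle element and a coset, and integers under the trivial
  action.\<close>

locale additive_action =
  fixes act :: "'g::ab_group_add \<Rightarrow> 's \<Rightarrow> 's"
  assumes act_0: "act 0 s = s" and act_add: "act (g + h) s = act g (act h s)"
begin

text \<open>Undoing the jumps passed so far turns \<open>E\<close> into a locally constant function
  on a connected interval.\<close>

lemma line_transport:
  fixes E El Er :: "real \<Rightarrow> 's" and J :: "real \<Rightarrow> 'g"
  assumes P: "finite P" "P \<subseteq> {a<..<b}" and ab: "a \<le> b"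
    and L: "\<And>\<theta>. \<theta> \<in> {a..b} \<Longrightarrow> \<forall>\<^sub>F t in at_left \<theta>. E t = El \<theta>"
    and R: "\<And>\<theta>. \<theta> \<in> {a..b} \<Longrightarrow> \<forall>\<^sub>F t in at_right \<theta>. E t = Er \<theta>"
    and off: "\<And>\<theta>. \<theta> \<in> {a..b} \<Longrightarrow> \<theta> \<notin> P \<Longrightarrow> El \<theta> = E \<theta> \<and> Er \<theta> = E \<theta>"
    and on: "\<And>\<theta>. \<theta> \<in> P \<Longrightarrow> Er \<theta> = act (J \<theta>) (El \<theta>)"
  shows "E b = act (\<Sum>p\<in>P. J p) (E a)"
proof -
  define S where "S \<theta> = (\<Sum>p\<in>P \<inter> {..<\<theta>}. J p)" for \<theta>
  \<comment> \<open>\<open>S\<close> contains only the jumps strictly before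
    \<open>\<theta>\<close>, so at a jump the left-hand value is the one to correct.\<close>
  define F where "F \<theta> = act (- S \<theta>) (if \<theta> \<in> P then El \<theta> else E \<theta>)" for \<theta>
  have "F a = F b"
  proof (rule connected_local_const[of "{a..b}"])
    show "\<forall>\<theta>\<in>{a..b}. \<forall>\<^sub>F t in at \<theta> within {a..b}. F \<theta> = F t"
    proof
      fix \<theta> assume \<theta>: "\<theta> \<in> {a..b}"
      have "\<forall>\<^sub>F t in at_left \<theta>. F \<theta> = F t"
        using L[OF \<theta>] finite_gap_left[OF P(1), of \<theta>] eventually_at_left_less[of \<theta>]
      proof eventually_elim
        case (elim t)
        have "x \<in> P \<inter> {..<t} \<longleftrightarrow> x \<in> P \<inter> {..<\<theta>}" for x
          using elim(2,3) by (cases x t rule: linorder_cases) auto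
        then have "P \<inter> {..<t} = P \<inter> {..<\<theta>}" by blast
        moreover have "t \<notin> P" using elim(2,3) by auto
        ultimately show ?case using elim(1) off[OF \<theta>] by (auto simp: F_def S_def)
      qed
      moreover have "\<forall>\<^sub>F t in at_right \<theta>. F \<theta> = F t"
        using R[OF \<theta>] finite_gap_right[OF P(1), of \<theta>] eventually_at_right_less[of \<theta>]
      proof eventually_elim
        case (elim t)
        have t: "t \<notin> P" using elim(2,3) by auto
        show ?case
        proof (cases "\<theta> \<in> P")
          case True
          have "x \<in> P \<inter> {..<t} \<longleftrightarrow> x \<in> insert \<theta> (P \<inter> {..<\<theta>})" for x
            using elim(2,3) True by (cases x \<theta> rule: linorder_cases) auto
          then have "P \<inter> {..<t} = insert \<theta> (P \<inter> {..<\<theta>})" by blast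
          then have "S t = J \<theta> + S \<theta>" using P(1) by (simp add: S_def)
          then have mS: "- S t = - S \<theta> + - J \<theta>" by simp
          have "F t = act (- S t) (E t)" using t by (simp add: F_def)
          also have "\<dots> = act (- S \<theta> + - J \<theta>) (act (J \<theta>) (El \<theta>))"
            unfolding mS elim(1) on[OF True] ..
          also have "\<dots> = act (- S \<theta>) (act (- J \<theta> + J \<theta>) (El \<theta>))" unfolding act_add ..
          also have "\<dots> = F \<theta>" using True by (simp add: F_def act_0)
          finally show ?thesis ..
        next
          case False
          have "x \<in> P \<inter> {..<t} \<longleftrightarrow> x \<in> P \<inter> {..<\<theta>}" for x
            using elim(2,3) False by (cases x \<theta> rule: linorder_cases) auto
          then have "P \<inter> {..<t} = P \<inter> {..<\<theta>}" by blast
          then show ?thesis using False t elim(1) off[OF \<theta>] by (simp add: F_def S_def)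
        qed
      qed
      ultimately have "\<forall>\<^sub>F t in at \<theta>. F \<theta> = F t" by (simp add: eventually_at_split)
      then show "\<forall>\<^sub>F t in at \<theta> within {a..b}. F \<theta> = F t"
        by (rule filter_leD[OF at_le, rotated]) simp
    qed
  qed (use ab in auto)
  moreover have "a \<notin> P" "b \<notin> P" "P \<inter> {..<a} = {}" "P \<inter> {..<b} = P" using P(2) by auto
  ultimately have "E a = act (- (\<Sum>p\<in>P. J p)) (E b)" by (simp add: F_def S_def act_0)
  then have "act (\<Sum>p\<in>P. J p) (E a) = act ((\<Sum>p\<in>P. J p) + - (\<Sum>p\<in>P. J p)) (E b)" by (simp only: act_add)
  then show ?thesis by (simp add: act_0)
qed

text \<open>The circle is cut open at \<open>z\<close>, which is not a jump. Going all the way round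
  gives the first part; stopping at \<open>w\<close> gives the second, with \<open>Y\<close> the set
  of jumps passed so far.\<close>

lemma circle_transport:
  fixes e el er :: "complex \<Rightarrow> 's" and J :: "complex \<Rightarrow> 'g"
  assumes X: "finite X" "X \<subseteq> sphere 0 1"
    and L: "\<And>z. norm z = 1 \<Longrightarrow> \<forall>\<^sub>F s in at_left 0. e (z * cis s) = el z"
    and R: "\<And>z. norm z = 1 \<Longrightarrow> \<forall>\<^sub>F s in at_right 0. e (z * cis s) = er z"
    and off: "\<And>z. norm z = 1 \<Longrightarrow> z \<notin> X \<Longrightarrow> el z = e z \<and> er z = e z"
    and on: "\<And>z. z \<in> X \<Longrightarrow> er z = act (J z) (el z)"
    and z: "norm z = 1" "z \<notin> X"
  shows "e z = act (\<Sum>x\<in>X. J x) (e z)"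
    and "norm w = 1 \<Longrightarrow> w \<notin> X \<Longrightarrow> \<exists>Y\<subseteq>X. e w = act (\<Sum>x\<in>Y. J x) (e z)"
proof -
  let ?c = "\<lambda>s. z * cis s"
  have nz: "z \<noteq> 0" using z by auto
  have inj: "inj_on ?c {0<..<2 * pi}"
  proof (rule inj_onI)
    fix s t assume st: "s \<in> {0<..<2 * pi}" "t \<in> {0<..<2 * pi}" "?c s = ?c t"
    then have "cis s = cis t" using nz by simp
    then have "exp (\<i> * of_real s) = exp (\<i> * of_real t)" by (simp add: cis_conv_exp)
    then obtain n :: int where "\<i> * of_real s = \<i> * of_real t + (of_int (2 * n) * pi) * \<i>"
      unfolding exp_eq by auto
    from arg_cong[OF this, of Im] have n: "s = t + 2 * of_int n * pi" by simp
    have "\<bar>s - t\<bar> < 2 * pi" using st by auto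
    then have "\<bar>2 * of_int n * pi\<bar> < 2 * pi" using n by simp
    then have "\<bar>of_int n :: real\<bar> < 1" by (simp add: abs_mult)
    then have "n = 0" by linarith
    then show "s = t" using n by simp
  qed
  have main: "e (?c b) = act (\<Sum>x\<in>?c ` {s\<in>{0<..<b}. ?c s \<in> X}. J x) (e z)"
    if b: "0 \<le> b" "b \<le> 2 * pi" "?c b \<notin> X" for b
  proof -
    define P where "P = {s\<in>{0<..<b}. ?c s \<in> X}"
    have injP: "inj_on ?c P" by (rule inj_on_subset[OF inj]) (use b in \<open>auto simp: P_def\<close>)
    have "finite (?c ` P)" by (rule finite_subset[OF _ X(1)]) (auto simp: P_def)
    then have finP: "finite P" using injP by (rule finite_imageD)
    have "e (?c b) = act (\<Sum>p\<in>P. J (?c p)) (e (?c 0))"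
    proof (rule line_transport[where El = "\<lambda>s. el (?c s)" and Er = "\<lambda>s. er (?c s)"])
      fix \<theta> :: real
      have n: "norm (?c \<theta>) = 1" using z by (simp add: norm_mult)
      have shift: "?c (s + \<theta>) = ?c \<theta> * cis s" for s by (simp add: cis_mult[symmetric] mult_ac)
      show "\<forall>\<^sub>F t in at_left \<theta>. e (?c t) = el (?c \<theta>)"
        using L[OF n] unfolding at_left_to_0[of \<theta>] eventually_filtermap shift .
      show "\<forall>\<^sub>F t in at_right \<theta>. e (?c t) = er (?c \<theta>)"
        using R[OF n] unfolding at_right_to_0[of \<theta>] eventually_filtermap shift .
      show "el (?c \<theta>) = e (?c \<theta>) \<and> er (?c \<theta>) = e (?c \<theta>)" if "\<theta> \<in> {0..b}" "\<theta> \<notin> P"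
      proof (rule off[OF n])
        show "?c \<theta> \<notin> X"
        proof
          assume "?c \<theta> \<in> X"
          then have "\<theta> = 0 \<or> \<theta> = b" using that by (auto simp: P_def)
          then show False using \<open>?c \<theta> \<in> X\<close> b z by auto
        qed
      qed
      show "er (?c \<theta>) = act (J (?c \<theta>)) (el (?c \<theta>))" if "\<theta> \<in> P"
        using on that by (auto simp: P_def)
    qed (use finP b in \<open>auto simp: P_def\<close>)
    then show ?thesis unfolding P_def[symmetric] by (simp add: sum.reindex[OF injP])
  qed
  have angle: "\<exists>s\<in>{0..<2 * pi}. w = ?c s" if "norm w = 1" for w
  proof -
    have "norm (w / z) = 1" using that z by (simp add: norm_divide)
    then have "w / z = cis (Arg2pi (w / z))"
      using Arg2pi_eq[of "w / z"] by (simp add: cis_conv_exp)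
    then have "w = ?c (Arg2pi (w / z))" using nz by (metis nonzero_mult_div_cancel_left times_divide_eq_right)
    then show ?thesis using Arg2pi[of "w / z"] by auto
  qed
  have "?c ` {s\<in>{0<..<2 * pi}. ?c s \<in> X} = X"
  proof (rule equalityI; rule subsetI)
    fix w assume w: "w \<in> X"
    have "norm w = 1" using w X(2) by auto
    then obtain s where s: "s \<in> {0..<2 * pi}" "w = ?c s" using angle by blast
    then have "s \<noteq> 0" using w z by auto
    then show "w \<in> ?c ` {s\<in>{0<..<2 * pi}. ?c s \<in> X}" using s w by auto
  qed auto
  then show "e z = act (\<Sum>x\<in>X. J x) (e z)" using main[of "2 * pi"] z by simp
  show "\<exists>Y\<subseteq>X. e w = act (\<Sum>x\<in>Y. J x) (e z)" if w: "norm w = 1" "w \<notin> X"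
  proof -
    obtain s where s: "s \<in> {0..<2 * pi}" "w = ?c s" using angle[OF w(1)] by auto
    show ?thesis
      using main[of s] s w by (intro exI[of _ "?c ` {t\<in>{0<..<s}. ?c t \<in> X}"]) auto
  qed
qed

end

section \<open>Arcs and crossings\<close>

lemma eventually_rotate_notin:
  assumes "finite X" "norm z = 1"
  shows "\<forall>\<^sub>F s in at (0::real). z * cis s \<notin> X"
proof -
  have "((\<lambda>s. z * cis (1 * s)) \<longlongrightarrow> z) (at 0)" by (rule tendsto_rotate)
  then have "\<forall>\<^sub>F s in at (0::real). z * cis (1 * s) \<in> - (X - {z})"
    by (rule topological_tendstoD[OF _ open_Compl[OF finite_imp_closed]]) (use assms in auto)
  moreover have "\<forall>\<^sub>F s in at (0::real). s \<noteq> 0 \<and> \<bar>s\<bar> < pi"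
    unfolding eventually_at by (intro exI[of _ pi]) auto
  ultimately show ?thesis
  proof eventually_elim
    case (elim s)
    have "cis s \<noteq> 1"
    proof
      assume "cis s = 1"
      then have "Arg (cis s) = 0" by simp
      then show False using elim(2) Arg_cis[of s] by (auto simp: abs_less_iff)
    qed
    moreover have "z \<noteq> 0" using assms by auto
    ultimately have "z * cis s \<noteq> z" by simp
    then show ?case using elim(1) by auto
  qed
qed

context link
begin

lemma under_points: "under D \<subseteq> {x \<in> circles D. pos D x \<in> crossings D}"
  using diagram unfolding link_diagram_def by (elim conjE) assumption

lemma finite_crossings: "finite (crossings D)"
  using diagram unfolding link_diagram_def by (elim conjE) assumption

lemma crossing_points:
  assumes "c \<in> crossings D"
  obtains x y where "x \<in> circles D" "y \<in> circles D" "x \<noteq> y" "pos D x = c" "pos D y = c"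
    "x \<notin> under D" "y \<in> under D"
proof -
  obtain x y where xy: "x \<in> circles D" "y \<in> circles D" "x \<noteq> y" "pos D x = c" "pos D y = c"
    using assms unfolding crossings_def by blast
  have *: "\<forall>x\<in>circles D. \<forall>y\<in>circles D. x \<noteq> y \<and> pos D x = pos D y \<longrightarrow> (x \<in> under D \<longleftrightarrow> y \<notin> under D)"
    using diagram unfolding link_diagram_def by (elim conjE) assumption
  have "x \<noteq> y \<and> pos D x = pos D y" using xy by simp
  then have "x \<in> under D \<longleftrightarrow> y \<notin> under D" by (rule mp[OF bspec[OF bspec[OF * xy(1)] xy(2)]])
  note iff = this
  show thesis
  proof (cases "y \<in> under D")
    case True
    with iff show thesis by (intro that[OF xy]) simp_all
  next
    case False
    with iff show thesis by (intro that[OF xy(2,1) xy(3)[symmetric] xy(5,4)]) simp_all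
  qed
qed

lemma finite_crossing_points: "finite {x \<in> circles D. pos D x \<in> crossings D}"
proof -
  have "{x \<in> circles D. pos D x \<in> crossings D} = (\<Union>c\<in>crossings D. {x \<in> circles D. pos D x = c})" by auto
  moreover have "finite {x \<in> circles D. pos D x = c}" if c: "c \<in> crossings D" for c
  proof -
    obtain x y where xy: "x \<in> circles D" "y \<in> circles D" "x \<noteq> y" "pos D x = c" "pos D y = c"
      by (rule crossing_points[OF c])
    then have "pos D x = pos D y" by simp
    have "z = x \<or> z = y" if "z \<in> circles D" "pos D z = c" for z
      by (rule double_point[OF xy(1-3) \<open>pos D x = pos D y\<close> that(1)]) (simp only: that(2) xy(4))
    then have "{x \<in> circles D. pos D x = c} \<subseteq> {x, y}" by auto
    then show ?thesis by (rule finite_subset) simp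
  qed
  ultimately show ?thesis using finite_crossings by simp
qed

lemma finite_under: "finite {z. (i, z) \<in> under D}"
proof -
  have "finite (under D)" by (rule finite_subset[OF under_points finite_crossing_points])
  then have "finite (snd ` under D)" by simp
  then show ?thesis by (rule rev_finite_subset) force
qed

lemma over_point_eq:
  assumes "x \<in> circles D" "y \<in> circles D" "x \<noteq> y" "pos D x = c" "pos D y = c" "x \<notin> under D" "y \<in> under D"
  shows "over_point D c = x" "under_point D c = y"
proof -
  have "pos D x = pos D y" by (simp only: assms)
  note double = double_point[OF assms(1-3) this]
  show "over_point D c = x" unfolding over_point_def
  proof (rule the_equality)
    fix z assume z: "z \<in> circles D \<and> pos D z = c \<and> z \<notin> under D"
    then have "z = x \<or> z = y" by (intro double) (simp_all only: assms)
    then show "z = x" using z assms(7) by auto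
  qed (simp only: assms simp_thms)
  show "under_point D c = y" unfolding under_point_def
  proof (rule the_equality)
    fix z assume z: "z \<in> circles D \<and> pos D z = c \<and> z \<in> under D"
    then have "z = x \<or> z = y" by (intro double) (simp_all only: assms)
    then show "z = y" using z assms(6) by auto
  qed (simp only: assms simp_thms)
qed

lemma
  assumes "c \<in> crossings D"
  shows over_point: "over_point D c \<in> circles D" "pos D (over_point D c) = c" "over_point D c \<notin> under D"
    and under_point: "under_point D c \<in> circles D" "pos D (under_point D c) = c" "under_point D c \<in> under D"
    and over_neq_under: "over_point D c \<noteq> under_point D c"
proof -
  obtain x y where xy: "x \<in> circles D" "y \<in> circles D" "x \<noteq> y" "pos D x = c" "pos D y = c"
    "x \<notin> under D" "y \<in> under D"
    by (rule crossing_points[OF assms])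
  note over_point_eq[OF xy]
  then show "over_point D c \<in> circles D" "pos D (over_point D c) = c" "over_point D c \<notin> under D"
    "under_point D c \<in> circles D" "pos D (under_point D c) = c" "under_point D c \<in> under D"
    "over_point D c \<noteq> under_point D c" using xy by (simp_all only: not_False_eq_True)
qed

lemma under_point_pos:
  assumes "x \<in> under D"
  shows "pos D x \<in> crossings D" "under_point D (pos D x) = x"
proof -
  show c: "pos D x \<in> crossings D" using assms under_points by auto
  have x: "x \<in> circles D" using assms under_points by auto
  have "x = over_point D (pos D x) \<or> x = under_point D (pos D x)"
    by (rule double_point[OF over_point(1)[OF c] under_point(1)[OF c] over_neq_under[OF c] _ x])
      (simp_all only: over_point(2)[OF c] under_point(2)[OF c])
  then show "under_point D (pos D x) = x" using over_point(3)[OF c] assms by auto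
qed

lemma bij_under_crossings:
  "bij_betw (\<lambda>z. pos D (i, z)) {z. (i, z) \<in> under D} {c \<in> crossings D. fst (under_point D c) = i}"
  by (rule bij_betw_byWitness[where f' = "\<lambda>c. snd (under_point D c)"])
    (use under_point_pos under_point in \<open>force+\<close>)

abbreviation free_circle :: "nat \<Rightarrow> complex set" where
  "free_circle i \<equiv> sphere 0 1 - {z. (i, z) \<in> under D}"

lemma arcs_iff: "a \<in> arcs D \<longleftrightarrow> fst a < ncomp D \<and> snd a \<in> components (free_circle (fst a))"
  by (cases a) (simp add: arcs_def)

lemma component_eq: "B \<in> components S \<Longrightarrow> z \<in> B \<Longrightarrow> B = connected_component_set S z"
  by (metis components_iff connected_component_eq)

lemma
  assumes "i < ncomp D" "z \<in> free_circle i"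
  shows arc_containing_eq: "arc_containing D (i, z) = (i, connected_component_set (free_circle i) z)"
    and arc_containing_arcs: "arc_containing D (i, z) \<in> arcs D"
proof -
  let ?a = "(i, connected_component_set (free_circle i) z)"
  have a: "?a \<in> arcs D" using assms by (auto simp: arcs_iff components_def)
  show eq: "arc_containing D (i, z) = ?a"
    unfolding arc_containing_def
  proof (rule the_equality)
    show "?a \<in> arcs D \<and> fst ?a = fst (i, z) \<and> snd (i, z) \<in> snd ?a"
      using a assms(2) by (auto simp: connected_component_refl_eq)
    fix b assume "b \<in> arcs D \<and> fst b = fst (i, z) \<and> snd (i, z) \<in> snd b"
    then show "b = ?a" using component_eq[of "snd b" "free_circle i" z] by (cases b) (auto simp: arcs_iff)
  qed
  show "arc_containing D (i, z) \<in> arcs D" using a eq by simp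
qed

lemma arc_contains_point:
  assumes "a \<in> arcs D"
  obtains z where "z \<in> free_circle (fst a)" "arc_containing D (fst a, z) = a"
proof -
  have a: "fst a < ncomp D" "snd a \<in> components (free_circle (fst a))" using assms by (auto simp: arcs_iff)
  obtain z where z: "z \<in> snd a" using in_components_nonempty[OF a(2)] by blast
  then have f: "z \<in> free_circle (fst a)" using in_components_subset[OF a(2)] by blast
  have "arc_containing D (fst a, z) = a"
    using arc_containing_eq[OF a(1) f] component_eq[OF a(2) z] by (simp add: prod_eq_iff)
  then show thesis using that f by blast
qed

text \<open>A short one-sided interval of angles contains no underpass, so its connected image lies
  in one arc. If \<open>z\<close> itself is no underpass, the angle 0 is added to the interval,
  which identifies that arc as the one through \<open>z\<close>.\<close>

lemma side_arc:
  assumes i: "i < ncomp D" and z: "norm z = 1" and \<sigma>: "\<sigma> = 1 \<or> \<sigma> = -1"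
  obtains a where "a \<in> arcs D" "fst a = i"
    "\<forall>\<^sub>F s in at_right 0. z * cis (\<sigma> * s) \<in> snd a \<and> arc_containing D (i, z * cis (\<sigma> * s)) = a"
    "z \<in> free_circle i \<Longrightarrow> arc_containing D (i, z) = a"
proof -
  obtain d where d: "d > 0" "\<And>s. s \<noteq> 0 \<Longrightarrow> \<bar>s\<bar> < d \<Longrightarrow> (i, z * cis s) \<notin> under D"
    using eventually_rotate_notin[OF finite_under[of i] z] unfolding eventually_at by (auto simp: dist_norm)
  define I where "I = {0<..<d} \<union> (if z \<in> free_circle i then {0} else {})"
  have I: "connected I"
  proof (cases "z \<in> free_circle i")
    case True
    then have "I = {0..<d}" using d(1) by (auto simp: I_def)
    then show ?thesis by simp
  next
    case False
    then have "I = {0<..<d}" by (simp only: I_def if_False Un_empty_right)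
    then show ?thesis by simp
  qed
  define W where "W = (\<lambda>s. z * cis (\<sigma> * s)) ` I"
  have "connected W" unfolding W_def
    by (rule connected_continuous_image[OF _ I])
      (intro continuous_at_imp_continuous_on ballI continuous_intros isCont_o2[OF _ isCont_cis])
  have ab: "\<bar>\<sigma> * s\<bar> = \<bar>s\<bar>" for s using \<sigma> by auto
  have "W \<subseteq> free_circle i"
  proof
    fix w assume "w \<in> W"
    then obtain s where s: "s \<in> I" "w = z * cis (\<sigma> * s)" by (auto simp: W_def)
    show "w \<in> free_circle i"
    proof (cases "s = 0")
      case True
      then show ?thesis using s by (auto simp: I_def split: if_splits)
    next
      case False
      then have "(i, w) \<notin> under D" unfolding s(2) using s(1) \<sigma> by (intro d(2)) (auto simp: I_def ab split: if_splits)
      then show ?thesis using s(2) z by (simp add: norm_mult)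
    qed
  qed
  define p where "p = z * cis (\<sigma> * (d / 2))"
  have p: "p \<in> W" unfolding p_def W_def by (rule imageI) (use d(1) in \<open>auto simp: I_def\<close>)
  define a where "a = arc_containing D (i, p)"
  have pf: "p \<in> free_circle i" using p \<open>W \<subseteq> _\<close> by blast
  have a: "a = (i, connected_component_set (free_circle i) p)" unfolding a_def by (rule arc_containing_eq[OF i pf])
  have Wa: "w \<in> snd a \<and> arc_containing D (i, w) = a" if "w \<in> W" for w
  proof -
    have *: "w \<in> connected_component_set (free_circle i) p"
      using connected_component_maximal[OF p \<open>connected W\<close> \<open>W \<subseteq> _\<close>] that by blast
    then have eq: "connected_component_set (free_circle i) w = connected_component_set (free_circle i) p"
      by (rule connected_component_eq)
    have "w \<in> free_circle i" using that \<open>W \<subseteq> _\<close> by blast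
    from arc_containing_eq[OF i this] show ?thesis unfolding a eq using * by simp
  qed
  have "\<forall>\<^sub>F s in at_right 0. s < d" by (rule order_tendstoD(2)[OF tendsto_ident_at d(1)])
  then have "\<forall>\<^sub>F s in at_right 0. z * cis (\<sigma> * s) \<in> W"
    using eventually_at_right_less[of 0] by eventually_elim (auto simp: W_def I_def)
  then have ev: "\<forall>\<^sub>F s in at_right 0. z * cis (\<sigma> * s) \<in> snd a \<and> arc_containing D (i, z * cis (\<sigma> * s)) = a"
    by eventually_elim (rule Wa)
  show thesis
  proof (rule that[OF _ _ ev])
    show "a \<in> arcs D" unfolding a_def by (rule arc_containing_arcs[OF i pf])
    show "fst a = i" by (simp add: a)
    assume "z \<in> free_circle i"
    then have "z \<in> W" by (auto simp: W_def I_def intro!: image_eqI[of _ _ 0])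
    then show "arc_containing D (i, z) = a" using Wa by blast
  qed
qed

lemma side_arc_unique:
  assumes "a \<in> arcs D" "b \<in> arcs D" "fst a = fst b" "F \<noteq> bot"
    and "\<forall>\<^sub>F s in F. f s \<in> snd a" "\<forall>\<^sub>F s in F. f s \<in> snd b"
  shows "a = b"
proof -
  have "\<forall>\<^sub>F s in F. f s \<in> snd a \<and> f s \<in> snd b" using assms(5,6) by eventually_elim simp
  then obtain s where "f s \<in> snd a" "f s \<in> snd b" using eventually_happens'[OF assms(4)] by blast
  then have "snd a = snd b"
    using component_eq[of "snd a" "free_circle (fst a)" "f s"] component_eq[of "snd b" "free_circle (fst b)" "f s"]
      assms(1-3) unfolding arcs_iff by metis
  then show ?thesis using assms(3) by (simp add: prod_eq_iff)
qed

lemma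
  assumes i: "i < ncomp D" and z: "norm z = 1"
  shows arc_out_of: "arc_out_of D (i, z) \<in> arcs D" "fst (arc_out_of D (i, z)) = i"
      "\<forall>\<^sub>F s in at_right 0. z * cis s \<in> snd (arc_out_of D (i, z))"
      "\<forall>\<^sub>F s in at_right 0. arc_containing D (i, z * cis s) = arc_out_of D (i, z)"
      "z \<in> free_circle i \<Longrightarrow> arc_out_of D (i, z) = arc_containing D (i, z)"
    and arc_into: "arc_into D (i, z) \<in> arcs D" "fst (arc_into D (i, z)) = i"
      "\<forall>\<^sub>F s in at_left 0. z * cis s \<in> snd (arc_into D (i, z))"
      "\<forall>\<^sub>F s in at_left 0. arc_containing D (i, z * cis s) = arc_into D (i, z)"
      "z \<in> free_circle i \<Longrightarrow> arc_into D (i, z) = arc_containing D (i, z)"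
proof -
  obtain a where a: "a \<in> arcs D" "fst a = i"
    "\<forall>\<^sub>F s in at_right 0. z * cis (1 * s) \<in> snd a \<and> arc_containing D (i, z * cis (1 * s)) = a"
    "z \<in> free_circle i \<Longrightarrow> arc_containing D (i, z) = a"
    by (rule side_arc[OF i z, of 1]) auto
  have a3: "\<forall>\<^sub>F s in at_right 0. z * cis s \<in> snd a" "\<forall>\<^sub>F s in at_right 0. arc_containing D (i, z * cis s) = a"
    using a(3) by (auto elim: eventually_mono)
  have "arc_out_of D (i, z) = a"
    unfolding arc_out_of_def
  proof (rule the_equality)
    fix b assume "b \<in> arcs D \<and> fst b = fst (i, z) \<and> (\<forall>\<^sub>F s in at_right 0. snd (i, z) * cis s \<in> snd b)"
    then show "b = a"
      by (intro side_arc_unique[OF _ a(1) _ trivial_limit_at_right_real _ a3(1)]) (use a(2) in simp_all)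
  qed (use a a3 in auto)
  then show "arc_out_of D (i, z) \<in> arcs D" "fst (arc_out_of D (i, z)) = i"
      "\<forall>\<^sub>F s in at_right 0. z * cis s \<in> snd (arc_out_of D (i, z))"
      "\<forall>\<^sub>F s in at_right 0. arc_containing D (i, z * cis s) = arc_out_of D (i, z)"
      "z \<in> free_circle i \<Longrightarrow> arc_out_of D (i, z) = arc_containing D (i, z)"
    using a a3 by auto
  obtain b where b: "b \<in> arcs D" "fst b = i"
    "\<forall>\<^sub>F s in at_right 0. z * cis ((-1) * s) \<in> snd b \<and> arc_containing D (i, z * cis ((-1) * s)) = b"
    "z \<in> free_circle i \<Longrightarrow> arc_containing D (i, z) = b"
    by (rule side_arc[OF i z, of "-1"]) auto
  have b3: "\<forall>\<^sub>F s in at_left 0. z * cis s \<in> snd b" "\<forall>\<^sub>F s in at_left 0. arc_containing D (i, z * cis s) = b"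
    using b(3) unfolding eventually_at_left_0 by (auto elim: eventually_mono)
  have "arc_into D (i, z) = b"
    unfolding arc_into_def
  proof (rule the_equality)
    fix c assume "c \<in> arcs D \<and> fst c = fst (i, z) \<and> (\<forall>\<^sub>F s in at_left 0. snd (i, z) * cis s \<in> snd c)"
    then show "c = b"
      by (intro side_arc_unique[OF _ b(1) _ trivial_limit_at_left_real _ b3(1)]) (use b(2) in simp_all)
  qed (use b b3 in auto)
  then show "arc_into D (i, z) \<in> arcs D" "fst (arc_into D (i, z)) = i"
      "\<forall>\<^sub>F s in at_left 0. z * cis s \<in> snd (arc_into D (i, z))"
      "\<forall>\<^sub>F s in at_left 0. arc_containing D (i, z * cis s) = arc_into D (i, z)"
      "z \<in> free_circle i \<Longrightarrow> arc_into D (i, z) = arc_containing D (i, z)"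
    using b b3 by auto
qed

end

section \<open>Scalar multiplication and sides of connected sets on the circle\<close>

lemma lscale_simps:
  shows lscale_add_left: "lscale (r + s) f = lscale r f + lscale s f"
    and lscale_add_right: "lscale r (f + g) = lscale r f + lscale r g"
    and lscale_diff_left: "lscale (r - s) f = lscale r f - lscale s f"
    and lscale_diff_right: "lscale r (f - g) = lscale r f - lscale r g"
    and lscale_minus_left: "lscale (- r) f = - lscale r f"
    and lscale_minus_right: "lscale r (- f) = - lscale r f"
    and lscale_lscale: "lscale r (lscale s f) = lscale (r * s) f"
    and lscale_one: "lscale 1 f = f"
    and lscale_zero_left: "lscale 0 f = 0"
    and lscale_zero_right: "lscale r 0 = 0"
  by (rule poly_mapping_eqI; simp add: lookup_add lookup_minus algebra_simps)+

lemma lscale_single: "lscale r (Poly_Mapping.single x s) = Poly_Mapping.single x (r * s)"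
  by (rule poly_mapping_eqI) (simp add: lookup_single when_def)

lemma lscale_sum_right: "lscale r (\<Sum>x\<in>A. f x) = (\<Sum>x\<in>A. lscale r (f x))"
  by (induction A rule: infinite_finite_induct) (simp_all add: lscale_simps)

abbreviation tpow :: "int \<Rightarrow> laurent" where
  "tpow n \<equiv> Poly_Mapping.single n 1"

text \<open>A connected set that avoids two points of the circle is confined to one of the two
  intervals between them, so it cannot lie next to both points on the same side. This recovers an
  underpass from its outgoing or incoming arc.\<close>

lemma connected_circle_subset_side:
  assumes "connected B" "B \<subseteq> sphere 0 1 - {z, z'}" and norm: "norm z = 1" "norm z' = 1" and \<sigma>: "\<sigma> = 1 \<or> \<sigma> = -1"
    and side: "\<forall>\<^sub>F s in at_right 0. z * cis (\<sigma> * s) \<in> B" "\<forall>\<^sub>F s in at_right 0. z' * cis (\<sigma> * s) \<in> B"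
  shows "z = z'"
proof (rule ccontr)
  assume ne: "z \<noteq> z'"
  \<comment> \<open>The minus sign puts the branch cut of \<open>Arg\<close> at \<open>z\<close>,
    which \<open>B\<close> avoids. So \<open>ang\<close> maps \<open>B\<close> to an interval, and
    the two sides of \<open>z\<close> correspond to angles near -pi and pi.\<close>
  define ang where "ang w = Arg (- (w / z))" for w
  have nz: "z \<noteq> 0" "z' \<noteq> 0" using norm by auto
  have off: "- (w / z) \<notin> \<real>\<^sub>\<le>\<^sub>0" if "norm w = 1" "w \<noteq> z" for w
  proof
    assume "- (w / z) \<in> \<real>\<^sub>\<le>\<^sub>0"
    then obtain r where r: "- (w / z) = of_real r" "r \<le> 0" by (rule nonpos_Reals_cases)
    have "norm (- (w / z)) = 1" using that norm by (simp add: norm_divide)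
    then have "r = -1" unfolding r(1) using r(2) by simp
    then show False using r(1) nz that by simp
  qed
  define \<alpha> where "\<alpha> = ang z'"
  have \<alpha>: "-pi < \<alpha>" "\<alpha> < pi"
  proof -
    show "-pi < \<alpha>" unfolding \<alpha>_def ang_def using Arg_bounded[of "- (z' / z)"] by simp
    have "Arg (- (z' / z)) \<noteq> pi"
      using off[OF norm(2)] ne nz by (simp add: Arg_eq_pi complex_nonpos_Reals_iff)
    then show "\<alpha> < pi" unfolding \<alpha>_def ang_def using Arg_bounded[of "- (z' / z)"] by simp
  qed
  have z': "- (z' / z) = cis \<alpha>"
    unfolding \<alpha>_def ang_def using cis_Arg[of "- (z' / z)"] nz norm by (simp add: sgn_eq norm_divide)
  have "continuous_on B ang"
    unfolding ang_def
    by (intro continuous_on_compose2[OF continuous_on_Arg] continuous_intros) (use off nz assms(2) in auto)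
  then have conn: "connected (ang ` B)" using assms(1) by (rule connected_continuous_image)
  have notin: "\<alpha> \<notin> ang ` B"
  proof
    assume "\<alpha> \<in> ang ` B"
    then obtain w where w: "w \<in> B" "ang w = \<alpha>" by auto
    then have n: "norm w = 1" "w \<noteq> z'" using assms(2) by auto
    then have "w \<noteq> 0" by auto
    then have "- (w / z) = cis \<alpha>"
      using w(2) cis_Arg[of "- (w / z)"] nz norm n by (simp add: ang_def sgn_eq norm_divide)
    then show False using z' n nz by (metis divide_cancel_right neg_equal_iff_equal)
  qed
  have "\<forall>\<^sub>F s in at_right (0::real). s > 0 \<and> s < pi - \<bar>\<alpha>\<bar>"
    using eventually_at_right_less[of 0] order_tendstoD(2)[OF tendsto_ident_at, of 0 "pi - \<bar>\<alpha>\<bar>" "{0<..}"] \<alpha>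
    by (auto simp: eventually_conj_iff)
  with side have "\<forall>\<^sub>F s in at_right (0::real). z * cis (\<sigma> * s) \<in> B \<and> z' * cis (\<sigma> * s) \<in> B \<and> s > 0 \<and> s < pi - \<bar>\<alpha>\<bar>"
    by eventually_elim simp
  then obtain s where s: "z * cis (\<sigma> * s) \<in> B" "z' * cis (\<sigma> * s) \<in> B" "s > 0" "s < pi - \<bar>\<alpha>\<bar>"
    using eventually_happens'[OF trivial_limit_at_right_real] by blast
  have cp: "cis (- pi) = -1" by (simp add: complex_eq_iff)
  have "ang (z * cis (\<sigma> * s)) = Arg (cis (\<sigma> * (s - pi)))"
  proof -
    have "- (z * cis (\<sigma> * s) / z) = cis (\<sigma> * s) * cis (\<sigma> * - pi)" using nz \<sigma> cp by auto
    then show ?thesis unfolding ang_def cis_mult by (simp add: right_diff_distrib)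
  qed
  also have "\<dots> = \<sigma> * (s - pi)" by (rule Arg_cis) (use \<sigma> s in auto)
  finally have 1: "\<sigma> * (s - pi) \<in> ang ` B" using s(1) by (metis imageI)
  have "ang (z' * cis (\<sigma> * s)) = Arg (cis (\<alpha> + \<sigma> * s))"
  proof -
    have "- (z' * cis (\<sigma> * s) / z) = cis \<alpha> * cis (\<sigma> * s)" unfolding z'[symmetric] by simp
    then show ?thesis unfolding ang_def cis_mult by simp
  qed
  also have "\<dots> = \<alpha> + \<sigma> * s" by (rule Arg_cis) (use \<sigma> s in auto)
  finally have 2: "\<alpha> + \<sigma> * s \<in> ang ` B" using s(2) by (metis imageI)
  have "\<alpha> \<in> ang ` B"
  proof (cases "\<sigma> = 1")
    case True
    show ?thesis by (rule connectedD_interval[OF conn 1 2]) (use True s in auto)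
  next
    case False
    show ?thesis by (rule connectedD_interval[OF conn 2 1]) (use False \<sigma> s in auto)
  qed
  then show False using notin by simp
qed

section \<open>Injectivity of the end arcs and transport along a component\<close>

context link
begin

lemma under_bounds:
  assumes "(i, z) \<in> under D"
  shows "i < ncomp D" "norm z = 1"
  using assms under_points by (auto simp: circles_iff)

lemma arc_out_of_inject:
  assumes u: "x \<in> under D" "y \<in> under D" and eq: "arc_out_of D x = arc_out_of D y"
  shows "x = y"
proof -
  obtain i z j z' where [simp]: "x = (i, z)" "y = (j, z')" by (cases x; cases y)
  note b = under_bounds[OF u(1)[simplified]] under_bounds[OF u(2)[simplified]]
  have ij: "j = i" using eq arc_out_of(2)[OF b(1,2)] arc_out_of(2)[OF b(3,4)] by simp
  have comp: "snd (arc_out_of D (i, z)) \<in> components (free_circle i)"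
    using arc_out_of(1,2)[OF b(1,2)] by (simp add: arcs_iff)
  have "z = z'"
    by (rule connected_circle_subset_side[OF in_components_connected[OF comp] _ b(2,4), of 1])
      (use in_components_subset[OF comp] u ij arc_out_of(3)[OF b(1,2)] arc_out_of(3)[OF b(3,4)] eq in auto)
  then show ?thesis using ij by simp
qed

lemma arc_into_inject:
  assumes u: "x \<in> under D" "y \<in> under D" and eq: "arc_into D x = arc_into D y"
  shows "x = y"
proof -
  obtain i z j z' where [simp]: "x = (i, z)" "y = (j, z')" by (cases x; cases y)
  note b = under_bounds[OF u(1)[simplified]] under_bounds[OF u(2)[simplified]]
  have ij: "j = i" using eq arc_into(2)[OF b(1,2)] arc_into(2)[OF b(3,4)] by simp
  have comp: "snd (arc_into D (i, z)) \<in> components (free_circle i)"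
    using arc_into(1,2)[OF b(1,2)] by (simp add: arcs_iff)
  have "z = z'"
    by (rule connected_circle_subset_side[OF in_components_connected[OF comp] _ b(2,4), of "-1"])
      (use in_components_subset[OF comp] u ij arc_into(3)[OF b(1,2)] arc_into(3)[OF b(3,4)] eq
        in \<open>auto simp: eventually_at_left_0\<close>)
  then show ?thesis using ij by simp
qed

abbreviation under_crossings :: "nat \<Rightarrow> complex set" where
  "under_crossings i \<equiv> {c \<in> crossings D. fst (under_point D c) = i}"

text \<open>Along a component the arc changes only at its underpasses, which correspond to the
  crossings in \<open>under_crossings i\<close>; so the transport on the circle becomes
  combinatorial.\<close>

lemma component_transport:
  fixes act :: "'g::ab_group_add \<Rightarrow> 's \<Rightarrow> 's"
  assumes act: "additive_action act" and i: "i < ncomp D"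
    and step: "\<And>c. c \<in> under_crossings i \<Longrightarrow>
      st (arc_out_of D (under_point D c)) = act (J c) (st (arc_into D (under_point D c)))"
    and a: "a \<in> arcs D" "fst a = i"
  shows "st a = act (\<Sum>c\<in>under_crossings i. J c) (st a)"
    and "b \<in> arcs D \<Longrightarrow> fst b = i \<Longrightarrow> \<exists>Y\<subseteq>under_crossings i. st b = act (\<Sum>c\<in>Y. J c) (st a)"
proof -
  let ?U = "{z. (i, z) \<in> under D}" and ?p = "\<lambda>z. pos D (i, z)"
  let ?e = "\<lambda>z. st (arc_containing D (i, z))"
  have bij: "bij_betw ?p ?U (under_crossings i)" by (rule bij_under_crossings)
  obtain z where z: "z \<in> free_circle i" "arc_containing D (i, z) = a"
    using arc_contains_point[OF a(1)] a(2) by blast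
  have L: "\<forall>\<^sub>F s in at_left 0. ?e (w * cis s) = st (arc_into D (i, w))" if "norm w = 1" for w
    using arc_into(4)[OF i that] by eventually_elim simp
  have R: "\<forall>\<^sub>F s in at_right 0. ?e (w * cis s) = st (arc_out_of D (i, w))" if "norm w = 1" for w
    using arc_out_of(4)[OF i that] by eventually_elim simp
  have off: "st (arc_into D (i, w)) = ?e w \<and> st (arc_out_of D (i, w)) = ?e w" if "norm w = 1" "w \<notin> ?U" for w
    using arc_into(5)[OF i that(1)] arc_out_of(5)[OF i that(1)] that by simp
  have on: "st (arc_out_of D (i, w)) = act (J (?p w)) (st (arc_into D (i, w)))" if "w \<in> ?U" for w
    using step[of "?p w"] under_point_pos[of "(i, w)"] that by simp
  have U: "?U \<subseteq> sphere 0 1" using under_bounds by auto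
  have nz: "norm z = 1" "z \<notin> ?U" using z by auto
  have "?e z = act (\<Sum>w\<in>?U. J (?p w)) (?e z)"
    by (rule additive_action.circle_transport(1)[OF act finite_under[of i] U L R off on nz])
  then have "st a = act (\<Sum>w\<in>?U. J (?p w)) (st a)" unfolding z(2) .
  then show "st a = act (\<Sum>c\<in>under_crossings i. J c) (st a)"
    using sum.reindex_bij_betw[OF bij, of J] by simp
  assume b: "b \<in> arcs D" "fst b = i"
  obtain w where w: "w \<in> free_circle i" "arc_containing D (i, w) = b"
    using arc_contains_point[OF b(1)] b(2) by blast
  have nw: "norm w = 1" "w \<notin> ?U" using w by auto
  have "\<exists>Y\<subseteq>?U. ?e w = act (\<Sum>w\<in>Y. J (?p w)) (?e z)"
    by (rule additive_action.circle_transport(2)[OF act finite_under[of i] U L R off on nz nw])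
  then obtain Y where Y: "Y \<subseteq> ?U" "st b = act (\<Sum>w\<in>Y. J (?p w)) (st a)"
    unfolding z(2) w(2) by blast
  have "inj_on ?p Y" using bij Y(1) by (meson bij_betw_def inj_on_subset)
  then have "(\<Sum>w\<in>Y. J (?p w)) = (\<Sum>c\<in>?p ` Y. J c)" by (simp add: sum.reindex)
  moreover have "?p ` Y \<subseteq> under_crossings i" using bij Y(1) unfolding bij_betw_def by blast
  ultimately show "\<exists>Y\<subseteq>under_crossings i. st b = act (\<Sum>c\<in>Y. J c) (st a)"
    using Y(2) by (intro exI[of _ "?p ` Y"]) simp
qed

end

section \<open>Linear dependence of the relators\<close>

text \<open>A one-sided limit in the discrete sense, for functions that are eventually
  constant.\<close>

definition eventual_value :: "'a filter \<Rightarrow> ('a \<Rightarrow> 'b) \<Rightarrow> 'b" where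
  "eventual_value F f = (THE v. \<forall>\<^sub>F s in F. f s = v)"

lemma eventual_value_eq:
  assumes "F \<noteq> bot" "\<forall>\<^sub>F s in F. f s = v"
  shows "eventual_value F f = v"
  unfolding eventual_value_def
proof (rule the_equality)
  fix w assume "\<forall>\<^sub>F s in F. f s = w"
  with assms(2) have "\<forall>\<^sub>F s in F. w = v" by eventually_elim simp
  then show "w = v" using assms(1) by (simp add: eventually_const)
qed (rule assms)

context link
begin

lemma
  assumes "c \<in> crossings D"
  shows arc_into_under: "arc_into D (under_point D c) \<in> arcs D" "fst (arc_into D (under_point D c)) = fst (under_point D c)"
    and arc_out_of_under: "arc_out_of D (under_point D c) \<in> arcs D" "fst (arc_out_of D (under_point D c)) = fst (under_point D c)"
    and over_arc_arcs: "over_arc D c \<in> arcs D"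
    and over_arc_eq: "arc_into D (over_point D c) = over_arc D c" "arc_out_of D (over_point D c) = over_arc D c"
    and under_component: "fst (under_point D c) < ncomp D"
proof -
  obtain i z where u: "under_point D c = (i, z)" by force
  then have "i < ncomp D" "norm z = 1" using under_point(3)[OF assms] under_bounds by auto
  from arc_into[OF this] arc_out_of[OF this] this
  show "arc_into D (under_point D c) \<in> arcs D" "fst (arc_into D (under_point D c)) = fst (under_point D c)"
    "arc_out_of D (under_point D c) \<in> arcs D" "fst (arc_out_of D (under_point D c)) = fst (under_point D c)"
    "fst (under_point D c) < ncomp D"
    unfolding u by simp_all
  obtain j w where o: "over_point D c = (j, w)" by force
  then have j: "j < ncomp D" "norm w = 1" using over_point(1)[OF assms] by (auto simp: circles_iff)
  have w: "w \<in> free_circle j" using over_point(3)[OF assms] o j by simp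
  show "over_arc D c \<in> arcs D" unfolding over_arc_def o by (rule arc_containing_arcs[OF j(1) w])
  show "arc_into D (over_point D c) = over_arc D c" "arc_out_of D (over_point D c) = over_arc D c"
    using arc_into(5)[OF j w] arc_out_of(5)[OF j w] by (simp_all add: over_arc_def o)
qed

text \<open>The sign of the exponent is dictated by the relator: the left underpassing arc has the
  larger index and, compared with the right one, a coefficient with one factor t less.\<close>

definition weighted_arc :: "nat \<times> complex \<Rightarrow> arc \<Rightarrow>\<^sub>0 laurent" where
  "weighted_arc x = Poly_Mapping.single (arc_containing D x) (tpow (- index D x))"

definition value_before :: "nat \<times> complex \<Rightarrow> arc \<Rightarrow>\<^sub>0 laurent" where
  "value_before x = eventual_value (at_left 0) (\<lambda>s. weighted_arc (rotate_point x s))"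

definition value_after :: "nat \<times> complex \<Rightarrow> arc \<Rightarrow>\<^sub>0 laurent" where
  "value_after x = eventual_value (at_right 0) (\<lambda>s. weighted_arc (rotate_point x s))"

lemma weighted_arc_sides:
  assumes x: "x \<in> circles D"
  shows "\<forall>\<^sub>F s in at_right 0. index D (rotate_point x s) = m \<Longrightarrow>
      \<forall>\<^sub>F s in at_right 0. weighted_arc (rotate_point x s) = Poly_Mapping.single (arc_out_of D x) (tpow (- m))"
    and "\<forall>\<^sub>F s in at_left 0. index D (rotate_point x s) = m \<Longrightarrow>
      \<forall>\<^sub>F s in at_left 0. weighted_arc (rotate_point x s) = Poly_Mapping.single (arc_into D x) (tpow (- m))"
proof -
  have b: "fst x < ncomp D" "norm (snd x) = 1" using x by (cases x; simp add: circles_iff)+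
  have r: "\<forall>\<^sub>F s in at_right 0. arc_containing D (rotate_point x s) = arc_out_of D x"
    using arc_out_of(4)[OF b] by (simp add: rotate_point_def)
  have l: "\<forall>\<^sub>F s in at_left 0. arc_containing D (rotate_point x s) = arc_into D x"
    using arc_into(4)[OF b] by (simp add: rotate_point_def)
  show "\<forall>\<^sub>F s in at_right 0. weighted_arc (rotate_point x s) = Poly_Mapping.single (arc_out_of D x) (tpow (- m))"
    if "\<forall>\<^sub>F s in at_right 0. index D (rotate_point x s) = m"
    using that r by eventually_elim (simp add: weighted_arc_def)
  show "\<forall>\<^sub>F s in at_left 0. weighted_arc (rotate_point x s) = Poly_Mapping.single (arc_into D x) (tpow (- m))"
    if "\<forall>\<^sub>F s in at_left 0. index D (rotate_point x s) = m"
    using that l by eventually_elim (simp add: weighted_arc_def)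
qed

lemma weighted_arc_crossing:
  assumes x: "x \<in> circles D" and y: "y \<in> circles D" and neq: "x \<noteq> y" and pos_eq: "pos D x = pos D y"
  defines "\<kappa> \<equiv> cross (velocity D y) (velocity D x)" and "B \<equiv> crossing_index x y"
  shows "\<forall>\<^sub>F s in at_right 0. weighted_arc (rotate_point x s) =
      Poly_Mapping.single (arc_out_of D x) (tpow (- (B + (if \<kappa> > 0 then 1 else 0))))"
    and "\<forall>\<^sub>F s in at_left 0. weighted_arc (rotate_point x s) =
      Poly_Mapping.single (arc_into D x) (tpow (- (B + (if \<kappa> < 0 then 1 else 0))))"
proof -
  show "\<forall>\<^sub>F s in at_right 0. weighted_arc (rotate_point x s) =
      Poly_Mapping.single (arc_out_of D x) (tpow (- (B + (if \<kappa> > 0 then 1 else 0))))"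
    by (rule weighted_arc_sides(1)[OF x])
      (use index_near_crossing[OF x y neq pos_eq, of 1] in \<open>simp add: \<kappa>_def B_def\<close>)
  show "\<forall>\<^sub>F s in at_left 0. weighted_arc (rotate_point x s) =
      Poly_Mapping.single (arc_into D x) (tpow (- (B + (if \<kappa> < 0 then 1 else 0))))"
    by (rule weighted_arc_sides(2)[OF x])
      (use index_near_crossing[OF x y neq pos_eq, of "-1"] in \<open>simp add: \<kappa>_def B_def eventually_at_left_0\<close>)
qed

lemma value_crossing:
  assumes x: "x \<in> circles D" and y: "y \<in> circles D" and neq: "x \<noteq> y" and pos_eq: "pos D x = pos D y"
  defines "\<kappa> \<equiv> cross (velocity D y) (velocity D x)" and "B \<equiv> crossing_index x y"
  shows "value_after x = Poly_Mapping.single (arc_out_of D x) (tpow (- (B + (if \<kappa> > 0 then 1 else 0))))"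
    and "value_before x = Poly_Mapping.single (arc_into D x) (tpow (- (B + (if \<kappa> < 0 then 1 else 0))))"
  unfolding value_after_def value_before_def \<kappa>_def B_def
  by (rule eventual_value_eq[OF trivial_limit_at_right_real weighted_arc_crossing(1)[OF x y neq pos_eq]],
      rule eventual_value_eq[OF trivial_limit_at_left_real weighted_arc_crossing(2)[OF x y neq pos_eq]])

lemma weighted_arc_regular:
  assumes x: "x \<in> circles D" "pos D x \<notin> crossings D"
  shows "\<forall>\<^sub>F s in at_right 0. weighted_arc (rotate_point x s) = weighted_arc x"
    and "\<forall>\<^sub>F s in at_left 0. weighted_arc (rotate_point x s) = weighted_arc x"
proof -
  have b: "fst x < ncomp D" "norm (snd x) = 1" using x by (cases x; simp add: circles_iff)+
  have f: "snd x \<in> free_circle (fst x)" using b x(2) under_points by auto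
  show "\<forall>\<^sub>F s in at_right 0. weighted_arc (rotate_point x s) = weighted_arc x"
    using weighted_arc_sides(1)[OF x(1) index_locally_constant[OF x]] arc_out_of(5)[OF b f]
    by (simp add: weighted_arc_def)
  show "\<forall>\<^sub>F s in at_left 0. weighted_arc (rotate_point x s) = weighted_arc x"
    using weighted_arc_sides(2)[OF x(1) index_locally_constant[OF x]] arc_into(5)[OF b f]
    by (simp add: weighted_arc_def)
qed

lemma crossing_partner:
  assumes "x \<in> circles D" "pos D x \<in> crossings D"
  obtains y where "y \<in> circles D" "x \<noteq> y" "pos D x = pos D y"
proof -
  let ?c = "pos D x"
  show thesis
  proof (cases "x = over_point D ?c")
    case True
    show thesis
      by (rule that[OF under_point(1)[OF assms(2)]])
        (use over_neq_under[OF assms(2)] under_point(2)[OF assms(2)] True in simp_all)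
  next
    case False
    show thesis
      by (rule that[OF over_point(1)[OF assms(2)] False]) (simp add: over_point(2)[OF assms(2)])
  qed
qed

lemma weighted_arc_eventually:
  assumes x: "x \<in> circles D"
  shows "\<forall>\<^sub>F s in at_right 0. weighted_arc (rotate_point x s) = value_after x"
    and "\<forall>\<^sub>F s in at_left 0. weighted_arc (rotate_point x s) = value_before x"
proof -
  have "(\<forall>\<^sub>F s in at_right 0. weighted_arc (rotate_point x s) = value_after x) \<and>
    (\<forall>\<^sub>F s in at_left 0. weighted_arc (rotate_point x s) = value_before x)"
  proof (cases "pos D x \<in> crossings D")
    case True
    obtain y where "y \<in> circles D" "x \<noteq> y" "pos D x = pos D y" by (rule crossing_partner[OF x True])
    note y = x this
    show ?thesis using weighted_arc_crossing[OF y] unfolding value_crossing[OF y] by blast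
  next
    case False
    have "value_after x = weighted_arc x" "value_before x = weighted_arc x"
      unfolding value_after_def value_before_def
      by (rule eventual_value_eq[OF trivial_limit_at_right_real weighted_arc_regular(1)[OF x False]],
          rule eventual_value_eq[OF trivial_limit_at_left_real weighted_arc_regular(2)[OF x False]])
    then show ?thesis using weighted_arc_regular[OF x False] by simp
  qed
  then show "\<forall>\<^sub>F s in at_right 0. weighted_arc (rotate_point x s) = value_after x"
    "\<forall>\<^sub>F s in at_left 0. weighted_arc (rotate_point x s) = value_before x" by auto
qed

abbreviation jump :: "nat \<times> complex \<Rightarrow> arc \<Rightarrow>\<^sub>0 laurent" where
  "jump x \<equiv> value_after x - value_before x"

text \<open>After a full turn the weighted arc returns to its initial value, so its jumps
  cancel.\<close>

lemma sum_jumps_component: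
  assumes i: "i < ncomp D"
  shows "(\<Sum>z | norm z = 1 \<and> pos D (i, z) \<in> crossings D. jump (i, z)) = 0"
proof -
  let ?X = "{z. norm z = 1 \<and> pos D (i, z) \<in> crossings D}"
  have circ: "(i, z) \<in> circles D \<longleftrightarrow> norm z = 1" for z using i by (simp add: circles_iff)
  have fin: "finite ?X"
    by (rule finite_subset[OF _ finite_imageI[OF finite_crossing_points, of snd]]) (use circ in force)
  obtain s where "1 * cis s \<notin> ?X"
    using eventually_happens'[OF _ eventually_rotate_notin[OF fin, of 1]] by (auto simp: at_neq_bot)
  then obtain z where z: "norm z = 1" "z \<notin> ?X" by (metis mult_1 norm_cis)
  have act: "additive_action ((+) :: (arc \<Rightarrow>\<^sub>0 laurent) \<Rightarrow> _)"
    by unfold_locales (simp_all add: add.assoc)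
  have "weighted_arc (i, z) = (\<Sum>z\<in>?X. jump (i, z)) + weighted_arc (i, z)"
  proof (rule additive_action.circle_transport(1)[OF act fin, where el = "\<lambda>z. value_before (i, z)" and er = "\<lambda>z. value_after (i, z)" and e = "\<lambda>z. weighted_arc (i, z)"])
    show "?X \<subseteq> sphere 0 1" by auto
    show "\<forall>\<^sub>F s in at_left 0. weighted_arc (i, w * cis s) = value_before (i, w)" if "norm w = 1" for w
      using weighted_arc_eventually(2)[of "(i, w)"] that circ by (simp add: rotate_point_def)
    show "\<forall>\<^sub>F s in at_right 0. weighted_arc (i, w * cis s) = value_after (i, w)" if "norm w = 1" for w
      using weighted_arc_eventually(1)[of "(i, w)"] that circ by (simp add: rotate_point_def)
    show "value_before (i, w) = weighted_arc (i, w) \<and> value_after (i, w) = weighted_arc (i, w)"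
      if "norm w = 1" "w \<notin> ?X" for w
    proof -
      have w: "(i, w) \<in> circles D" "pos D (i, w) \<notin> crossings D" using that circ by auto
      show ?thesis
        unfolding value_after_def value_before_def
        by (intro conjI eventual_value_eq[OF trivial_limit_at_right_real weighted_arc_regular(1)[OF w]]
            eventual_value_eq[OF trivial_limit_at_left_real weighted_arc_regular(2)[OF w]])
    qed
  qed (use z in auto)
  then show ?thesis by simp
qed

text \<open>By the index jumps the right underpassing arc carries exponent - B and the left one - B
  - 1, whichever is incoming, while the overpassing arc changes between these two exponents.
  Extracting the power - B - 1 leaves the relator up to sign.\<close>

lemma jump_crossing:
  assumes c: "c \<in> crossings D"
  defines "B \<equiv> crossing_index (over_point D c) (under_point D c)"
  shows "jump (over_point D c) + jump (under_point D c) =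
    lscale ((if under_right_to_left D c then -1 else 1) * tpow (- B - 1)) (relator D c)"
proof -
  let ?x = "over_point D c" and ?y = "under_point D c"
  have xy: "?x \<in> circles D" "?y \<in> circles D" "?x \<noteq> ?y" "pos D ?x = pos D ?y"
    using over_point[OF c] under_point[OF c] over_neq_under[OF c] by simp_all
  have yx: "?y \<in> circles D" "?x \<in> circles D" "?y \<noteq> ?x" "pos D ?y = pos D ?x" using xy by auto
  have B': "crossing_index ?y ?x = B" unfolding B_def by (rule crossing_index_commute[OF yx(3,4)])
  let ?k = "cross (velocity D ?x) (velocity D ?y)"
  have k: "cross (velocity D ?y) (velocity D ?x) = - ?k" by (simp add: cross_def)
  have k0: "?k \<noteq> 0" by (rule cross_nonzero[OF yx])
  have R: "under_right_to_left D c \<longleftrightarrow> ?k > 0" by (simp add: under_right_to_left_def)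
  have t: "tvar * tpow (- B - 1) = tpow (- B)" "tpow (- B - 1) * tvar = tpow (- B)"
    unfolding tvar_def by (simp_all add: mult_single)
  show ?thesis
  proof (cases "under_right_to_left D c")
    case True
    then have "?k > 0" using R by simp
    then show ?thesis using True
      unfolding value_crossing[OF xy] value_crossing[OF yx] B_def[symmetric] B' k over_arc_eq[OF c] relator_def
      by (simp add: right_arc_def left_arc_def lscale_simps lscale_single t algebra_simps single_diff single_uminus)
  next
    case False
    then have "?k < 0" using R k0 by simp
    then show ?thesis using False
      unfolding value_crossing[OF xy] value_crossing[OF yx] B_def[symmetric] B' k over_arc_eq[OF c] relator_def
      by (simp add: right_arc_def left_arc_def lscale_simps lscale_single t algebra_simps single_diff single_uminus)
  qed
qed

text \<open>All jumps are added in two ways: component by component they cancel, and crossing by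
  crossing they combine to the relators.\<close>

lemma relator_dependence:
  "\<exists>m :: complex \<Rightarrow> int. (\<Sum>c\<in>crossings D.
     lscale ((if under_right_to_left D c then -1 else 1) * tpow (m c)) (relator D c)) = 0"
proof -
  let ?CP = "{x \<in> circles D. pos D x \<in> crossings D}"
  let ?C = "crossings D"
  have "(\<Sum>i<ncomp D. \<Sum>z | norm z = 1 \<and> pos D (i, z) \<in> crossings D. jump (i, z)) = 0"
    by (rule sum.neutral) (simp add: sum_jumps_component)
  also have "(\<Sum>i<ncomp D. \<Sum>z | norm z = 1 \<and> pos D (i, z) \<in> crossings D. jump (i, z)) =
    (\<Sum>x\<in>(SIGMA i:{..<ncomp D}. {z. norm z = 1 \<and> pos D (i, z) \<in> crossings D}). jump x)"
    (is "_ = sum _ ?S")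
  proof -
    have "finite {z. norm z = 1 \<and> pos D (i, z) \<in> crossings D}" if "i < ncomp D" for i
      by (rule finite_subset[OF _ finite_imageI[OF finite_crossing_points, of snd]])
        (use that circles_iff in force)
    then show ?thesis by (subst sum.Sigma) auto
  qed
  also have "?S = ?CP" by (auto simp: circles_iff)
  also have "?CP = over_point D ` ?C \<union> under_point D ` ?C"
  proof (rule equalityI; rule subsetI)
    fix x assume x: "x \<in> ?CP"
    then have c: "pos D x \<in> ?C" by simp
    have "x = over_point D (pos D x) \<or> x = under_point D (pos D x)"
      by (rule double_point[OF over_point(1)[OF c] under_point(1)[OF c] over_neq_under[OF c]])
        (use x in \<open>simp_all add: over_point(2)[OF c] under_point(2)[OF c]\<close>)
    then show "x \<in> over_point D ` ?C \<union> under_point D ` ?C" using c by blast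
  qed (auto simp: over_point under_point)
  also have "(\<Sum>x\<in>over_point D ` ?C \<union> under_point D ` ?C. jump x) =
     (\<Sum>x\<in>over_point D ` ?C. jump x) + (\<Sum>x\<in>under_point D ` ?C. jump x)"
  proof (rule sum.union_disjoint)
    have "over_point D ` ?C \<subseteq> - under D" "under_point D ` ?C \<subseteq> under D"
      using over_point(3) under_point(3) by blast+
    then show "over_point D ` ?C \<inter> under_point D ` ?C = {}" by blast
  qed (use finite_crossings in auto)
  also have "(\<Sum>x\<in>over_point D ` ?C. jump x) = (\<Sum>c\<in>?C. jump (over_point D c))"
    by (rule sum.reindex_cong[OF _ HOL.refl HOL.refl]) (metis inj_onI over_point(2))
  also have "(\<Sum>x\<in>under_point D ` ?C. jump x) = (\<Sum>c\<in>?C. jump (under_point D c))"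
    by (rule sum.reindex_cong[OF _ HOL.refl HOL.refl]) (metis inj_onI under_point(2))
  also have "(\<Sum>c\<in>?C. jump (over_point D c)) + (\<Sum>c\<in>?C. jump (under_point D c)) =
    (\<Sum>c\<in>?C. jump (over_point D c) + jump (under_point D c))" by (simp only: sum.distrib)
  also have "\<dots> = (\<Sum>c\<in>?C. lscale ((if under_right_to_left D c then -1 else 1) *
     tpow (- crossing_index (over_point D c) (under_point D c) - 1)) (relator D c))"
    by (rule sum.cong[OF HOL.refl jump_crossing])
  finally show ?thesis
    by (intro exI[of _ "\<lambda>c. - crossing_index (over_point D c) (under_point D c) - 1"])
qed

end

section \<open>Linear algebra over the Laurent polynomials\<close>

lemma poly_mapping_expand:
  fixes f :: "'a \<Rightarrow>\<^sub>0 'b::comm_monoid_add"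
  shows "f = (\<Sum>x\<in>Poly_Mapping.keys f. Poly_Mapping.single x (Poly_Mapping.lookup f x))"
proof (rule poly_mapping_eqI)
  fix k
  show "Poly_Mapping.lookup f k = Poly_Mapping.lookup (\<Sum>x\<in>Poly_Mapping.keys f. Poly_Mapping.single x (Poly_Mapping.lookup f x)) k"
    by (cases "k \<in> Poly_Mapping.keys f")
      (auto simp: lookup_sum lookup_single when_def in_keys_iff intro!: sum.neutral[symmetric])
qed

lemma poly_mapping_additive_induct:
  fixes f :: "'a \<Rightarrow>\<^sub>0 'b::comm_monoid_add"
  assumes "Poly_Mapping.keys f \<subseteq> A" "P 0" "\<And>f g. P f \<Longrightarrow> P g \<Longrightarrow> P (f + g)"
    and "\<And>a r. a \<in> A \<Longrightarrow> P (Poly_Mapping.single a r)"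
  shows "P f"
proof -
  have "P (\<Sum>x\<in>X. Poly_Mapping.single x (Poly_Mapping.lookup f x))" if "X \<subseteq> A" "finite X" for X
    using that(2,1) by (induction X rule: finite_induct) (auto intro: assms)
  then show ?thesis using poly_mapping_expand[of f] assms(1) by (metis finite_keys)
qed

lemma laurent_induct:
  fixes r :: laurent
  assumes "P 0" "\<And>r s. P r \<Longrightarrow> P s \<Longrightarrow> P (r + s)" "\<And>n. P (tpow n)" "\<And>n. P (- tpow n)"
  shows "P r"
proof (rule poly_mapping_additive_induct[of r UNIV])
  fix n c :: int
  have 1: "P (Poly_Mapping.single n (of_nat k))" for k
    by (induction k) (simp_all add: assms single_add)
  have 2: "P (Poly_Mapping.single n (- of_nat k))" for k
  proof (induction k)
    case (Suc k)
    have "- int (Suc k) = - int k + - 1" by simp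
    then have eq: "Poly_Mapping.single n (- of_nat (Suc k)) = Poly_Mapping.single n (- of_nat k) + - tpow n"
      by (simp only: single_add single_uminus)
    show ?case unfolding eq by (rule assms(2)[OF Suc assms(4)])
  qed (simp add: assms)
  show "P (Poly_Mapping.single n c)"
    using 1[of "nat c"] 2[of "nat (- c)"] by (cases "c \<ge> 0") simp_all
qed (auto intro: assms)

text \<open>As an abelian group the free module is generated by the monomials; this serves for
  properties whose behaviour is known only under addition and under powers of t.\<close>

lemma laurent_module_induct:
  fixes f :: "'a \<Rightarrow>\<^sub>0 laurent"
  assumes "Poly_Mapping.keys f \<subseteq> A" "P 0" "\<And>f g. P f \<Longrightarrow> P g \<Longrightarrow> P (f + g)"
    and "\<And>a n. a \<in> A \<Longrightarrow> P (Poly_Mapping.single a (tpow n))"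
    and "\<And>a n. a \<in> A \<Longrightarrow> P (- Poly_Mapping.single a (tpow n))"
  shows "P f"
proof (rule poly_mapping_additive_induct[OF assms(1)])
  fix a r assume a: "a \<in> A"
  show "P (Poly_Mapping.single a r)"
    by (induction r rule: laurent_induct) (use a in \<open>auto simp: assms single_add single_uminus\<close>)
qed (use assms in auto)

text \<open>The common form of linear extensions, of \<open>augmentation\<close> and of
  \<open>component_weight\<close>: an additive map given on each coefficient.\<close>

definition psum :: "('a \<Rightarrow> 'b \<Rightarrow> 'c) \<Rightarrow> ('a \<Rightarrow>\<^sub>0 'b::zero) \<Rightarrow> 'c::comm_monoid_add" where
  "psum \<phi> f = (\<Sum>x\<in>Poly_Mapping.keys f. \<phi> x (Poly_Mapping.lookup f x))"

lemma psum_superset: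
  assumes "\<And>x. \<phi> x 0 = 0" "finite X" "Poly_Mapping.keys f \<subseteq> X"
  shows "psum \<phi> f = (\<Sum>x\<in>X. \<phi> x (Poly_Mapping.lookup f x))"
  unfolding psum_def using assms by (intro sum.mono_neutral_left) (auto simp: in_keys_iff)

lemma psum_add:
  fixes f :: "'a \<Rightarrow>\<^sub>0 'b::monoid_add"
  assumes "\<And>x. \<phi> x 0 = 0" "\<And>x a b. \<phi> x (a + b) = \<phi> x a + \<phi> x b"
  shows "psum \<phi> (f + g) = psum \<phi> f + psum \<phi> g"
proof -
  let ?X = "Poly_Mapping.keys f \<union> Poly_Mapping.keys g"
  have "psum \<phi> h = (\<Sum>x\<in>?X. \<phi> x (Poly_Mapping.lookup h x))" if "Poly_Mapping.keys h \<subseteq> ?X" for h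
    by (rule psum_superset) (use assms that in auto)
  then show ?thesis by (simp add: Poly_Mapping.keys_add lookup_add assms sum.distrib)
qed

lemma psum_single:
  assumes "\<phi> x 0 = 0"
  shows "psum \<phi> (Poly_Mapping.single x a) = \<phi> x a"
  using assms by (simp add: psum_def)

lemma psum_zero [simp]: "psum \<phi> 0 = 0"
  by (simp add: psum_def)

lemma linear_extension_psum: "linear_extension h = psum (\<lambda>x r. lscale r (h x))"
  by (simp add: fun_eq_iff linear_extension_def psum_def)

lemma
  shows linear_extension_add: "linear_extension h (f + g) = linear_extension h f + linear_extension h g"
    and linear_extension_single: "linear_extension h (Poly_Mapping.single x r) = lscale r (h x)"
    and linear_extension_zero: "linear_extension h 0 = 0"
  unfolding linear_extension_psum by (simp_all add: psum_add psum_single lscale_simps)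

lemma linear_extension_lscale: "linear_extension h (lscale r f) = lscale r (linear_extension h f)"
  by (rule poly_mapping_additive_induct[of f UNIV])
    (auto simp: linear_extension_add linear_extension_single linear_extension_zero lscale_simps lscale_single)

lemma linear_extension_diff: "linear_extension h (f - g) = linear_extension h f - linear_extension h g"
  using linear_extension_add[of h "f - g" g] by (simp add: algebra_simps)

text \<open>Evaluation at t = 1.\<close>

definition augmentation :: "laurent \<Rightarrow> int" where
  "augmentation = psum (\<lambda>_ c. c)"

lemma
  shows augmentation_add: "augmentation (r + s) = augmentation r + augmentation s"
    and augmentation_single: "augmentation (Poly_Mapping.single n c) = c"
    and augmentation_zero: "augmentation 0 = 0"
  unfolding augmentation_def by (simp_all add: psum_add psum_single)

lemma augmentation_minus: "augmentation (- r) = - augmentation r"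
  using augmentation_add[of r "- r"] by (simp add: augmentation_zero)

lemma augmentation_diff: "augmentation (r - s) = augmentation r - augmentation s"
  using augmentation_add[of r "- s"] by (simp add: augmentation_minus)

lemma augmentation_one: "augmentation 1 = 1"
  using augmentation_single[of 0 1] by simp

lemma augmentation_tvar: "augmentation tvar = 1"
  by (simp add: tvar_def augmentation_single)

lemma augmentation_mult: "augmentation (r * s) = augmentation r * augmentation s"
proof (rule poly_mapping_additive_induct[of r UNIV])
  fix m c :: int
  show "augmentation (Poly_Mapping.single m c * s) = augmentation (Poly_Mapping.single m c) * augmentation s"
    by (rule poly_mapping_additive_induct[of s UNIV])
      (auto simp: mult_single augmentation_single augmentation_zero augmentation_add algebra_simps)
qed (auto simp: augmentation_zero augmentation_add algebra_simps)

lemma augmentation_of_int: "augmentation (of_int n) = n"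
  by (subst single_of_int[symmetric]) (simp add: augmentation_single)

lemmas augmentation_simps = augmentation_add augmentation_zero augmentation_minus augmentation_diff
  augmentation_one augmentation_tvar augmentation_mult augmentation_of_int augmentation_single

lemma tvar_inverse: "tpow (-1) * tvar = 1" "tvar * tpow (-1) = 1"
  by (simp_all add: tvar_def mult_single)

lemma tpow_divide: "\<exists>q. tpow n = 1 + (1 - tvar) * q"
proof -
  have pos: "\<exists>q. tpow (int k) = 1 + (1 - tvar) * q" for k
  proof (induction k)
    case (Suc k)
    then obtain q where q: "tpow (int k) = 1 + (1 - tvar) * q" by blast
    have "tpow (int (Suc k)) = tvar * tpow (int k)" by (simp add: tvar_def mult_single)
    also have "\<dots> = 1 + (1 - tvar) * (tvar * q - 1)" unfolding q by (simp add: algebra_simps)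
    finally show ?case by blast
  qed (auto intro!: exI[of _ 0])
  have neg: "\<exists>q. tpow (- int k) = 1 + (1 - tvar) * q" for k
  proof -
    obtain q where q: "tpow (int k) = 1 + (1 - tvar) * q" using pos by blast
    have "tpow (- int k) * tpow (int k) = 1" by (simp add: mult_single)
    then have "tpow (- int k) = 1 + (1 - tvar) * (- q * tpow (- int k))"
      unfolding q by (simp add: algebra_simps)
    then show ?thesis by blast
  qed
  show ?thesis using pos[of "nat n"] neg[of "nat (- n)"] by (cases "n \<ge> 0") simp_all
qed

text \<open>Every power of t is 1 modulo 1 - t, so the kernel of the evaluation at t = 1 is the
  ideal generated by 1 - t.\<close>

lemma laurent_divide: "\<exists>q. r = of_int (augmentation r) + (1 - tvar) * q"
proof (induction r rule: laurent_induct)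
  case 1
  show ?case by (rule exI[of _ 0]) (simp add: augmentation_simps)
next
  case (2 r s)
  then obtain p q where "r = of_int (augmentation r) + (1 - tvar) * p" "s = of_int (augmentation s) + (1 - tvar) * q"
    by blast
  then have "r + s = (of_int (augmentation r) + (1 - tvar) * p) + (of_int (augmentation s) + (1 - tvar) * q)"
    by (rule arg_cong2)
  then show ?case
    by (intro exI[of _ "p + q"]) (simp add: augmentation_simps distrib_left add_ac)
next
  case (3 n)
  show ?case using tpow_divide[of n] by (simp add: augmentation_simps)
next
  case (4 n)
  obtain q where "tpow n = 1 + (1 - tvar) * q" using tpow_divide by blast
  then show ?case by (intro exI[of _ "- q"]) (simp add: augmentation_simps)
qed

lemma one_minus_tvar_nonzero: "1 - tvar \<noteq> 0"
proof
  assume "1 - tvar = 0"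
  then have "Poly_Mapping.lookup (1 - tvar) 0 = 0" by simp
  then show False by (simp add: tvar_def lookup_minus lookup_single lookup_one)
qed

text \<open>The coefficients form a domain. Cancellation is legitimate only in the free module: in
  the Alexander module 1 - t may have an annihilator, which is computed below by lifting to the free
  module and cancelling there.\<close>

lemma lscale_one_minus_tvar_cancel: "lscale (1 - tvar) f = lscale (1 - tvar) g \<longleftrightarrow> f = g"
proof
  assume "lscale (1 - tvar) f = lscale (1 - tvar) g"
  then have "lscale (1 - tvar) (f - g) = 0" by (simp add: lscale_simps)
  then have "(1 - tvar) * Poly_Mapping.lookup (f - g) x = 0" for x
    by (metis lookup_lscale lookup_zero)
  then have "Poly_Mapping.lookup (f - g) x = 0" for x
    using one_minus_tvar_nonzero by simp
  then have "f - g = 0" by (intro poly_mapping_eqI) simp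
  then show "f = g" by simp
qed simp

text \<open>Terms are evaluated in the affine quandle of the free module; the \<open>Inv\<close>
  clause solves x = t y + (1 - t) u for y.\<close>

primrec alexander_value :: "'a qterm \<Rightarrow> ('a \<Rightarrow>\<^sub>0 laurent)" where
  "alexander_value (Gen a) = Poly_Mapping.single a 1"
| "alexander_value (Op s u) = lscale tvar (alexander_value s) + lscale (1 - tvar) (alexander_value u)"
| "alexander_value (Inv s u) = lscale (tpow (-1)) (alexander_value s - lscale (1 - tvar) (alexander_value u))"

lemma keys_diff_subset: "Poly_Mapping.keys f \<subseteq> A \<Longrightarrow> Poly_Mapping.keys g \<subseteq> A \<Longrightarrow> Poly_Mapping.keys (f - g :: 'a \<Rightarrow>\<^sub>0 laurent) \<subseteq> A"
proof -
  have "x \<in> Poly_Mapping.keys f \<or> x \<in> Poly_Mapping.keys g" if "x \<in> Poly_Mapping.keys (f - g)" for x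
    using that by (auto simp: in_keys_iff lookup_minus)
  then show "Poly_Mapping.keys f \<subseteq> A \<Longrightarrow> Poly_Mapping.keys g \<subseteq> A \<Longrightarrow> ?thesis" by blast
qed

lemma keys_add_subset: "Poly_Mapping.keys f \<subseteq> A \<Longrightarrow> Poly_Mapping.keys g \<subseteq> A \<Longrightarrow> Poly_Mapping.keys (f + g :: 'a \<Rightarrow>\<^sub>0 laurent) \<subseteq> A"
  using Poly_Mapping.keys_add[of f g] by blast

lemma keys_lscale: "Poly_Mapping.keys f \<subseteq> A \<Longrightarrow> Poly_Mapping.keys (lscale r f) \<subseteq> A"
  using keys_lscale_subset[of r f] by blast

lemmas keys_subset = keys_diff_subset keys_add_subset keys_lscale

lemma keys_alexander_value: "s \<in> qterms A \<Longrightarrow> Poly_Mapping.keys (alexander_value s) \<subseteq> A"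
  by (induction s) (simp_all add: qterms_iffs keys_subset)

lemma coeff_sum_diff: "coeff_sum (f - g) = coeff_sum f - coeff_sum g"
  using coeff_sum_add[of "f - g" g] by (simp add: algebra_simps)

lemma coeff_sum_zero: "coeff_sum 0 = 0"
  by (simp add: coeff_sum_def)

lemma coeff_sum_alexander_value: "coeff_sum (alexander_value s) = 1"
  by (induction s)
    (simp_all add: coeff_sum_add coeff_sum_lscale coeff_sum_diff coeff_sum_single tvar_inverse)

section \<open>Congruences modulo a submodule\<close>

locale lsubmodule =
  fixes N :: "('a \<Rightarrow>\<^sub>0 laurent) set"
  assumes zero_mem: "0 \<in> N" and add_mem: "f \<in> N \<Longrightarrow> g \<in> N \<Longrightarrow> f + g \<in> N"
    and lscale_mem: "f \<in> N \<Longrightarrow> lscale r f \<in> N"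
begin

lemma minus_mem: "f \<in> N \<Longrightarrow> - f \<in> N"
  using lscale_mem[of f "-1"] by (simp add: lscale_simps)

lemma diff_mem: "f \<in> N \<Longrightarrow> g \<in> N \<Longrightarrow> f - g \<in> N"
  using add_mem[OF _ minus_mem] by fastforce

lemma sum_mem: "(\<And>x. x \<in> X \<Longrightarrow> h x \<in> N) \<Longrightarrow> sum h X \<in> N"
  by (induction X rule: infinite_finite_induct) (auto intro: zero_mem add_mem)

lemma cong_sym: "f - g \<in> N \<Longrightarrow> g - f \<in> N"
  using minus_mem[of "f - g"] by simp

lemma cong_trans: "f - g \<in> N \<Longrightarrow> g - h \<in> N \<Longrightarrow> f - h \<in> N"
  using add_mem[of "f - g" "g - h"] by simp

lemma cong_add: "f - f' \<in> N \<Longrightarrow> g - g' \<in> N \<Longrightarrow> (f + g) - (f' + g') \<in> N"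
  using add_mem[of "f - f'" "g - g'"] by (simp add: algebra_simps)

lemma cong_diff: "f - f' \<in> N \<Longrightarrow> g - g' \<in> N \<Longrightarrow> (f - g) - (f' - g') \<in> N"
  using diff_mem[of "f - f'" "g - g'"] by (simp add: algebra_simps)

lemma cong_lscale: "f - f' \<in> N \<Longrightarrow> lscale r f - lscale r f' \<in> N"
  using lscale_mem[of "f - f'" r] by (simp add: lscale_simps)

text \<open>The affine operation satisfies the axioms of a medial quandle identically in the free
  module; only the given relations need the submodule.\<close>

lemma alexander_value_mq_eq:
  assumes R: "\<And>x y z. (x, y, z) \<in> R \<Longrightarrow> x \<in> A \<Longrightarrow> y \<in> A \<Longrightarrow> z \<in> A \<Longrightarrow>
    alexander_value (Op (Gen x) (Gen y)) - alexander_value (Gen z) \<in> N"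
  shows "mq_eq A R s u \<Longrightarrow> alexander_value s - alexander_value u \<in> N"
proof (induction rule: mq_eq.induct)
  case (Inv_cong s s' u u')
  then show ?case unfolding alexander_value.simps by (intro cong_lscale cong_diff)
next
  case (Op_cong s s' u u')
  then show ?case unfolding alexander_value.simps by (intro cong_lscale cong_add)
next
  case (sym s u)
  from sym.IH show ?case by (rule cong_sym)
next
  case (trans s u v)
  from trans.IH show ?case by (rule cong_trans)
next
  case (rel x y z)
  then show ?case by (intro R)
qed (simp_all add: lscale_simps zero_mem tvar_inverse algebra_simps)

end

lemma relations_range:
  assumes "finite (crossings D)"
  shows "relations D = range (\<lambda>r. \<Sum>c\<in>crossings D. lscale (r c) (relator D c))"
proof (rule equalityI; rule subsetI)
  fix f assume "f \<in> relations D"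
  then obtain h where h: "Poly_Mapping.keys h \<subseteq> crossings D" "f = linear_extension (relator D) h"
    by (auto simp: relations_def free_module_def)
  have "f = (\<Sum>c\<in>crossings D. lscale (Poly_Mapping.lookup h c) (relator D c))"
    unfolding h(2) linear_extension_psum by (rule psum_superset) (use assms h in \<open>simp_all add: lscale_simps\<close>)
  then show "f \<in> range (\<lambda>r. \<Sum>c\<in>crossings D. lscale (r c) (relator D c))" by blast
next
  fix f assume "f \<in> range (\<lambda>r. \<Sum>c\<in>crossings D. lscale (r c) (relator D c))"
  then obtain r where r: "f = (\<Sum>c\<in>crossings D. lscale (r c) (relator D c))" by blast
  define h where "h = (\<Sum>c\<in>crossings D. Poly_Mapping.single c (r c))"
  have "linear_extension (relator D) (\<Sum>c\<in>X. Poly_Mapping.single c (r c)) = (\<Sum>c\<in>X. lscale (r c) (relator D c))" for X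
    by (induction X rule: infinite_finite_induct)
      (simp_all add: linear_extension_zero linear_extension_add linear_extension_single)
  then have "f = linear_extension (relator D) h" by (simp add: r h_def)
  moreover have "Poly_Mapping.keys (\<Sum>c\<in>X. Poly_Mapping.single c (r c)) \<subseteq> X" if "finite X" for X
    using that
  proof induction
    case (insert x F)
    then show ?case by (simp, intro keys_add_subset) auto
  qed simp
  then have "h \<in> carrier (free_module (crossings D))"
    unfolding h_def free_module_def using assms by simp
  ultimately show "f \<in> relations D" unfolding relations_def by blast
qed

context link
begin

lemma relations_iff: "f \<in> relations D \<longleftrightarrow> (\<exists>r. f = (\<Sum>c\<in>crossings D. lscale (r c) (relator D c)))"
  unfolding relations_range[OF finite_crossings] by blast

sublocale relations: lsubmodule "relations D"
proof
  show "0 \<in> relations D" by (rule zero_in_relations)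
  fix f g assume "f \<in> relations D" "g \<in> relations D"
  then obtain r s where "f = (\<Sum>c\<in>crossings D. lscale (r c) (relator D c))"
    "g = (\<Sum>c\<in>crossings D. lscale (s c) (relator D c))" by (auto simp: relations_iff)
  then show "f + g \<in> relations D" unfolding relations_iff
    by (intro exI[of _ "\<lambda>c. r c + s c"]) (simp add: lscale_simps sum.distrib)
next
  fix f r assume "f \<in> relations D"
  then obtain s where "f = (\<Sum>c\<in>crossings D. lscale (s c) (relator D c))" by (auto simp: relations_iff)
  then show "lscale r f \<in> relations D" unfolding relations_iff
    by (intro exI[of _ "\<lambda>c. r * s c"]) (simp add: lscale_simps lscale_sum_right)
qed

lemma relator_mem: "c \<in> crossings D \<Longrightarrow> relator D c \<in> relations D"
  unfolding relations_iff using finite_crossings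
  by (intro exI[of _ "\<lambda>c'. if c' = c then 1 else 0"]) (simp add: lscale_simps if_distrib if_distribR sum.delta cong: if_cong)

lemma right_left_arcs:
  assumes "c \<in> crossings D"
  shows "right_arc D c \<in> arcs D" "left_arc D c \<in> arcs D"
    "fst (right_arc D c) = fst (under_point D c)" "fst (left_arc D c) = fst (under_point D c)"
  using arc_into_under[OF assms] arc_out_of_under[OF assms] by (auto simp: right_arc_def left_arc_def)

abbreviation mq_relations where
  "mq_relations \<equiv> (\<lambda>c. (right_arc D c, over_arc D c, left_arc D c)) ` crossings D"

lemma MQ_eq: "MQ D = presented_mq (arcs D) mq_relations"
  by (simp add: MQ_def)

lemma alexander_value_relator:
  "alexander_value (Op (Gen (right_arc D c)) (Gen (over_arc D c))) - alexander_value (Gen (left_arc D c)) = relator D c"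
  by (simp add: relator_def lscale_single)

lemma alexander_value_cong:
  "mq_eq (arcs D) mq_relations s u \<Longrightarrow> alexander_value s - alexander_value u \<in> relations D"
  by (rule relations.alexander_value_mq_eq) (auto simp: alexander_value_relator simp del: alexander_value.simps intro: relator_mem)

end

section \<open>From quandles to modules\<close>

context link
begin

abbreviation kernel_elements :: "(arc \<Rightarrow>\<^sub>0 laurent) set" where
  "kernel_elements \<equiv> {f. Poly_Mapping.keys f \<subseteq> arcs D \<and> coeff_sum f = 0}"

definition coset :: "(arc \<Rightarrow>\<^sub>0 laurent) \<Rightarrow> (arc \<Rightarrow>\<^sub>0 laurent) set" where
  "coset f = relations D +>\<^bsub>free_module (arcs D)\<^esub> f"

lemma coset_image: "coset f = (\<lambda>r. r + f) ` relations D"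
  unfolding coset_def a_r_coset_def' by (auto simp: free_module_def)

lemma mem_coset: "g \<in> coset f \<longleftrightarrow> g - f \<in> relations D"
  unfolding coset_image by (metis (no_types, lifting) add_diff_cancel_right' diff_add_cancel image_iff)

lemma coset_eq_iff: "coset f = coset g \<longleftrightarrow> f - g \<in> relations D"
proof
  assume "coset f = coset g"
  moreover have "f \<in> coset f" by (simp add: mem_coset relations.zero_mem)
  ultimately show "f - g \<in> relations D" by (simp add: mem_coset)
next
  assume fg: "f - g \<in> relations D"
  show "coset f = coset g"
    by (auto simp: mem_coset intro: relations.cong_trans[OF _ fg] relations.cong_trans[OF _ relations.cong_sym[OF fg]])
qed

lemma invariant_carrier: "carrier (reduced_alexander_invariant D) = coset ` kernel_elements"
proof -
  have "carrier (reduced_alexander_module D) = coset ` {f. Poly_Mapping.keys f \<subseteq> arcs D}"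
    by (auto simp: reduced_alexander_module_def quotient_module_def A_RCOSETS_def' coset_def free_module_def)
  then show ?thesis
    by (auto simp: reduced_alexander_invariant_def a_kernel_def' coset_def crowell_coset Lambda_def)
qed

lemma invariant_add: "coset f \<oplus>\<^bsub>reduced_alexander_invariant D\<^esub> coset g = coset (f + g)"
proof -
  have "coset f \<oplus>\<^bsub>reduced_alexander_invariant D\<^esub> coset g = (\<Union>x\<in>coset f. \<Union>y\<in>coset g. {x + y})"
    by (simp add: reduced_alexander_invariant_def reduced_alexander_module_def quotient_module_def
        set_add_def' free_module_def)
  also have "\<dots> = coset (f + g)"
  proof (rule equalityI; rule subsetI)
    fix h assume "h \<in> (\<Union>x\<in>coset f. \<Union>y\<in>coset g. {x + y})"
    then show "h \<in> coset (f + g)" by (auto simp: mem_coset intro: relations.cong_add)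
  next
    fix h assume h: "h \<in> coset (f + g)"
    have "h - g \<in> coset f" using h by (simp add: mem_coset algebra_simps)
    moreover have "g \<in> coset g" by (simp add: mem_coset relations.zero_mem)
    moreover have "h = (h - g) + g" by simp
    ultimately show "h \<in> (\<Union>x\<in>coset f. \<Union>y\<in>coset g. {x + y})" by blast
  qed
  finally show ?thesis .
qed

lemma invariant_smult: "r \<odot>\<^bsub>reduced_alexander_invariant D\<^esub> coset f = coset (lscale r f)"
proof -
  have "r \<odot>\<^bsub>reduced_alexander_invariant D\<^esub> coset f = (\<Union>x\<in>coset f. coset (lscale r x))"
    by (simp add: reduced_alexander_invariant_def reduced_alexander_module_def quotient_module_def
        free_module_def coset_def)
  also have "\<dots> = (\<Union>x\<in>coset f. coset (lscale r f))"
    by (rule SUP_cong[OF HOL.refl]) (simp add: coset_eq_iff mem_coset relations.cong_lscale)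
  also have "\<dots> = coset (lscale r f)"
    using relations.zero_mem mem_coset[of f f] by auto
  finally show ?thesis .
qed

end

locale two_links = L: link D + L': link D' for D D'
begin

text \<open>Elements of the invariants are cosets. Passing to the quotient is done once here, so
  that maps can be handled on representatives and need to be linear only modulo the
  relations.\<close>

lemma module_isomorphic_from_representatives:
  assumes p: "\<And>f. f \<in> L.kernel_elements \<Longrightarrow> p f \<in> L'.kernel_elements"
    and inj: "\<And>f g. f \<in> L.kernel_elements \<Longrightarrow> g \<in> L.kernel_elements \<Longrightarrow>
      f - g \<in> relations D \<longleftrightarrow> p f - p g \<in> relations D'"
    and surj: "\<And>h. h \<in> L'.kernel_elements \<Longrightarrow> \<exists>f\<in>L.kernel_elements. p f - h \<in> relations D'"
    and add: "\<And>f g. f \<in> L.kernel_elements \<Longrightarrow> g \<in> L.kernel_elements \<Longrightarrow> p (f + g) - (p f + p g) \<in> relations D'"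
    and smult: "\<And>r f. f \<in> L.kernel_elements \<Longrightarrow> p (lscale r f) - lscale r (p f) \<in> relations D'"
  shows "module_isomorphic (reduced_alexander_invariant D) (reduced_alexander_invariant D')"
proof -
  let ?Z = "L.kernel_elements"
  define rep where "rep X = (SOME f. f \<in> ?Z \<and> L.coset f = X)" for X
  define F where "F X = L'.coset (p (rep X))" for X
  have rep: "rep (L.coset f) \<in> ?Z" "L.coset (rep (L.coset f)) = L.coset f" if "f \<in> ?Z" for f
    using someI[of "\<lambda>g. g \<in> ?Z \<and> L.coset g = L.coset f" f] that unfolding rep_def by blast+
  have F: "F (L.coset f) = L'.coset (p f)" if "f \<in> ?Z" for f
    unfolding F_def L'.coset_eq_iff using inj[OF rep(1)[OF that] that] rep(2)[OF that] by (simp add: L.coset_eq_iff)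
  have cl: "f + g \<in> ?Z" "lscale r f \<in> ?Z" if "f \<in> ?Z" "g \<in> ?Z" for f g r
    using that by (simp_all add: coeff_sum_add coeff_sum_lscale keys_subset)
  show ?thesis
    unfolding module_isomorphic_def
  proof (intro exI[of _ F] conjI ballI allI)
    show "bij_betw F (carrier (reduced_alexander_invariant D)) (carrier (reduced_alexander_invariant D'))"
      unfolding bij_betw_def L.invariant_carrier L'.invariant_carrier
    proof
      show "inj_on F (L.coset ` ?Z)"
      proof (rule inj_onI)
        fix X Y assume "X \<in> L.coset ` ?Z" "Y \<in> L.coset ` ?Z" "F X = F Y"
        then obtain f g where fg: "f \<in> ?Z" "g \<in> ?Z" "X = L.coset f" "Y = L.coset g"
          "L'.coset (p f) = L'.coset (p g)" using F by force
        then show "X = Y" using inj[OF fg(1,2)] by (simp add: L.coset_eq_iff L'.coset_eq_iff)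
      qed
      have "L'.coset h \<in> F ` L.coset ` ?Z" if h: "h \<in> L'.kernel_elements" for h
      proof -
        obtain f where f: "f \<in> ?Z" "p f - h \<in> relations D'" using surj[OF h] by blast
        from f(2) have *: "L'.coset h = F (L.coset f)" unfolding F[OF f(1)] L'.coset_eq_iff by (rule L'.relations.cong_sym)
        show ?thesis unfolding * by (intro imageI f(1))
      qed
      moreover have "F (L.coset f) \<in> L'.coset ` L'.kernel_elements" if "f \<in> ?Z" for f
        unfolding F[OF that] using p[OF that] by (rule imageI)
      ultimately show "F ` L.coset ` ?Z = L'.coset ` L'.kernel_elements" by (intro equalityI) blast+
    qed
  next
    fix X Y assume "X \<in> carrier (reduced_alexander_invariant D)" "Y \<in> carrier (reduced_alexander_invariant D)"
    then obtain f g where fg: "f \<in> ?Z" "g \<in> ?Z" and [simp]: "X = L.coset f" "Y = L.coset g"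
      unfolding L.invariant_carrier by blast
    show "F (X \<oplus>\<^bsub>reduced_alexander_invariant D\<^esub> Y) = F X \<oplus>\<^bsub>reduced_alexander_invariant D'\<^esub> F Y"
      by (simp only: \<open>X = _\<close> \<open>Y = _\<close> L.invariant_add F[OF cl(1)[OF fg]] F[OF fg(1)] F[OF fg(2)]
          L'.invariant_add L'.coset_eq_iff add[OF fg])
  next
    fix r X assume "X \<in> carrier (reduced_alexander_invariant D)"
    then obtain f where f: "f \<in> ?Z" and [simp]: "X = L.coset f"
      unfolding L.invariant_carrier by blast
    show "F (r \<odot>\<^bsub>reduced_alexander_invariant D\<^esub> X) = r \<odot>\<^bsub>reduced_alexander_invariant D'\<^esub> F X"
      by (simp only: \<open>X = _\<close> L.invariant_smult F[OF cl(2)[OF f f]] F[OF f]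
          L'.invariant_smult L'.coset_eq_iff smult[OF f])
  qed
qed

text \<open>The chosen representatives of the images need not depend linearly on the argument; hence
  all identities are congruences.\<close>

lemma representatives_from_module_isomorphic:
  assumes "module_isomorphic (reduced_alexander_invariant D) (reduced_alexander_invariant D')"
  obtains p where "\<And>f. f \<in> L.kernel_elements \<Longrightarrow> p f \<in> L'.kernel_elements"
    "\<And>f g. f \<in> L.kernel_elements \<Longrightarrow> g \<in> L.kernel_elements \<Longrightarrow>
      f - g \<in> relations D \<longleftrightarrow> p f - p g \<in> relations D'"
    "\<And>h. h \<in> L'.kernel_elements \<Longrightarrow> \<exists>f\<in>L.kernel_elements. p f - h \<in> relations D'"
    "\<And>f g. f \<in> L.kernel_elements \<Longrightarrow> g \<in> L.kernel_elements \<Longrightarrow> p (f + g) - (p f + p g) \<in> relations D'"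
    "\<And>r f. f \<in> L.kernel_elements \<Longrightarrow> p (lscale r f) - lscale r (p f) \<in> relations D'"
proof -
  let ?Z = "L.kernel_elements" and ?Z' = "L'.kernel_elements"
  obtain F where bij: "bij_betw F (L.coset ` ?Z) (L'.coset ` ?Z')"
    and add: "\<And>X Y. X \<in> L.coset ` ?Z \<Longrightarrow> Y \<in> L.coset ` ?Z \<Longrightarrow>
      F (X \<oplus>\<^bsub>reduced_alexander_invariant D\<^esub> Y) = F X \<oplus>\<^bsub>reduced_alexander_invariant D'\<^esub> F Y"
    and smult: "\<And>r X. X \<in> L.coset ` ?Z \<Longrightarrow>
      F (r \<odot>\<^bsub>reduced_alexander_invariant D\<^esub> X) = r \<odot>\<^bsub>reduced_alexander_invariant D'\<^esub> F X"
    using assms unfolding module_isomorphic_def L.invariant_carrier L'.invariant_carrier by blast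
  define p where "p f = (SOME h. h \<in> ?Z' \<and> F (L.coset f) = L'.coset h)" for f
  have p: "p f \<in> ?Z'" "F (L.coset f) = L'.coset (p f)" if "f \<in> ?Z" for f
  proof -
    have "F (L.coset f) \<in> L'.coset ` ?Z'" using bij that unfolding bij_betw_def by blast
    then have "\<exists>h. h \<in> ?Z' \<and> F (L.coset f) = L'.coset h" by blast
    from someI_ex[OF this] show "p f \<in> ?Z'" "F (L.coset f) = L'.coset (p f)" unfolding p_def by blast+
  qed
  have cl: "f + g \<in> ?Z" "lscale r f \<in> ?Z" if "f \<in> ?Z" "g \<in> ?Z" for f g r
    using that by (simp_all add: coeff_sum_add coeff_sum_lscale keys_subset)
  show thesis
  proof (rule that[of p])
    show "p f \<in> ?Z'" if "f \<in> ?Z" for f using p(1)[OF that] .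
    show "f - g \<in> relations D \<longleftrightarrow> p f - p g \<in> relations D'" if "f \<in> ?Z" "g \<in> ?Z" for f g
    proof -
      have "L.coset f = L.coset g \<longleftrightarrow> F (L.coset f) = F (L.coset g)"
        using inj_on_eq_iff[OF bij_betw_imp_inj_on[OF bij] imageI[OF that(1)] imageI[OF that(2)]] by (rule HOL.sym)
      then show ?thesis unfolding p(2)[OF that(1)] p(2)[OF that(2)] L.coset_eq_iff L'.coset_eq_iff .
    qed
    show "\<exists>f\<in>?Z. p f - h \<in> relations D'" if "h \<in> ?Z'" for h
    proof -
      have "L'.coset h \<in> F ` L.coset ` ?Z"
        unfolding bij_betw_imp_surj_on[OF bij] by (rule imageI[OF that])
      then obtain f where f: "f \<in> ?Z" "L'.coset h = F (L.coset f)" by (elim imageE) simp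
      have "p f - h \<in> relations D'" using f(2) unfolding p(2)[OF f(1)] L'.coset_eq_iff by (rule L'.relations.cong_sym)
      then show ?thesis using f(1) by (rule rev_bexI[rotated])
    qed
    show "p (f + g) - (p f + p g) \<in> relations D'" if "f \<in> ?Z" "g \<in> ?Z" for f g
      using add[of "L.coset f" "L.coset g"] that
      by (simp only: imageI L.invariant_add p(2)[OF cl(1)[OF that]] p(2)[OF that(1)] p(2)[OF that(2)]
          L'.invariant_add L'.coset_eq_iff HOL.simp_thms)
    show "p (lscale r f) - lscale r (p f) \<in> relations D'" if "f \<in> ?Z" for r f
      using smult[of "L.coset f" r] that
      by (simp only: imageI L.invariant_smult p(2)[OF cl(2)[OF that that]] p(2)[OF that]
          L'.invariant_smult L'.coset_eq_iff HOL.simp_thms)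
  qed
qed

abbreviation "cls \<equiv> mq_class (arcs D) L.mq_relations"
abbreviation "cls' \<equiv> mq_class (arcs D') L'.mq_relations"

lemma MQ_carrier: "carrier (MQ D) = cls ` qterms (arcs D)"
  unfolding L.MQ_eq by (rule carrier_presented_mq)

lemma MQ_op: "s \<in> qterms (arcs D) \<Longrightarrow> u \<in> qterms (arcs D) \<Longrightarrow> cls s \<triangleright>\<^bsub>MQ D\<^esub> cls u = cls (Op s u)"
  unfolding L.MQ_eq by (rule qop_mq_class)

lemma quandle_isomorphic_from_representatives:
  assumes p: "\<And>s. s \<in> qterms (arcs D) \<Longrightarrow> p s \<in> qterms (arcs D')"
    and inj: "\<And>s u. s \<in> qterms (arcs D) \<Longrightarrow> u \<in> qterms (arcs D) \<Longrightarrow>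
      mq_eq (arcs D) L.mq_relations s u \<longleftrightarrow> mq_eq (arcs D') L'.mq_relations (p s) (p u)"
    and surj: "\<And>v. v \<in> qterms (arcs D') \<Longrightarrow> \<exists>s\<in>qterms (arcs D). mq_eq (arcs D') L'.mq_relations (p s) v"
    and op: "\<And>s u. s \<in> qterms (arcs D) \<Longrightarrow> u \<in> qterms (arcs D) \<Longrightarrow>
      mq_eq (arcs D') L'.mq_relations (p (Op s u)) (Op (p s) (p u))"
  shows "quandle_isomorphic (MQ D) (MQ D')"
proof -
  interpret T: two_links D' D ..
  let ?A = "qterms (arcs D)" and ?A' = "qterms (arcs D')"
  define rep where "rep X = (SOME s. s \<in> ?A \<and> cls s = X)" for X
  define F where "F X = cls' (p (rep X))" for X
  have rep: "rep (cls s) \<in> ?A" "cls (rep (cls s)) = cls s" if "s \<in> ?A" for s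
    using someI[of "\<lambda>u. u \<in> ?A \<and> cls u = cls s" s] that unfolding rep_def by blast+
  have F: "F (cls s) = cls' (p s)" if "s \<in> ?A" for s
    unfolding F_def mq_class_eq_iff[OF p[OF rep(1)[OF that]] p[OF that]] inj[OF rep(1)[OF that] that, symmetric]
    using rep(2)[OF that] unfolding mq_class_eq_iff[OF rep(1)[OF that] that] .
  show ?thesis
    unfolding quandle_isomorphic_def
  proof (intro exI[of _ F] conjI ballI)
    show "bij_betw F (carrier (MQ D)) (carrier (MQ D'))"
      unfolding bij_betw_def MQ_carrier T.MQ_carrier
    proof
      show "inj_on F (cls ` ?A)"
      proof (rule inj_onI)
        fix X Y assume "X \<in> cls ` ?A" "Y \<in> cls ` ?A" "F X = F Y"
        then obtain s u where su: "s \<in> ?A" "u \<in> ?A" "X = cls s" "Y = cls u" "cls' (p s) = cls' (p u)"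
          using F by force
        then show "X = Y" using inj[OF su(1,2)] by (simp add: mq_class_eq_iff p)
      qed
      have "cls' v \<in> F ` cls ` ?A" if v: "v \<in> ?A'" for v
      proof -
        obtain s where s: "s \<in> ?A" "mq_eq (arcs D') L'.mq_relations (p s) v" using surj[OF v] by blast
        from s(2) have *: "cls' v = F (cls s)" unfolding F[OF s(1)] by (rule mq_eq_imp_class[OF mq_eq.sym])
        show ?thesis unfolding * by (intro imageI s(1))
      qed
      moreover have "F (cls s) \<in> cls' ` ?A'" if "s \<in> ?A" for s
        unfolding F[OF that] using p[OF that] by (rule imageI)
      ultimately show "F ` cls ` ?A = cls' ` ?A'" by (intro equalityI) blast+
    qed
    fix X Y assume "X \<in> carrier (MQ D)" "Y \<in> carrier (MQ D)"
    then obtain s u where su: "s \<in> ?A" "u \<in> ?A" and XY: "X = cls s" "Y = cls u"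
      unfolding MQ_carrier by blast
    have "Op s u \<in> ?A" using su by (simp add: qterms_iffs)
    then show "F (X \<triangleright>\<^bsub>MQ D\<^esub> Y) = F X \<triangleright>\<^bsub>MQ D'\<^esub> F Y"
      unfolding XY MQ_op[OF su] F[OF su(1)] F[OF su(2)] T.MQ_op[OF p[OF su(1)] p[OF su(2)]]
      using F op[OF su] by (simp add: mq_eq_imp_class)
  qed
qed

text \<open>The linear map is prescribed on an arc by the Alexander value of some term representing
  its image. Induction on terms shows that it computes Alexander values of images in general, and
  applying this to both sides of a crossing relation makes it respect the relators.\<close>

lemma linear_lift:
  assumes g: "\<And>X. X \<in> carrier (MQ D) \<Longrightarrow> g X \<in> carrier (MQ D')"
    and hom: "\<And>X Y. X \<in> carrier (MQ D) \<Longrightarrow> Y \<in> carrier (MQ D) \<Longrightarrow> g (X \<triangleright>\<^bsub>MQ D\<^esub> Y) = g X \<triangleright>\<^bsub>MQ D'\<^esub> g Y"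
  obtains h where "\<And>a. a \<in> arcs D \<Longrightarrow> Poly_Mapping.keys (h a) \<subseteq> arcs D'"
    "\<And>a. a \<in> arcs D \<Longrightarrow> coeff_sum (h a) = 1"
    "\<And>f. f \<in> relations D \<Longrightarrow> linear_extension h f \<in> relations D'"
    "\<And>s s'. s \<in> qterms (arcs D) \<Longrightarrow> s' \<in> qterms (arcs D') \<Longrightarrow> g (cls s) = cls' s' \<Longrightarrow>
      alexander_value s' - linear_extension h (alexander_value s) \<in> relations D'"
proof -
  interpret T: two_links D' D ..
  let ?A = "qterms (arcs D)" and ?A' = "qterms (arcs D')" and ?N' = "relations D'"
  define rep where "rep s = (SOME s'. s' \<in> ?A' \<and> g (cls s) = cls' s')" for s
  have rep: "rep s \<in> ?A'" "g (cls s) = cls' (rep s)" if "s \<in> ?A" for s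
  proof -
    have "\<exists>s'. s' \<in> ?A' \<and> g (cls s) = cls' s'"
      using g[of "cls s"] that unfolding MQ_carrier T.MQ_carrier by blast
    from someI_ex[OF this] show "rep s \<in> ?A'" "g (cls s) = cls' (rep s)" unfolding rep_def by blast+
  qed
  define h where "h a = alexander_value (rep (Gen a))" for a
  let ?G = "linear_extension h"
  have eq: "alexander_value s' - alexander_value (rep s) \<in> ?N'" if "s \<in> ?A" "s' \<in> ?A'" "g (cls s) = cls' s'" for s s'
    by (rule L'.alexander_value_cong) (use that rep[OF that(1)] in \<open>simp add: mq_class_eq_iff[symmetric]\<close>)
  have op: "g (cls (Op s u)) = cls' (Op (rep s) (rep u))" if "s \<in> ?A" "u \<in> ?A" for s u
  proof -
    have "g (cls (Op s u)) = g (cls s) \<triangleright>\<^bsub>MQ D'\<^esub> g (cls u)"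
      using hom[of "cls s" "cls u"] that by (simp add: MQ_op MQ_carrier)
    then show ?thesis using that rep by (simp add: T.MQ_op)
  qed
  have main: "alexander_value (rep s) - ?G (alexander_value s) \<in> ?N'" if "s \<in> ?A" for s
    using that
  proof (induction s)
    case (Gen a)
    then show ?case by (simp add: linear_extension_single h_def lscale_one L'.relations.zero_mem)
  next
    case (Op s u)
    then have su: "s \<in> ?A" "u \<in> ?A" by (simp_all add: qterms_iffs)
    have "alexander_value (Op (rep s) (rep u)) - alexander_value (rep (Op s u)) \<in> ?N'"
      by (rule eq) (use Op.prems op su rep in \<open>simp_all add: qterms_iffs\<close>)
    then have "alexander_value (rep (Op s u)) - alexander_value (Op (rep s) (rep u)) \<in> ?N'"
      by (rule L'.relations.cong_sym)
    moreover have "alexander_value (Op (rep s) (rep u)) - ?G (alexander_value (Op s u)) \<in> ?N'"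
      unfolding alexander_value.simps linear_extension_add linear_extension_lscale
      by (intro L'.relations.cong_add L'.relations.cong_lscale Op.IH su)
    ultimately show ?case by (rule L'.relations.cong_trans)
  next
    case (Inv s u)
    then have su: "s \<in> ?A" "u \<in> ?A" by (simp_all add: qterms_iffs)
    \<comment> \<open>The identity that \<open>Op ?v u\<close> equals \<open>s\<close> is pushed
      through \<open>g\<close>, and the value of \<open>?v\<close> is obtained by solving for it, t
      being invertible.\<close>
    let ?v = "Inv s u"
    have "cls (Op ?v u) = cls s" using su by (intro mq_eq_imp_class mq_eq.Op_Inv)
    then have "g (cls s) = cls' (Op (rep ?v) (rep u))" using op[OF Inv.prems su(2)] by simp
    then have "alexander_value (Op (rep ?v) (rep u)) - alexander_value (rep s) \<in> ?N'"
      by (intro eq) (use su rep Inv.prems in \<open>simp_all add: qterms_iffs\<close>)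
    then have "alexander_value (Op (rep ?v) (rep u)) - ?G (alexander_value s) \<in> ?N'"
      by (rule L'.relations.cong_trans) (rule Inv.IH(1)[OF su(1)])
    then have "lscale (tpow (-1)) (alexander_value (Op (rep ?v) (rep u)) - lscale (1 - tvar) (alexander_value (rep u))) -
       lscale (tpow (-1)) (?G (alexander_value s) - lscale (1 - tvar) (?G (alexander_value u))) \<in> ?N'"
      by (intro L'.relations.cong_lscale L'.relations.cong_diff Inv.IH su)
    moreover have "lscale (tpow (-1)) (alexander_value (Op (rep ?v) (rep u)) - lscale (1 - tvar) (alexander_value (rep u))) = alexander_value (rep ?v)"
      by (simp add: lscale_lscale tvar_inverse lscale_one)
    ultimately show ?case by (simp add: linear_extension_lscale linear_extension_diff)
  qed
  have G: "alexander_value s' - ?G (alexander_value s) \<in> ?N'" if "s \<in> ?A" "s' \<in> ?A'" "g (cls s) = cls' s'" for s s'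
    by (rule L'.relations.cong_trans[OF eq[OF that] main[OF that(1)]])
  have relator: "?G (relator D c) \<in> ?N'" if c: "c \<in> crossings D" for c
  proof -
    let ?s = "Op (Gen (right_arc D c)) (Gen (over_arc D c))" and ?u = "Gen (left_arc D c)"
    have su: "?s \<in> ?A" "?u \<in> ?A"
      using L.over_arc_arcs[OF c] L.right_left_arcs[OF c] by (simp_all add: qterms_iffs)
    have "cls ?s = cls ?u"
      by (intro mq_eq_imp_class mq_eq.rel) (use c L.over_arc_arcs[OF c] L.right_left_arcs[OF c] in auto)
    then have "alexander_value (rep ?u) - ?G (alexander_value ?s) \<in> ?N'"
      by (intro G) (use su rep in simp_all)
    from L'.relations.cong_trans[OF L'.relations.cong_sym[OF this] main[OF su(2)]]
    show ?thesis unfolding L.alexander_value_relator[symmetric] linear_extension_diff .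
  qed
  show thesis
  proof (rule that[of h])
    show "Poly_Mapping.keys (h a) \<subseteq> arcs D'" if "a \<in> arcs D" for a
      unfolding h_def by (intro keys_alexander_value rep) (simp add: qterms_iffs that)
    show "coeff_sum (h a) = 1" for a by (simp add: h_def coeff_sum_alexander_value)
    show "?G f \<in> ?N'" if "f \<in> relations D" for f
    proof -
      obtain r where r: "f = (\<Sum>c\<in>crossings D. lscale (r c) (relator D c))"
        using \<open>f \<in> relations D\<close> by (auto simp: L.relations_iff)
      have "?G (\<Sum>c\<in>X. lscale (r c) (relator D c)) = (\<Sum>c\<in>X. lscale (r c) (?G (relator D c)))" for X
        by (induction X rule: infinite_finite_induct)
          (simp_all add: linear_extension_zero linear_extension_add linear_extension_lscale)
      then show ?thesis unfolding r
        by (simp add: L'.relations.sum_mem L'.relations.lscale_mem relator)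
    qed
  qed (use G in auto)
qed

text \<open>Both sides are linear, so it is enough to test on a single arc, where the claim reduces
  to \<open>g'\<close> undoing \<open>g\<close> on its class.\<close>

lemma lift_inverse:
  assumes g: "\<And>X. X \<in> carrier (MQ D) \<Longrightarrow> g X \<in> carrier (MQ D')" "\<And>X. X \<in> carrier (MQ D) \<Longrightarrow> g' (g X) = X"
    and h: "\<And>s s'. s \<in> qterms (arcs D) \<Longrightarrow> s' \<in> qterms (arcs D') \<Longrightarrow> g (cls s) = cls' s' \<Longrightarrow>
      alexander_value s' - linear_extension h (alexander_value s) \<in> relations D'"
    and k: "\<And>f. f \<in> relations D' \<Longrightarrow> linear_extension k f \<in> relations D"
      "\<And>s s'. s \<in> qterms (arcs D') \<Longrightarrow> s' \<in> qterms (arcs D) \<Longrightarrow> g' (cls' s) = cls s' \<Longrightarrow>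
      alexander_value s' - linear_extension k (alexander_value s) \<in> relations D"
    and keys: "Poly_Mapping.keys f \<subseteq> arcs D"
  shows "linear_extension k (linear_extension h f) - f \<in> relations D"
proof -
  interpret T: two_links D' D ..
  let ?G = "linear_extension h" and ?K = "linear_extension k"
  show ?thesis
    using keys
  proof (rule poly_mapping_additive_induct)
    fix f1 f2 assume "?K (?G f1) - f1 \<in> relations D" "?K (?G f2) - f2 \<in> relations D"
    then show "?K (?G (f1 + f2)) - (f1 + f2) \<in> relations D"
      unfolding linear_extension_add by (rule L.relations.cong_add)
  next
    fix a r assume a: "a \<in> arcs D"
    have A: "Gen a \<in> qterms (arcs D)" using a by (simp add: qterms_iffs)
    then have "g (cls (Gen a)) \<in> cls' ` qterms (arcs D')" using g(1) unfolding MQ_carrier T.MQ_carrier by blast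
    then obtain s where s: "s \<in> qterms (arcs D')" "g (cls (Gen a)) = cls' s" by blast
    have "g' (cls' s) = cls (Gen a)" using g(2)[of "cls (Gen a)"] A s(2) unfolding MQ_carrier by simp
    then have "Poly_Mapping.single a 1 - ?K (alexander_value s) \<in> relations D"
      using k(2)[OF s(1) A] by simp
    moreover have "?K (alexander_value s) - ?K (?G (Poly_Mapping.single a 1)) \<in> relations D"
      using k(1)[OF h[OF A s]] by (simp add: linear_extension_diff)
    ultimately have "lscale r (?K (?G (Poly_Mapping.single a 1))) - lscale r (Poly_Mapping.single a 1) \<in> relations D"
      by (rule L.relations.cong_lscale[OF L.relations.cong_sym[OF L.relations.cong_trans]])
    then show "?K (?G (Poly_Mapping.single a r)) - Poly_Mapping.single a r \<in> relations D"
      unfolding linear_extension_lscale[symmetric] lscale_single by simp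
  qed (simp add: linear_extension_zero L.relations.zero_mem)
qed

lemma keys_linear_extension:
  assumes "\<And>a. a \<in> A \<Longrightarrow> Poly_Mapping.keys (h a) \<subseteq> B" "Poly_Mapping.keys f \<subseteq> A"
  shows "Poly_Mapping.keys (linear_extension h f) \<subseteq> B"
  by (rule poly_mapping_additive_induct[OF assms(2)])
    (simp_all add: linear_extension_zero linear_extension_add linear_extension_single keys_subset assms(1))

lemma coeff_sum_linear_extension:
  assumes "\<And>a. a \<in> A \<Longrightarrow> coeff_sum (h a) = 1" "Poly_Mapping.keys f \<subseteq> A"
  shows "coeff_sum (linear_extension h f) = coeff_sum f"
  by (rule poly_mapping_additive_induct[OF assms(2)])
    (simp_all add: linear_extension_zero linear_extension_add linear_extension_single coeff_sum_add
      coeff_sum_lscale coeff_sum_single coeff_sum_zero assms(1))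

text \<open>The two lifts are inverse to each other modulo relations, and they restrict to the
  kernels because every arc goes to an element of coefficient sum 1.\<close>

lemma module_isomorphic_if_quandle_isomorphic:
  assumes "quandle_isomorphic (MQ D) (MQ D')"
  shows "module_isomorphic (reduced_alexander_invariant D) (reduced_alexander_invariant D')"
proof -
  interpret T: two_links D' D ..
  obtain g where bij: "bij_betw g (carrier (MQ D)) (carrier (MQ D'))"
    and hom: "\<And>X Y. X \<in> carrier (MQ D) \<Longrightarrow> Y \<in> carrier (MQ D) \<Longrightarrow> g (X \<triangleright>\<^bsub>MQ D\<^esub> Y) = g X \<triangleright>\<^bsub>MQ D'\<^esub> g Y"
    using assms unfolding quandle_isomorphic_def by blast
  define g' where "g' = inv_into (carrier (MQ D)) g"
  have g: "g X \<in> carrier (MQ D')" "g' (g X) = X" if "X \<in> carrier (MQ D)" for X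
    using bij that unfolding g'_def by (auto simp: bij_betw_def)
  have g': "g' X \<in> carrier (MQ D)" "g (g' X) = X" if "X \<in> carrier (MQ D')" for X
    using bij that unfolding g'_def by (auto simp: bij_betw_def inv_into_into f_inv_into_f)
  have mq: "medial_quandle (MQ D)" unfolding L.MQ_eq by (rule medial_quandle_presented_mq)
  have hom': "g' (X \<triangleright>\<^bsub>MQ D'\<^esub> Y) = g' X \<triangleright>\<^bsub>MQ D\<^esub> g' Y"
    if "X \<in> carrier (MQ D')" "Y \<in> carrier (MQ D')" for X Y
  proof -
    have "g (g' X \<triangleright>\<^bsub>MQ D\<^esub> g' Y) = X \<triangleright>\<^bsub>MQ D'\<^esub> Y" using that g' hom by simp
    then show ?thesis
      using g(2)[OF medial_quandle.closed[OF mq g'(1)[OF that(1)] g'(1)[OF that(2)]]] by simp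
  qed
  obtain h where h: "\<And>a. a \<in> arcs D \<Longrightarrow> Poly_Mapping.keys (h a) \<subseteq> arcs D'"
    "\<And>a. a \<in> arcs D \<Longrightarrow> coeff_sum (h a) = 1"
    "\<And>f. f \<in> relations D \<Longrightarrow> linear_extension h f \<in> relations D'"
    "\<And>s s'. s \<in> qterms (arcs D) \<Longrightarrow> s' \<in> qterms (arcs D') \<Longrightarrow> g (cls s) = cls' s' \<Longrightarrow>
      alexander_value s' - linear_extension h (alexander_value s) \<in> relations D'"
    using linear_lift[OF g(1) hom] by blast
  obtain k where k: "\<And>a. a \<in> arcs D' \<Longrightarrow> Poly_Mapping.keys (k a) \<subseteq> arcs D"
    "\<And>a. a \<in> arcs D' \<Longrightarrow> coeff_sum (k a) = 1"
    "\<And>f. f \<in> relations D' \<Longrightarrow> linear_extension k f \<in> relations D"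
    "\<And>s s'. s \<in> qterms (arcs D') \<Longrightarrow> s' \<in> qterms (arcs D) \<Longrightarrow> g' (cls' s) = cls s' \<Longrightarrow>
      alexander_value s' - linear_extension k (alexander_value s) \<in> relations D"
    using T.linear_lift[OF g'(1) hom'] by blast
  let ?G = "linear_extension h" and ?K = "linear_extension k"
  have KG: "?K (?G f) - f \<in> relations D" if "Poly_Mapping.keys f \<subseteq> arcs D" for f
    by (rule lift_inverse[OF g h(4) k(3,4) that])
  have GK: "?G (?K f) - f \<in> relations D'" if "Poly_Mapping.keys f \<subseteq> arcs D'" for f
    by (rule T.lift_inverse[OF g' k(4) h(3,4) that])
  show ?thesis
  proof (rule module_isomorphic_from_representatives)
    show "?G f \<in> L'.kernel_elements" if f: "f \<in> L.kernel_elements" for f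
    proof -
      have k: "Poly_Mapping.keys f \<subseteq> arcs D" using f by simp
      have "Poly_Mapping.keys (?G f) \<subseteq> arcs D'" by (rule keys_linear_extension[OF h(1) k])
      moreover have "coeff_sum (?G f) = coeff_sum f" by (rule coeff_sum_linear_extension[OF h(2) k])
      ultimately show ?thesis using f by simp
    qed
    show "f1 - f2 \<in> relations D \<longleftrightarrow> ?G f1 - ?G f2 \<in> relations D'"
      if f: "f1 \<in> L.kernel_elements" "f2 \<in> L.kernel_elements" for f1 f2
    proof
      assume "f1 - f2 \<in> relations D"
      then show "?G f1 - ?G f2 \<in> relations D'" unfolding linear_extension_diff[symmetric] by (rule h(3))
    next
      assume "?G f1 - ?G f2 \<in> relations D'"
      then have *: "?K (?G f1) - ?K (?G f2) \<in> relations D" unfolding linear_extension_diff[symmetric] by (rule k(3))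
      have 1: "f1 - ?K (?G f1) \<in> relations D" by (rule L.relations.cong_sym[OF KG]) (use f in simp)
      have 2: "?K (?G f2) - f2 \<in> relations D" by (rule KG) (use f in simp)
      show "f1 - f2 \<in> relations D" by (rule L.relations.cong_trans[OF 1 L.relations.cong_trans[OF * 2]])
    qed
    show "\<exists>f\<in>L.kernel_elements. ?G f - f' \<in> relations D'" if f': "f' \<in> L'.kernel_elements" for f'
    proof -
      have ks: "Poly_Mapping.keys f' \<subseteq> arcs D'" using f' by simp
      have "Poly_Mapping.keys (?K f') \<subseteq> arcs D" by (rule keys_linear_extension[OF k(1) ks])
      moreover have "coeff_sum (?K f') = coeff_sum f'" by (rule coeff_sum_linear_extension[OF k(2) ks])
      ultimately have "?K f' \<in> L.kernel_elements" using f' by simp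
      then show ?thesis using GK[OF ks] by (rule rev_bexI)
    qed
  qed (simp_all add: linear_extension_add linear_extension_lscale L'.relations.zero_mem)
qed

end

section \<open>Displacements of medial quandles\<close>

definition commutant :: "('a \<Rightarrow> 'a) set \<Rightarrow> ('a \<Rightarrow> 'a) set" where
  "commutant S = {f. bij f \<and> (\<forall>g\<in>S. f \<circ> g = g \<circ> f)}"

lemma commutant_closed:
  "id \<in> commutant S"
  "f \<in> commutant S \<Longrightarrow> g \<in> commutant S \<Longrightarrow> f \<circ> g \<in> commutant S"
  "f \<in> commutant S \<Longrightarrow> inv_into UNIV f \<in> commutant S"
proof -
  show "id \<in> commutant S" by (simp add: commutant_def)
  show "f \<in> commutant S \<Longrightarrow> g \<in> commutant S \<Longrightarrow> f \<circ> g \<in> commutant S"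
    by (simp add: commutant_def bij_comp o_assoc) (metis o_assoc)
  assume f: "f \<in> commutant S"
  then have bf: "bij f" by (simp add: commutant_def)
  have "inv_into UNIV f \<circ> g = g \<circ> inv_into UNIV f" if "g \<in> S" for g
  proof -
    have "f (g x) = g (f x)" for x using f that unfolding commutant_def by (auto simp: fun_eq_iff)
    then have "inv_into UNIV f (g (f (inv_into UNIV f x))) = inv_into UNIV f (f (g (inv_into UNIV f x)))" for x by simp
    then show ?thesis using bf by (simp add: fun_eq_iff bij_is_surj surj_f_inv_f bij_is_inj inv_f_f)
  qed
  then show "inv_into UNIV f \<in> commutant S" using bf by (simp add: commutant_def bij_imp_bij_inv)
qed

text \<open>The double commutant stands in for the subgroup generated by S: it is closed under
  composition and inverses by construction, and no words in the generators are needed.\<close>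

definition perm_group :: "('a \<Rightarrow> 'a) set \<Rightarrow> ('a \<Rightarrow> 'a) monoid" where
  "perm_group S = \<lparr>carrier = commutant (commutant S), mult = (\<circ>), one = id\<rparr>"

text \<open>If S commutes with itself, it lies in its commutant; hence the double commutant is
  contained in the commutant, with which it commutes.\<close>

lemma bicommutant:
  assumes "\<And>f. f \<in> S \<Longrightarrow> bij f" "\<And>f g. f \<in> S \<Longrightarrow> g \<in> S \<Longrightarrow> f \<circ> g = g \<circ> f"
  shows "S \<subseteq> commutant (commutant S)"
    and "f \<in> commutant (commutant S) \<Longrightarrow> g \<in> commutant (commutant S) \<Longrightarrow> f \<circ> g = g \<circ> f"
proof -
  have "S \<subseteq> commutant S" using assms by (auto simp: commutant_def)
  then have "commutant (commutant S) \<subseteq> commutant S" by (auto simp: commutant_def)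
  then show "f \<in> commutant (commutant S) \<Longrightarrow> g \<in> commutant (commutant S) \<Longrightarrow> f \<circ> g = g \<circ> f"
    unfolding commutant_def[of "commutant S"] by blast
  show "S \<subseteq> commutant (commutant S)"
  proof
    fix f assume f: "f \<in> S"
    then have "f \<circ> g = g \<circ> f" if "g \<in> commutant S" for g
      using that unfolding commutant_def by (metis (mono_tags, lifting) mem_Collect_eq)
    then show "f \<in> commutant (commutant S)" using assms(1)[OF f] by (simp add: commutant_def[of "commutant S"])
  qed
qed

lemma comm_group_perm_group:
  assumes "\<And>f. f \<in> S \<Longrightarrow> bij f" "\<And>f g. f \<in> S \<Longrightarrow> g \<in> S \<Longrightarrow> f \<circ> g = g \<circ> f"
  shows "comm_group (perm_group S)"
proof (rule comm_groupI)
  fix f assume f: "f \<in> carrier (perm_group S)"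
  then have "bij f" by (simp add: perm_group_def commutant_def)
  then show "\<exists>g\<in>carrier (perm_group S). g \<otimes>\<^bsub>perm_group S\<^esub> f = \<one>\<^bsub>perm_group S\<^esub>"
    using f commutant_closed(3)[of f "commutant S"]
    by (intro bexI[of _ "inv_into UNIV f"]) (auto simp: perm_group_def bij_is_inj)
next
  fix f g assume "f \<in> carrier (perm_group S)" "g \<in> carrier (perm_group S)"
  then show "f \<otimes>\<^bsub>perm_group S\<^esub> g = g \<otimes>\<^bsub>perm_group S\<^esub> f"
    using bicommutant(2)[OF assms] by (simp add: perm_group_def)
qed (auto simp: perm_group_def commutant_closed o_assoc)

text \<open>The module structure is forgotten: the pair (a, n) stands for the monomial t^n a, so the
  free Laurent module becomes a free abelian group.\<close>

definition flatten :: "('a \<Rightarrow>\<^sub>0 laurent) \<Rightarrow> ('a \<times> int) \<Rightarrow>\<^sub>0 int" where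
  "flatten f = Abs_poly_mapping (\<lambda>(a, n). Poly_Mapping.lookup (Poly_Mapping.lookup f a) n)"

lemma lookup_flatten: "Poly_Mapping.lookup (flatten f) (a, n) = Poly_Mapping.lookup (Poly_Mapping.lookup f a) n"
proof -
  let ?S = "{x. (case x of (a, n) \<Rightarrow> Poly_Mapping.lookup (Poly_Mapping.lookup f a) n) \<noteq> 0}"
  have "?S \<subseteq> (SIGMA a:Poly_Mapping.keys f. Poly_Mapping.keys (Poly_Mapping.lookup f a))"
    by (auto simp: in_keys_iff)
  then have "finite ?S" by (rule finite_subset) simp
  then show ?thesis unfolding flatten_def by simp
qed

lemma flatten_add: "flatten (f + g) = flatten f + flatten g"
  by (rule poly_mapping_eqI) (auto simp: lookup_flatten lookup_add)

lemma flatten_tpow: "flatten (Poly_Mapping.single a (tpow n)) = frag_of (a, n)"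
  by (rule poly_mapping_eqI) (auto simp: lookup_flatten lookup_single when_def split: if_splits)

text \<open>By \<open>flatten\<close> the images of the monomials can be prescribed freely. The
  target is only an abelian group; its action of t is brought in later through the choice of these
  images.\<close>

lemma free_module_hom:
  assumes G: "comm_group G" and x: "\<And>a n. x a n \<in> carrier G"
  shows "\<exists>H :: ('a \<Rightarrow>\<^sub>0 laurent) \<Rightarrow> 'g. (\<forall>f. H f \<in> carrier G) \<and>
    (\<forall>f g. H (f + g) = H f \<otimes>\<^bsub>G\<^esub> H g) \<and> (\<forall>a n. H (Poly_Mapping.single a (tpow n)) = x a n)"
proof -
  have "(\<lambda>(a, n). x a n) ` UNIV \<subseteq> carrier G" using x by auto
  then obtain h where h: "h \<in> hom (free_Abelian_group UNIV) G" "\<And>y. y \<in> UNIV \<Longrightarrow> h (frag_of y) = (\<lambda>(a, n). x a n) y"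
    using comm_group.free_Abelian_group_universal[OF G] by blast
  have mem: "f \<in> carrier (free_Abelian_group UNIV)" for f :: "('a \<times> int) \<Rightarrow>\<^sub>0 int" by simp
  show ?thesis
  proof (intro exI[of _ "\<lambda>f. h (flatten f)"] conjI allI)
    show "h (flatten f) \<in> carrier G" for f by (rule hom_in_carrier[OF h(1) mem])
    show "h (flatten (f + g)) = h (flatten f) \<otimes>\<^bsub>G\<^esub> h (flatten g)" for f g
      using hom_mult[OF h(1) mem mem, of "flatten f" "flatten g"] by (simp add: flatten_add)
    show "h (flatten (Poly_Mapping.single a (tpow n))) = x a n" for a n
      using h(2)[of "(a, n)"] by (simp add: flatten_tpow)
  qed
qed

section \<open>Translations and displacements of a medial quandle\<close>

context medial_quandle
begin

text \<open>The identity outside the carrier makes this a bijection of the whole type, so that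
  compositions and inverses carry no side conditions.\<close>

definition translation :: "'a \<Rightarrow> 'a \<Rightarrow> 'a" where
  "translation y x = (if x \<in> carrier Q then x \<triangleright> y else x)"

definition displacement :: "'a \<Rightarrow> 'a \<Rightarrow> 'a \<Rightarrow> 'a" where
  "displacement x y = translation x \<circ> inv_into UNIV (translation y)"

lemma bij_translation:
  assumes "y \<in> carrier Q"
  shows "bij (translation y)"
proof -
  have "bij_betw (translation y) (carrier Q) (carrier Q)"
    using bij[OF assms] by (rule bij_betw_cong[THEN iffD1, rotated]) (simp add: translation_def)
  moreover have "bij_betw (translation y) (- carrier Q) (- carrier Q)"
    by (rule bij_betw_cong[THEN iffD1, OF _ bij_betw_id]) (simp add: translation_def)
  ultimately have "bij_betw (translation y) (carrier Q \<union> - carrier Q) (carrier Q \<union> - carrier Q)"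
    by (rule bij_betw_combine) auto
  then show ?thesis by simp
qed

lemma translation_inv:
  assumes "y \<in> carrier Q"
  shows "translation y (inv_into UNIV (translation y) x) = x" "inv_into UNIV (translation y) (translation y x) = x"
  using bij_translation[OF assms] by (simp_all add: bij_is_surj surj_f_inv_f bij_is_inj inv_f_f)

lemma translation_translation:
  assumes "y \<in> carrier Q" "z \<in> carrier Q"
  shows "translation (y \<triangleright> z) x = translation z (translation y (inv_into UNIV (translation z) x))"
proof -
  have "translation z (translation y w) = translation (y \<triangleright> z) (translation z w)" for w
    using distrib[of w y z] assms by (cases "w \<in> carrier Q") (simp_all add: translation_def closed)
  from this[of "inv_into UNIV (translation z) x"] show ?thesis by (simp add: translation_inv assms)
qed

text \<open>The medial law compares translations by y and x, each acted on by z. Such a translation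
  is a conjugate by the translation of z, and cancelling the latter leaves this exchange
  rule.\<close>

lemma translation_medial:
  assumes "x \<in> carrier Q" "y \<in> carrier Q" "z \<in> carrier Q"
  shows "translation y (inv_into UNIV (translation z) (translation x w)) = translation x (inv_into UNIV (translation z) (translation y w))"
proof -
  have "translation (y \<triangleright> z) (translation x w) = translation (x \<triangleright> z) (translation y w)"
    using medial[of w x y z] assms by (cases "w \<in> carrier Q") (simp_all add: translation_def closed)
  then have "inv_into UNIV (translation z) (translation z (translation y (inv_into UNIV (translation z) (translation x w)))) =
    inv_into UNIV (translation z) (translation z (translation x (inv_into UNIV (translation z) (translation y w))))"
    using assms by (simp only: translation_translation)
  then show ?thesis using assms by (simp only: translation_inv)
qed

lemma translation_medial_inv:
  assumes "x \<in> carrier Q" "y \<in> carrier Q" "z \<in> carrier Q"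
  shows "inv_into UNIV (translation x) (translation z (inv_into UNIV (translation y) w)) = inv_into UNIV (translation y) (translation z (inv_into UNIV (translation x) w))"
proof -
  define u where "u = inv_into UNIV (translation y) (translation z (inv_into UNIV (translation x) w))"
  have "translation x (inv_into UNIV (translation z) (translation y u)) = w"
    using assms by (simp add: u_def translation_inv)
  then have "w = translation y (inv_into UNIV (translation z) (translation x u))"
    using translation_medial[OF assms] by simp
  then have "inv_into UNIV (translation x) (translation z (inv_into UNIV (translation y) w)) = u"
    using assms by (simp add: translation_inv)
  then show ?thesis by (simp add: u_def)
qed

text \<open>The exchange rule for inverses swaps the two inverse translations, the rule
  \<open>translation_medial\<close> then swaps the two direct ones.\<close>

lemma displacement_commute:
  assumes "x \<in> carrier Q" "y \<in> carrier Q" "u \<in> carrier Q" "v \<in> carrier Q"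
  shows "displacement x y \<circ> displacement u v = displacement u v \<circ> displacement x y"
proof
  fix w
  have "(displacement x y \<circ> displacement u v) w = translation x (inv_into UNIV (translation v) (translation u (inv_into UNIV (translation y) w)))"
    using translation_medial_inv[of y v u w] assms by (simp add: displacement_def)
  also have "\<dots> = (displacement u v \<circ> displacement x y) w"
    using translation_medial[of u x v] assms by (simp add: displacement_def)
  finally show "(displacement x y \<circ> displacement u v) w = (displacement u v \<circ> displacement x y) w" .
qed

lemma bij_displacement: "x \<in> carrier Q \<Longrightarrow> y \<in> carrier Q \<Longrightarrow> bij (displacement x y)"
  unfolding displacement_def by (intro bij_comp bij_translation bij_imp_bij_inv)

abbreviation displacements :: "('a \<Rightarrow> 'a) set" where
  "displacements \<equiv> {displacement x y | x y. x \<in> carrier Q \<and> y \<in> carrier Q}"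

lemma comm_group_displacements: "comm_group (perm_group displacements)"
  by (rule comm_group_perm_group) (use bij_displacement displacement_commute in blast)+

lemma displacement_mem: "x \<in> carrier Q \<Longrightarrow> y \<in> carrier Q \<Longrightarrow> displacement x y \<in> carrier (perm_group displacements)"
proof -
  have "displacements \<subseteq> commutant (commutant displacements)"
    by (rule bicommutant(1)) (use bij_displacement displacement_commute in blast)+
  then show "x \<in> carrier Q \<Longrightarrow> y \<in> carrier Q \<Longrightarrow> ?thesis" unfolding perm_group_def by auto
qed

lemma bij_mem: "f \<in> carrier (perm_group S) \<Longrightarrow> bij f"
  by (simp add: perm_group_def commutant_def)

text \<open>A bijection normalizing S normalizes its commutant and therefore also the double
  commutant.\<close>

lemma conj_mem_aux:
  assumes "bij b" "\<And>s. s \<in> S \<Longrightarrow> inv_into UNIV b \<circ> s \<circ> b \<in> S" "\<And>s. s \<in> S \<Longrightarrow> b \<circ> s \<circ> inv_into UNIV b \<in> S"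
    and f: "f \<in> commutant (commutant S)"
  shows "b \<circ> f \<circ> inv_into UNIV b \<in> commutant (commutant S)"
proof -
  have bb: "b \<circ> inv_into UNIV b = id" "inv_into UNIV b \<circ> b = id"
    using assms(1) by (simp_all add: fun_eq_iff bij_is_surj surj_f_inv_f bij_is_inj inv_f_f)
  have bf: "bij f" using f by (simp add: commutant_def)
  have "b \<circ> f \<circ> inv_into UNIV b \<circ> g = g \<circ> (b \<circ> f \<circ> inv_into UNIV b)" if g: "g \<in> commutant S" for g
  proof -
    have "inv_into UNIV b \<circ> g \<circ> b \<in> commutant S"
    proof -
      have "bij (inv_into UNIV b \<circ> g \<circ> b)" using g assms(1) by (auto simp: commutant_def intro!: bij_comp bij_imp_bij_inv)
      moreover have "(inv_into UNIV b \<circ> g \<circ> b) \<circ> s = s \<circ> (inv_into UNIV b \<circ> g \<circ> b)" if s: "s \<in> S" for s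
      proof -
        have c: "g \<circ> (b \<circ> s \<circ> inv_into UNIV b) = (b \<circ> s \<circ> inv_into UNIV b) \<circ> g"
          using g assms(3)[OF s] unfolding commutant_def by blast
        have "(inv_into UNIV b \<circ> g \<circ> b) \<circ> s = inv_into UNIV b \<circ> (g \<circ> (b \<circ> s \<circ> inv_into UNIV b)) \<circ> b"
          by (simp add: o_assoc[symmetric] bb)
        also have "\<dots> = (inv_into UNIV b \<circ> b) \<circ> s \<circ> (inv_into UNIV b \<circ> g \<circ> b)" unfolding c by (simp add: o_assoc[symmetric])
        finally show ?thesis by (simp add: bb)
      qed
      ultimately show ?thesis by (simp add: commutant_def)
    qed
    then have c: "f \<circ> (inv_into UNIV b \<circ> g \<circ> b) = (inv_into UNIV b \<circ> g \<circ> b) \<circ> f"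
      using f unfolding commutant_def[of "commutant S"] by blast
    have "b \<circ> f \<circ> inv_into UNIV b \<circ> g = b \<circ> (f \<circ> (inv_into UNIV b \<circ> g \<circ> b)) \<circ> inv_into UNIV b"
      by (simp add: o_assoc[symmetric] bb)
    also have "\<dots> = (b \<circ> inv_into UNIV b) \<circ> g \<circ> (b \<circ> f \<circ> inv_into UNIV b)" unfolding c by (simp add: o_assoc[symmetric])
    finally show ?thesis by (simp add: bb)
  qed
  moreover have "bij (b \<circ> f \<circ> inv_into UNIV b)" using bf assms(1) by (intro bij_comp bij_imp_bij_inv)
  ultimately show ?thesis by (simp add: commutant_def[of "commutant S"])
qed

text \<open>Since \<open>translation z\<close> is an automorphism of the quandle, conjugating by it
  applies it to both arguments of a displacement.\<close>

lemma
  assumes z: "z \<in> carrier Q" and s: "s \<in> displacements"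
  shows conj_displacement: "translation z \<circ> s \<circ> inv_into UNIV (translation z) \<in> displacements"
    and conj_displacement_inv: "inv_into UNIV (translation z) \<circ> s \<circ> translation z \<in> displacements"
proof -
  obtain x y where xy: "x \<in> carrier Q" "y \<in> carrier Q" "s = displacement x y" using s by blast
  have conj: "translation z \<circ> displacement x y \<circ> inv_into UNIV (translation z) = displacement (x \<triangleright> z) (y \<triangleright> z)"
    if "x \<in> carrier Q" "y \<in> carrier Q" for x y
  proof -
    have "inv_into UNIV (translation (y \<triangleright> z)) w = translation z (inv_into UNIV (translation y) (inv_into UNIV (translation z) w))" for w
    proof -
      have "translation (y \<triangleright> z) (translation z (inv_into UNIV (translation y) (inv_into UNIV (translation z) w))) = w"
        using that z by (simp add: translation_translation translation_inv)
      then show ?thesis using translation_inv(2)[OF closed[OF that(2) z]] by metis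
    qed
    then show ?thesis
      using that z by (simp add: fun_eq_iff displacement_def translation_translation translation_inv)
  qed
  then show "translation z \<circ> s \<circ> inv_into UNIV (translation z) \<in> displacements"
    using xy z closed by blast
  obtain x' y' where x': "x' \<in> carrier Q" "x = x' \<triangleright> z" and y': "y' \<in> carrier Q" "y = y' \<triangleright> z"
    using bij[OF z] xy unfolding bij_betw_def by blast
  have "inv_into UNIV (translation z) \<circ> s \<circ> translation z = displacement x' y'"
    unfolding xy(3) x'(2) y'(2) conj[OF x'(1) y'(1), symmetric]
    using z by (simp add: fun_eq_iff translation_inv)
  then show "inv_into UNIV (translation z) \<circ> s \<circ> translation z \<in> displacements" using x' y' by blast
qed

text \<open>Multiplication by t has to act as conjugation by \<open>translation z\<close>. So t^n b
  is sent to the n-fold conjugate of its displacement, and the resulting additive map satisfies the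
  rule for t on monomials, hence everywhere.\<close>

lemma displacement_action:
  fixes q :: "'b \<Rightarrow> 'a"
  assumes z: "z \<in> carrier Q" and q: "\<And>b. b \<in> B \<Longrightarrow> q b \<in> carrier Q"
  obtains H :: "('b \<Rightarrow>\<^sub>0 laurent) \<Rightarrow> 'a \<Rightarrow> 'a" where
    "additive_action H"
    "\<And>b. b \<in> B \<Longrightarrow> H (Poly_Mapping.single b 1) = displacement (q b) z"
    "\<And>f. H (lscale tvar f) = translation z \<circ> H f \<circ> inv_into UNIV (translation z)"
proof -
  let ?G = "perm_group displacements" and ?b = "translation z"
  define conj where "conj f = ?b \<circ> f \<circ> inv_into UNIV ?b" for f :: "'a \<Rightarrow> 'a"
  define conj' where "conj' f = inv_into UNIV ?b \<circ> f \<circ> ?b" for f :: "'a \<Rightarrow> 'a"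
  have b: "bij ?b" by (rule bij_translation[OF z])
  have conj: "conj f \<in> carrier ?G" if "f \<in> carrier ?G" for f
    using conj_mem_aux[OF b conj_displacement_inv[OF z] conj_displacement[OF z], of f] that
    by (simp add: conj_def perm_group_def)
  have conj': "conj' f \<in> carrier ?G" if "f \<in> carrier ?G" for f
    using conj_mem_aux[OF bij_imp_bij_inv[OF b], of displacements f]
      conj_displacement_inv[OF z] conj_displacement[OF z] that
    by (simp add: conj'_def perm_group_def inv_inv_eq[OF b])
  have cc: "conj (conj' f) = f" for f
    using z by (simp add: conj_def conj'_def fun_eq_iff translation_inv)
  \<comment> \<open>Negative powers use the inverse conjugation; basis elements outside
    \<open>B\<close> get the identity as a harmless value.\<close>
  define x where "x a n = (if a \<in> B then (if n \<ge> 0 then (conj ^^ nat n) (displacement (q a) z)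
      else (conj' ^^ nat (- n)) (displacement (q a) z)) else id)" for a and n :: int
  have pow: "(conj ^^ k) f \<in> carrier ?G" "(conj' ^^ k) f \<in> carrier ?G" if "f \<in> carrier ?G" for k f
    using that by (induction k) (auto intro: conj conj')
  have x: "x a n \<in> carrier ?G" for a n
    unfolding x_def using pow[OF displacement_mem[OF q z]] commutant_closed(1) by (auto simp: perm_group_def)
  have step: "x a (n + 1) = conj (x a n)" for a n
  proof -
    have "conj id = id" using z by (simp add: conj_def fun_eq_iff translation_inv)
    moreover have "nat (n + 1) = Suc (nat n)" if "n \<ge> 0" using that by simp
    moreover have "nat (- n) = Suc (nat (- (n + 1)))" if "n < 0" using that by simp
    ultimately show ?thesis
      by (cases "n \<ge> 0"; cases "n = -1") (auto simp: x_def cc)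
  qed
  obtain H :: "('b \<Rightarrow>\<^sub>0 laurent) \<Rightarrow> 'a \<Rightarrow> 'a" where H': "(\<forall>f. H f \<in> carrier ?G) \<and>
    (\<forall>f g. H (f + g) = H f \<otimes>\<^bsub>?G\<^esub> H g) \<and> (\<forall>a n. H (Poly_Mapping.single a (tpow n)) = x a n)"
    using free_module_hom[OF comm_group_displacements, where x = x, OF x] by (rule exE)
  have H: "H f \<in> carrier ?G" "H (f + g) = H f \<otimes>\<^bsub>?G\<^esub> H g" "H (Poly_Mapping.single a (tpow n)) = x a n" for f g a n
    using H' by simp_all
  have add: "H (f + g) = H f \<circ> H g" for f g using H(2) by (simp add: perm_group_def)
  have bij: "bij (H f)" for f by (rule bij_mem[OF H(1)])
  have zero: "H 0 = id"
  proof
    fix w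
    have "H 0 (H 0 w) = H 0 w" using fun_cong[OF add[of 0 0], of w] by simp
    then show "H 0 w = id w" using bij[of 0] by (simp add: bij_is_inj inj_eq)
  qed
  have act: "additive_action H" by unfold_locales (simp_all add: zero add)
  have neg: "H (lscale tvar (- f)) = conj (H (- f))" if f: "H (lscale tvar f) = conj (H f)" for f
  proof
    fix w
    have 1: "H (- f) (H f v) = v" for v using fun_cong[OF add[of "- f" f], of v] by (simp add: zero)
    have 2: "H (lscale tvar (- f)) (H (lscale tvar f) v) = v" for v
      using fun_cong[OF add[of "lscale tvar (- f)" "lscale tvar f"], of v] by (simp add: zero lscale_minus_right)
    obtain v where v: "w = conj (H f) v"
      using surjD[OF bij_is_surj[OF bij[of "lscale tvar f"]], of w] unfolding f by blast
    have "conj (H (- f)) w = v" using z by (simp add: v conj_def translation_inv 1)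
    moreover have "H (lscale tvar (- f)) w = v" using 2[of v] by (simp add: v f)
    ultimately show "H (lscale tvar (- f)) w = conj (H (- f)) w" by simp
  qed
  have mono: "H (lscale tvar (Poly_Mapping.single a (tpow n))) = conj (H (Poly_Mapping.single a (tpow n)))" for a n
    unfolding lscale_single H(3) step[symmetric] tvar_def by (simp add: mult_single H(3) add.commute)
  have shift: "H (lscale tvar f) = conj (H f)" for f
  proof (rule laurent_module_induct[of f UNIV])
    show "H (lscale tvar 0) = conj (H 0)"
      using z by (simp add: lscale_simps zero conj_def fun_eq_iff translation_inv)
    show "H (lscale tvar (f + g)) = conj (H (f + g))" if "H (lscale tvar f) = conj (H f)" "H (lscale tvar g) = conj (H g)" for f g
      using that z by (simp add: lscale_simps add conj_def fun_eq_iff translation_inv)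
  qed (use mono neg[OF mono] in auto)
  have gen: "H (Poly_Mapping.single b 1) = displacement (q b) z" if "b \<in> B" for b
    using H(3)[of b 0] that by (simp add: x_def)
  show thesis
    by (rule that[OF act gen]) (simp_all only: shift conj_def)
qed

end

section \<open>Longitudes\<close>

lemma lscale_commute: "lscale r (lscale s f) = lscale s (lscale r f)"
  by (simp add: lscale_lscale mult.commute)

context link
begin

definition crossing_sign :: "complex \<Rightarrow> laurent" where
  "crossing_sign c = (if under_right_to_left D c then 1 else -1)"

abbreviation "in_arc c \<equiv> arc_into D (under_point D c)"
abbreviation "out_arc c \<equiv> arc_out_of D (under_point D c)"
abbreviation "gen a \<equiv> (Poly_Mapping.single a 1 :: arc \<Rightarrow>\<^sub>0 laurent)"

text \<open>The displacement that carries the incoming underpassing arc to the outgoing one; at a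
  negative crossing the incoming arc is on the left and the inverse displacement is taken.\<close>

definition crossing_step :: "complex \<Rightarrow> arc \<Rightarrow>\<^sub>0 laurent" where
  "crossing_step c = lscale (crossing_sign c) (gen (over_arc D c) - gen (right_arc D c))"

text \<open>The total displacement met on one trip around component i, the module version of the
  longitude of the component.\<close>

definition longitude :: "nat \<Rightarrow> arc \<Rightarrow>\<^sub>0 laurent" where
  "longitude i = (\<Sum>c\<in>under_crossings i. crossing_step c)"

text \<open>Kept as an identity in the free module: the exact relator coefficients are needed later,
  when a factor 1 - t is cancelled.\<close>

lemma crossing_step_relator:
  "lscale (1 - tvar) (crossing_step c) = lscale (crossing_sign c) (relator D c) + (gen (out_arc c) - gen (in_arc c))"
proof -
  have "lscale (1 - tvar) (gen (over_arc D c) - gen (right_arc D c)) = relator D c + gen (left_arc D c) - gen (right_arc D c)"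
    by (simp add: relator_def lscale_simps lscale_single single_diff algebra_simps)
  then have "lscale (1 - tvar) (crossing_step c) = lscale (crossing_sign c) (relator D c + gen (left_arc D c) - gen (right_arc D c))"
    unfolding crossing_step_def by (subst lscale_commute) (rule arg_cong)
  also have "\<dots> = lscale (crossing_sign c) (relator D c) + (gen (out_arc c) - gen (in_arc c))"
    by (simp add: crossing_sign_def right_arc_def left_arc_def lscale_simps)
  finally show ?thesis .
qed

lemma arc_exists:
  assumes "i < ncomp D"
  obtains a where "a \<in> arcs D" "fst a = i"
  using arc_out_of(1,2)[OF assms, of 1] by auto

lemma additive_action_plus: "additive_action ((+) :: 'g::ab_group_add \<Rightarrow> 'g \<Rightarrow> 'g)"
  by unfold_locales (simp_all add: add.assoc)

text \<open>The differences of outgoing and incoming arcs telescope around the component, so only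
  the relators remain.\<close>

lemma longitude_relation:
  assumes i: "i < ncomp D"
  shows "lscale (1 - tvar) (longitude i) = (\<Sum>c\<in>under_crossings i. lscale (crossing_sign c) (relator D c))"
proof -
  obtain a where a: "a \<in> arcs D" "fst a = i" by (rule arc_exists[OF i])
  have "gen a = (\<Sum>c\<in>under_crossings i. gen (out_arc c) - gen (in_arc c)) + gen a"
    by (rule component_transport(1)[OF additive_action_plus i _ a]) simp
  then show ?thesis
    unfolding longitude_def lscale_sum_right crossing_step_relator sum.distrib by simp
qed

lemma sum_components: "(\<Sum>i<ncomp D. \<Sum>c\<in>under_crossings i. h c) = (\<Sum>c\<in>crossings D. h c)"
  for h :: "complex \<Rightarrow> 'b::comm_monoid_add"
  using sum.group[OF finite_crossings finite_lessThan, of "\<lambda>c. fst (under_point D c)" "ncomp D" h]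
    under_component by auto

text \<open>The planarity of the diagram enters through the dependence between the relators.\<close>

lemma sum_longitudes: "(\<Sum>i<ncomp D. longitude i) \<in> relations D"
proof -
  obtain m where m: "(\<Sum>c\<in>crossings D.
     lscale ((if under_right_to_left D c then -1 else 1) * tpow (m c)) (relator D c)) = 0"
    using relator_dependence by blast
  have "(\<Sum>c\<in>crossings D. lscale (crossing_sign c * tpow (m c)) (relator D c)) = 0"
  proof -
    have "lscale (crossing_sign c * tpow (m c)) (relator D c) =
      - lscale ((if under_right_to_left D c then -1 else 1) * tpow (m c)) (relator D c)" for c
      by (simp add: crossing_sign_def lscale_minus_left)
    then show ?thesis using m by (simp add: sum_negf)
  qed
  \<comment> \<open>Replacing each power of t by 1 plus a multiple of 1 - t turns the dependence
    into: the signed sum of relators is 1 - t times a relation. That signed sum is also 1 - t times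
    the sum of the longitudes, and 1 - t cancels.\<close>
  moreover have "\<exists>w. \<forall>c. tpow (m c) = 1 + (1 - tvar) * w c" by (intro choice allI tpow_divide)
  then obtain w where w: "tpow (m c) = 1 + (1 - tvar) * w c" for c by blast
  ultimately have "(\<Sum>c\<in>crossings D. lscale (crossing_sign c) (relator D c)) +
      lscale (1 - tvar) (\<Sum>c\<in>crossings D. lscale (crossing_sign c * w c) (relator D c)) = 0"
    by (simp add: lscale_sum_right lscale_lscale sum.distrib[symmetric] lscale_add_left[symmetric] algebra_simps)
  moreover have "lscale (1 - tvar) (\<Sum>i<ncomp D. longitude i) = (\<Sum>c\<in>crossings D. lscale (crossing_sign c) (relator D c))"
    by (simp add: lscale_sum_right longitude_relation sum_components)
  ultimately have "lscale (1 - tvar) (\<Sum>i<ncomp D. longitude i) =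
      lscale (1 - tvar) (- (\<Sum>c\<in>crossings D. lscale (crossing_sign c * w c) (relator D c)))"
    by (simp add: lscale_minus_right eq_neg_iff_add_eq_0)
  then have "(\<Sum>i<ncomp D. longitude i) = - (\<Sum>c\<in>crossings D. lscale (crossing_sign c * w c) (relator D c))"
    unfolding lscale_one_minus_tvar_cancel .
  then show ?thesis
    by (simp only:) (intro relations.minus_mem relations.sum_mem relations.lscale_mem relator_mem)
qed

lemma out_arc_inject: "c \<in> crossings D \<Longrightarrow> c' \<in> crossings D \<Longrightarrow> out_arc c = out_arc c' \<longleftrightarrow> c = c'"
  using arc_out_of_inject[OF under_point(3) under_point(3)] under_point(2) by metis

lemma in_arc_inject: "c \<in> crossings D \<Longrightarrow> c' \<in> crossings D \<Longrightarrow> in_arc c = in_arc c' \<longleftrightarrow> c = c'"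
  using arc_into_inject[OF under_point(3) under_point(3)] under_point(2) by metis

text \<open>At t = 1 the overpassing arc drops out and the relator becomes the signed difference of
  the incoming and the outgoing arc.\<close>

lemma augmentation_relator:
  "augmentation (r * Poly_Mapping.lookup (relator D c) b) = augmentation (crossing_sign c * r) *
    ((if in_arc c = b then 1 else 0) - (if out_arc c = b then 1 else 0))"
  by (simp add: relator_def lookup_add lookup_minus lookup_single when_def right_arc_def left_arc_def
      crossing_sign_def augmentation_simps)

lemma augmentation_sum: "augmentation (sum f X) = (\<Sum>x\<in>X. augmentation (f x))"
  by (induction X rule: infinite_finite_induct) (simp_all add: augmentation_simps)

text \<open>At t = 1 the coefficient of an arc balances the crossing where it begins against the one
  where it ends. So the signed value passes unchanged from crossing to crossing along the
  component.\<close>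

lemma constant_on_components:
  assumes f: "\<And>b. augmentation (Poly_Mapping.lookup (\<Sum>c\<in>crossings D. lscale (f c) (relator D c)) b) = 0"
    and i: "i < ncomp D"
  obtains n where "\<And>c. c \<in> under_crossings i \<Longrightarrow> augmentation (f c) * augmentation (crossing_sign c) = n"
proof -
  define g where "g c = augmentation (crossing_sign c * f c)" for c
  let ?C = "crossings D"
  define st where "st b = (\<Sum>c\<in>?C. if out_arc c = b then g c else 0)" for b
  have st': "st b = (\<Sum>c\<in>?C. if in_arc c = b then g c else 0)" for b
  proof -
    have "(\<Sum>c\<in>?C. g c * ((if in_arc c = b then 1 else 0) - (if out_arc c = b then 1 else 0))) = 0"
      using f[of b] by (simp add: lookup_sum augmentation_sum augmentation_relator g_def)
    then have "(\<Sum>c\<in>?C. (if in_arc c = b then g c else 0) - (if out_arc c = b then g c else 0)) = 0"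
      by (rule HOL.trans[OF sum.cong[OF HOL.refl], rotated]) simp
    then show ?thesis by (simp add: st_def sum_subtractf)
  qed
  have out: "st (out_arc c) = g c" if "c \<in> ?C" for c
  proof -
    have "st (out_arc c) = (\<Sum>c'\<in>?C. if c' = c then g c' else 0)"
      unfolding st_def by (rule sum.cong[OF HOL.refl]) (use that out_arc_inject in auto)
    then show ?thesis using that finite_crossings by simp
  qed
  have "st (in_arc c) = (\<Sum>c'\<in>?C. if c' = c then g c' else 0)" if "c \<in> ?C" for c
    unfolding st' by (rule sum.cong[OF HOL.refl]) (use that in_arc_inject in auto)
  then have into: "st (in_arc c) = g c" if "c \<in> ?C" for c using that finite_crossings by simp
  obtain a where a: "a \<in> arcs D" "fst a = i" by (rule arc_exists[OF i])
  \<comment> \<open>The trivial action: transport along a component then says that the state is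
    constant.\<close>
  have act: "additive_action (\<lambda>(_ :: int) (s :: int). s)" by unfold_locales simp_all
  show thesis
  proof (rule that[of "st a"])
    fix c assume c: "c \<in> under_crossings i"
    have "\<exists>Y\<subseteq>under_crossings i. st (out_arc c) = st a"
      by (rule component_transport(2)[where J = "\<lambda>_. 0 :: int" and act = "\<lambda>_ s. s", OF act i _ a]) (use c out into arc_out_of_under in auto)
    then have "st (out_arc c) = st a" by blast
    then show "augmentation (f c) * augmentation (crossing_sign c) = st a"
      using out c by (simp add: g_def augmentation_mult mult.commute)
  qed
qed

text \<open>The relator coefficients of (1 - t) \<open>\<kappa>\<close> are, modulo 1 - t, the
  crossing signs times an integer for each component. By \<open>longitude_relation\<close> these
  parts sum to 1 - t times a combination of longitudes; the rest is 1 - t times a relation.\<close>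

lemma annihilator:
  assumes \<kappa>: "lscale (1 - tvar) \<kappa> \<in> relations D"
  shows "\<exists>n :: nat \<Rightarrow> int. \<kappa> - (\<Sum>i<ncomp D. lscale (of_int (n i)) (longitude i)) \<in> relations D"
proof -
  obtain f where f: "lscale (1 - tvar) \<kappa> = (\<Sum>c\<in>crossings D. lscale (f c) (relator D c))"
    using \<kappa> by (auto simp: relations_iff)
  have "augmentation (Poly_Mapping.lookup (\<Sum>c\<in>crossings D. lscale (f c) (relator D c)) b) = 0" for b
    unfolding f[symmetric] by (simp add: augmentation_simps)
  note zero = this
  have "\<exists>n. i < ncomp D \<longrightarrow> (\<forall>c\<in>under_crossings i. augmentation (f c) * augmentation (crossing_sign c) = n)" for i
  proof (cases "i < ncomp D")
    case True
    show ?thesis by (rule constant_on_components[OF zero True]) blast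
  qed simp
  then have "\<exists>n. \<forall>i. i < ncomp D \<longrightarrow> (\<forall>c\<in>under_crossings i. augmentation (f c) * augmentation (crossing_sign c) = n i)"
    by (intro choice allI)
  then obtain n where n: "\<And>i c. i < ncomp D \<Longrightarrow> c \<in> under_crossings i \<Longrightarrow>
      augmentation (f c) * augmentation (crossing_sign c) = n i" by blast
  have "\<exists>w. \<forall>c. f c = of_int (augmentation (f c)) + (1 - tvar) * w c" by (intro choice allI laurent_divide)
  then obtain w where w: "f c = of_int (augmentation (f c)) + (1 - tvar) * w c" for c by blast
  \<comment> \<open>A sign squares to 1, so multiplying \<open>n i\<close> by the sign gives back
    the evaluation of \<open>f c\<close> at t = 1.\<close>
  have fc: "f c = of_int (n i) * crossing_sign c + (1 - tvar) * w c" if "i < ncomp D" "c \<in> under_crossings i" for i c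
  proof -
    have "of_int (n i) * crossing_sign c = of_int (augmentation (f c))"
      unfolding n[OF that, symmetric] by (simp add: crossing_sign_def augmentation_simps)
    then show ?thesis using w[of c] by simp
  qed
  have "lscale (1 - tvar) \<kappa> = (\<Sum>i<ncomp D. \<Sum>c\<in>under_crossings i. lscale (f c) (relator D c))"
    unfolding f sum_components ..
  also have "\<dots> = (\<Sum>i<ncomp D. \<Sum>c\<in>under_crossings i.
      lscale (of_int (n i)) (lscale (crossing_sign c) (relator D c)) + lscale (1 - tvar) (lscale (w c) (relator D c)))"
    by (intro sum.cong HOL.refl) (simp add: fc lscale_add_left lscale_lscale)
  also have "\<dots> = (\<Sum>i<ncomp D. lscale (of_int (n i)) (lscale (1 - tvar) (longitude i))) +
      (\<Sum>i<ncomp D. \<Sum>c\<in>under_crossings i. lscale (1 - tvar) (lscale (w c) (relator D c)))"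
    by (simp add: sum.distrib longitude_relation lscale_sum_right)
  also have "\<dots> = lscale (1 - tvar) ((\<Sum>i<ncomp D. lscale (of_int (n i)) (longitude i)) +
      (\<Sum>c\<in>crossings D. lscale (w c) (relator D c)))"
    unfolding sum_components by (simp add: lscale_add_right lscale_sum_right lscale_lscale mult.commute)
  finally have "\<kappa> = (\<Sum>i<ncomp D. lscale (of_int (n i)) (longitude i)) + (\<Sum>c\<in>crossings D. lscale (w c) (relator D c))"
    unfolding lscale_one_minus_tvar_cancel .
  then have "\<kappa> - (\<Sum>i<ncomp D. lscale (of_int (n i)) (longitude i)) = (\<Sum>c\<in>crossings D. lscale (w c) (relator D c))"
    by simp
  then show ?thesis unfolding relations_iff by blast
qed

text \<open>The sum of the two longitudes is a relation, so a multiple of it removes the longitude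
  of the other component.\<close>

lemma annihilator_two_components:
  assumes two: "ncomp D = 2" and i: "i < 2" and \<kappa>: "lscale (1 - tvar) \<kappa> \<in> relations D"
  shows "\<exists>n :: int. \<kappa> - lscale (of_int n) (longitude i) \<in> relations D"
proof -
  have l2: "{..<2::nat} = {0, 1}" by auto
  obtain n :: "nat \<Rightarrow> int" where n: "\<kappa> - (lscale (of_int (n 0)) (longitude 0) + lscale (of_int (n 1)) (longitude 1)) \<in> relations D"
    using annihilator[OF \<kappa>] by (auto simp: two l2)
  have s: "longitude 0 + longitude 1 \<in> relations D" using sum_longitudes by (simp add: two l2)
  have add: "\<kappa> - (lscale (of_int (n 0)) (longitude 0) + lscale (of_int (n 1)) (longitude 1)) +
      lscale r (longitude 0 + longitude 1) \<in> relations D" for r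
    by (intro relations.add_mem n relations.lscale_mem s)
  have "i = 0 \<or> i = 1" using i by auto
  then show ?thesis
  proof
    assume "i = 0"
    then show ?thesis using add[of "of_int (n 1)"]
      by (intro exI[of _ "n 0 - n 1"]) (simp add: lscale_simps algebra_simps)
  next
    assume "i = 1"
    then show ?thesis using add[of "of_int (n 0)"]
      by (intro exI[of _ "n 1 - n 0"]) (simp add: lscale_simps algebra_simps)
  qed
qed

end

section \<open>The action on the medial quandle\<close>

context link
begin

abbreviation "qclass \<equiv> mq_class (arcs D) mq_relations"
abbreviation "arc_terms \<equiv> qterms (arcs D)"

lemma MQ_carrier: "carrier (MQ D) = qclass ` arc_terms"
  unfolding MQ_eq by (rule carrier_presented_mq)

lemma MQ_op: "s \<in> arc_terms \<Longrightarrow> u \<in> arc_terms \<Longrightarrow> qclass s \<triangleright>\<^bsub>MQ D\<^esub> qclass u = qclass (Op s u)"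
  unfolding MQ_eq by (rule qop_mq_class)

lemma qclass_carrier: "s \<in> arc_terms \<Longrightarrow> qclass s \<in> carrier (MQ D)"
  unfolding MQ_carrier by (rule imageI)

lemma medial_quandle_MQ: "medial_quandle (MQ D)"
  unfolding MQ_eq by (rule medial_quandle_presented_mq)

end

sublocale link \<subseteq> MQ: medial_quandle "MQ D"
  by (rule medial_quandle_MQ)

text \<open>The action is set up on the whole free module and not only on the kernel: with the
  reference arc \<open>z\<close>, an arc b acts as its translation after the inverse translation of
  \<open>z\<close>, so that \<open>z\<close> itself acts trivially.\<close>

locale link_action = link +
  fixes z :: arc and H :: "(arc \<Rightarrow>\<^sub>0 laurent) \<Rightarrow> arc qterm set \<Rightarrow> arc qterm set"
  assumes z: "z \<in> arcs D" and act: "additive_action H"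
    and H_gen: "b \<in> arcs D \<Longrightarrow> H (Poly_Mapping.single b 1) = MQ.displacement (qclass (Gen b)) (qclass (Gen z))"
    and H_tvar: "H (lscale tvar f) = MQ.translation (qclass (Gen z)) \<circ> H f \<circ> inv_into UNIV (MQ.translation (qclass (Gen z)))"
begin

abbreviation "T s \<equiv> MQ.translation (qclass s)"
abbreviation "T' s \<equiv> inv_into UNIV (MQ.translation (qclass s))"

lemma H_0: "H 0 x = x" and H_add: "H (f + g) x = H f (H g x)"
  using act unfolding additive_action_def by auto

lemma H_minus: "H (- f) (H f x) = x" "H f (H (- f) x) = x"
  using H_add[of "- f" f x] H_add[of f "- f" x] by (simp_all add: H_0)

lemma H_diff: "H (f - g) x = H f (H (- g) x)"
  using H_add[of f "- g" x] by simp

lemma Gen_z: "Gen z \<in> arc_terms"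
  using z by (simp add: qterms_iffs)

lemma T_inv: "s \<in> arc_terms \<Longrightarrow> T s (T' s x) = x" "s \<in> arc_terms \<Longrightarrow> T' s (T s x) = x"
  using MQ.translation_inv[OF qclass_carrier] by auto

lemma T_inject:
  assumes "s \<in> arc_terms" "T s x = T s y"
  shows "x = y"
  using arg_cong[OF assms(2), of "T' s"] unfolding T_inv(2)[OF assms(1)] .

lemma H_tvar': "H (lscale tvar f) x = T (Gen z) (H f (T' (Gen z) x))"
  by (simp add: H_tvar)

lemma T_Op: "s \<in> arc_terms \<Longrightarrow> u \<in> arc_terms \<Longrightarrow> T (Op s u) x = T u (T s (T' u x))"
  using MQ.translation_translation[OF qclass_carrier qclass_carrier, of s u x] by (simp add: MQ_op)

lemma T_qclass: "s \<in> arc_terms \<Longrightarrow> u \<in> arc_terms \<Longrightarrow> T u (qclass s) = qclass (Op s u)"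
  by (simp add: MQ.translation_def qclass_carrier MQ_op)

lemma T_idem: "s \<in> arc_terms \<Longrightarrow> T s (qclass s) = qclass s"
  by (simp add: MQ.translation_def qclass_carrier MQ.idem)

text \<open>The defining property for arcs extends to terms because the translation of
  \<open>Op s u\<close> is that of \<open>s\<close> conjugated by that of \<open>u\<close>, which
  matches the rewriting of its value as u + t (s - u).\<close>

lemma H_alexander_value: "s \<in> arc_terms \<Longrightarrow> H (alexander_value s) (T (Gen z) x) = T s x"
proof (induction s arbitrary: x)
  case (Gen b)
  then show ?case by (simp add: Gen_qterms H_gen MQ.displacement_def T_inv Gen_z z)
next
  case (Op s u)
  then have su: "s \<in> arc_terms" "u \<in> arc_terms" by (simp_all add: qterms_iffs)
  let ?s = "alexander_value s" and ?u = "alexander_value u"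
  have "alexander_value (Op s u) = ?u + lscale tvar (?s + - ?u)" by (simp add: lscale_simps)
  then have "H (alexander_value (Op s u)) (T (Gen z) x) = T u (H ?s (H (- ?u) x))"
    by (simp add: H_add H_diff H_tvar' T_inv Gen_z Op.IH(2)[OF su(2)])
  also have "\<dots> = T u (H ?s (H (- ?u) (H ?u (T (Gen z) (T' u x)))))"
    by (simp add: Op.IH(2)[OF su(2)] T_inv su)
  also have "\<dots> = T (Op s u) x" by (simp add: H_minus Op.IH(1)[OF su(1)] T_Op su)
  finally show ?case .
next
  case (Inv s u)
  then have su: "s \<in> arc_terms" "u \<in> arc_terms" by (simp_all add: qterms_iffs)
  let ?s = "alexander_value s" and ?u = "alexander_value u" and ?v = "Inv s u"
  \<comment> \<open>Multiplying by t clears the inverse in the value of \<open>Inv s u\<close>; the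
    claim is proved after applying the translation of \<open>z\<close>, which is injective.\<close>
  have eq: "lscale tvar (alexander_value ?v) = - ?u + (?s + lscale tvar ?u)"
    by (simp add: lscale_lscale mult.assoc[symmetric] tvar_inverse lscale_simps)
  have 1: "T (Gen z) (H (alexander_value ?v) y) = H (- ?u) (H ?s (T (Gen z) (H ?u y)))" for y
  proof -
    have "T (Gen z) (H (alexander_value ?v) y) = H (lscale tvar (alexander_value ?v)) (T (Gen z) y)"
      by (simp only: H_tvar' T_inv(2)[OF Gen_z])
    also have "\<dots> = H (- ?u) (H ?s (T (Gen z) (H ?u y)))"
      unfolding eq H_add by (simp only: H_tvar' T_inv(2)[OF Gen_z])
    finally show ?thesis .
  qed
  have "qclass (Op ?v u) = qclass s" using su by (intro mq_eq_imp_class mq_eq.Op_Inv)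
  then have "T s (T u x) = T u (T ?v x)"
    using T_Op[OF Inv.prems su(2), of "T u x"] by (simp add: T_inv su)
  then have "H ?s (T (Gen z) (T u x)) = H ?u (T (Gen z) (T ?v x))"
    using Inv.IH su by simp
  then have "H (- ?u) (H ?s (T (Gen z) (T u x))) = T (Gen z) (T ?v x)" by (simp add: H_minus)
  then have "T (Gen z) (H (alexander_value ?v) (T (Gen z) x)) = T (Gen z) (T ?v x)"
    unfolding 1 by (simp add: Inv.IH(2)[OF su(2)])
  then show ?case by (rule T_inject[OF Gen_z])
qed

lemma H_alexander_value': "s \<in> arc_terms \<Longrightarrow> H (alexander_value s) x = T s (T' (Gen z) x)"
  using H_alexander_value[of s "T' (Gen z) x"] by (simp add: T_inv Gen_z)

text \<open>Multiplication by t acts by conjugation, so elements acting trivially are stable under t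
  and its inverse, and also under sums and negatives.\<close>

lemma H_kernel_lscale:
  assumes "\<And>x. H f x = x"
  shows "H (lscale r f) x = x"
proof -
  have neg: "H (- g) x = x" if "\<And>x. H g x = x" for g x using H_minus(1)[of g x] that by simp
  have up: "H (lscale tvar g) x = x" if "\<And>x. H g x = x" for g x by (simp add: H_tvar' that T_inv Gen_z)
  have down: "H g x = x" if "\<And>x. H (lscale tvar g) x = x" for g x
    by (rule T_inject[OF Gen_z]) (use that[of "T (Gen z) x"] in \<open>simp add: H_tvar' T_inv Gen_z\<close>)
  have "\<forall>x. H (lscale (tpow n) f) x = x" for n
  proof (induction n rule: int_induct[where k = 0])
    case base
    then show ?case by (simp add: lscale_one assms)
  next
    case (step1 n)
    have "lscale (tpow (n + 1)) f = lscale tvar (lscale (tpow n) f)"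
      by (simp add: lscale_lscale tvar_def mult_single add.commute)
    then show ?case using up step1 by simp
  next
    case (step2 n)
    have "lscale (tpow n) f = lscale tvar (lscale (tpow (n - 1)) f)"
      by (simp add: lscale_lscale tvar_def mult_single)
    then show ?case using down[of "lscale (tpow (n - 1)) f"] step2 by simp
  qed
  then have "\<forall>x. H (lscale r f) x = x"
    by (induction r rule: laurent_induct)
      (auto simp: lscale_simps H_0 H_add neg)
  then show ?thesis by blast
qed

text \<open>Both sides of a crossing relation have the same class, hence the same translation, so
  their difference acts trivially; the action factors through the Alexander module.\<close>

lemma H_relations:
  assumes "f \<in> relations D"
  shows "H f x = x"
proof -
  have relator: "H (relator D c) x = x" if c: "c \<in> crossings D" for c x
  proof -
    let ?s = "Op (Gen (right_arc D c)) (Gen (over_arc D c))" and ?u = "Gen (left_arc D c)"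
    have su: "?s \<in> arc_terms" "?u \<in> arc_terms"
      using over_arc_arcs[OF c] right_left_arcs[OF c] by (simp_all add: qterms_iffs)
    have "qclass ?s = qclass ?u"
      by (intro mq_eq_imp_class mq_eq.rel) (use c over_arc_arcs[OF c] right_left_arcs[OF c] in auto)
    then have "H (alexander_value ?s) y = H (alexander_value ?u) y" for y
      unfolding H_alexander_value'[OF su(1)] H_alexander_value'[OF su(2)] by simp
    moreover have "alexander_value ?s = relator D c + alexander_value ?u"
      using alexander_value_relator[of c] by (simp add: algebra_simps del: alexander_value.simps)
    ultimately have "H (relator D c) (H (alexander_value ?u) y) = H (alexander_value ?u) y" for y
      by (simp add: H_add del: alexander_value.simps)
    from this[of "H (- alexander_value ?u) x"] show ?thesis by (simp only: H_minus)
  qed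
  obtain r where r: "f = (\<Sum>c\<in>crossings D. lscale (r c) (relator D c))" using assms by (auto simp: relations_iff)
  have "H (\<Sum>c\<in>X. lscale (r c) (relator D c)) x = x" if "finite X" "X \<subseteq> crossings D" for X x
    using that by (induction X arbitrary: x rule: finite_induct) (simp_all add: H_0 H_add H_kernel_lscale relator)
  then show ?thesis using r finite_crossings by simp
qed

lemma H_base: "H (lscale r (gen z)) x = x"
  by (rule H_kernel_lscale) (simp add: H_gen z MQ.displacement_def T_inv Gen_z)

text \<open>By idempotence the inverse translation of the right arc fixes its own class, and the
  translation of the overpassing arc then produces the left arc.\<close>

lemma H_crossing_step:
  assumes c: "c \<in> crossings D"
  shows "H (crossing_step c) (qclass (Gen (in_arc c))) = qclass (Gen (out_arc c))"
proof -
  let ?r = "Gen (right_arc D c)" and ?l = "Gen (left_arc D c)" and ?o = "Gen (over_arc D c)"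
  have mem: "?r \<in> arc_terms" "?l \<in> arc_terms" "?o \<in> arc_terms"
    using over_arc_arcs[OF c] right_left_arcs[OF c] by (simp_all add: qterms_iffs)
  have "qclass (Op ?r ?o) = qclass ?l"
    by (intro mq_eq_imp_class mq_eq.rel) (use c over_arc_arcs[OF c] right_left_arcs[OF c] in auto)
  then have l: "T ?o (qclass ?r) = qclass ?l" using mem by (simp add: T_qclass)
  let ?d = "gen (over_arc D c) - gen (right_arc D c)"
  have "H ?d (qclass ?r) = H (alexander_value ?o + - alexander_value ?r) (qclass ?r)" by simp
  also have "\<dots> = H (alexander_value ?o) (H (- alexander_value ?r) (qclass ?r))" by (rule H_add)
  also have "H (- alexander_value ?r) (qclass ?r) = H (- alexander_value ?r) (H (alexander_value ?r) (T (Gen z) (qclass ?r)))"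
    unfolding H_alexander_value[OF mem(1)] T_idem[OF mem(1)] ..
  also have "\<dots> = T (Gen z) (qclass ?r)" by (rule H_minus)
  also have "H (alexander_value ?o) (T (Gen z) (qclass ?r)) = qclass ?l"
    unfolding H_alexander_value[OF mem(3)] l ..
  finally have d: "H ?d (qclass ?r) = qclass ?l" .
  then have d': "H (- ?d) (qclass ?l) = qclass ?r" using H_minus(1)[of ?d "qclass ?r"] by (simp only:)
  show ?thesis
  proof (cases "under_right_to_left D c")
    case True
    then show ?thesis using d by (simp add: crossing_step_def crossing_sign_def lscale_one right_arc_def left_arc_def)
  next
    case False
    then have "crossing_step c = - ?d" by (simp add: crossing_step_def crossing_sign_def lscale_minus_left lscale_one)
    then show ?thesis using False d' by (simp add: right_arc_def left_arc_def)
  qed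
qed

lemma coset_shift: "(\<lambda>f. f + h) ` coset g = coset (g + h)"
proof (rule equalityI; rule subsetI)
  fix f assume f: "f \<in> coset (g + h)"
  then have "f - h \<in> coset g" by (simp add: mem_coset algebra_simps)
  then show "f \<in> (\<lambda>f. f + h) ` coset g" by (intro image_eqI[of _ _ "f - h"]) simp_all
qed (auto simp: mem_coset)

lemma coeff_sum_crossing_step: "coeff_sum (crossing_step c) = 0"
  by (simp add: crossing_step_def coeff_sum_lscale coeff_sum_diff coeff_sum_single)

lemma keys_crossing_step: "c \<in> crossings D \<Longrightarrow> Poly_Mapping.keys (crossing_step c) \<subseteq> arcs D"
  unfolding crossing_step_def using over_arc_arcs right_left_arcs by (intro keys_subset) auto

text \<open>Class and Alexander coset are transported together, so that the same \<open>k\<close>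
  describes the displacement in the quandle and in the module. A full turn gives the longitude,
  which therefore fixes the class.\<close>

lemma component_class:
  assumes i: "i < ncomp D" and a: "a \<in> arcs D" "fst a = i" and b: "b \<in> arcs D" "fst b = i"
  shows "H (longitude i) (qclass (Gen a)) = qclass (Gen a)"
    and "\<exists>k. Poly_Mapping.keys k \<subseteq> arcs D \<and> coeff_sum k = 0 \<and> qclass (Gen b) = H k (qclass (Gen a)) \<and>
      gen b - (gen a + lscale (1 - tvar) k) \<in> relations D"
proof -
  define A where "A g x = (H g (fst x), (\<lambda>f. f + lscale (1 - tvar) g) ` snd x)" for g and x :: "arc qterm set \<times> (arc \<Rightarrow>\<^sub>0 laurent) set"
  have act: "additive_action A"
    by unfold_locales (auto simp: A_def H_0 H_add lscale_simps image_image add_ac)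
  define st where "st a = (qclass (Gen a), coset (gen a))" for a
  have step: "st (out_arc c) = A (crossing_step c) (st (in_arc c))" if "c \<in> under_crossings i" for c
  proof -
    have c: "c \<in> crossings D" using that by simp
    have "coset (gen (out_arc c)) = coset (gen (in_arc c) + lscale (1 - tvar) (crossing_step c))"
      unfolding coset_eq_iff crossing_step_relator
      using relations.minus_mem[OF relations.lscale_mem[OF relator_mem[OF c], of "crossing_sign c"]] by simp
    then show ?thesis by (simp add: st_def A_def H_crossing_step c coset_shift)
  qed
  have "st a = A (\<Sum>c\<in>under_crossings i. crossing_step c) (st a)"
    by (rule component_transport(1)[OF act i step a])
  then show "H (longitude i) (qclass (Gen a)) = qclass (Gen a)"
    by (simp add: st_def A_def longitude_def)
  have "\<exists>Y\<subseteq>under_crossings i. st b = A (\<Sum>c\<in>Y. crossing_step c) (st a)"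
    by (rule component_transport(2)[OF act i step a b])
  then obtain Y where Y: "Y \<subseteq> under_crossings i" "st b = A (\<Sum>c\<in>Y. crossing_step c) (st a)" by blast
  let ?k = "\<Sum>c\<in>Y. crossing_step c"
  have k: "qclass (Gen b) = H ?k (qclass (Gen a))" "coset (gen b) = coset (gen a + lscale (1 - tvar) ?k)"
    using Y(2) by (simp_all add: st_def A_def coset_shift)
  have finY: "finite Y" using Y(1) finite_crossings by (auto intro: finite_subset)
  have "Poly_Mapping.keys (\<Sum>c\<in>X. crossing_step c) \<subseteq> arcs D" if "finite X" "X \<subseteq> crossings D" for X
    using that
  proof (induction rule: finite_induct)
    case (insert x F)
    then show ?case by (simp add: keys_add_subset keys_crossing_step)
  qed simp
  then have "Poly_Mapping.keys ?k \<subseteq> arcs D" using finY Y(1) by blast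
  then show "\<exists>k. Poly_Mapping.keys k \<subseteq> arcs D \<and> coeff_sum k = 0 \<and> qclass (Gen b) = H k (qclass (Gen a)) \<and>
      gen b - (gen a + lscale (1 - tvar) k) \<in> relations D"
    using k by (intro exI[of _ ?k]) (simp add: coeff_sum_sum coeff_sum_crossing_step coset_eq_iff)
qed

text \<open>Multiples of \<open>z\<close> act trivially, so subtracting one yields an element of
  coefficient sum 0 with the same action.\<close>

definition centered :: "(arc \<Rightarrow>\<^sub>0 laurent) \<Rightarrow> (arc \<Rightarrow>\<^sub>0 laurent)" where
  "centered k = k - lscale (coeff_sum k) (gen z)"

lemma H_centered: "H (centered k) x = H k x"
proof -
  have "centered k = k + lscale (- coeff_sum k) (gen z)" by (simp add: centered_def lscale_minus_left)
  then show ?thesis by (simp only: H_add H_base)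
qed

text \<open>The quandle element is a displacement of a base arc, and its Alexander value remembers
  this displacement only multiplied by 1 - t. Both statements must share \<open>k\<close>, since
  their comparison decides injectivity.\<close>

lemma normal_form:
  assumes base: "\<And>i. i < ncomp D \<Longrightarrow> base i \<in> arcs D \<and> fst (base i) = i"
  shows "s \<in> arc_terms \<Longrightarrow> \<exists>i<ncomp D. \<exists>k. qclass s = H k (qclass (Gen (base i))) \<and>
    alexander_value s - (gen (base i) + lscale (1 - tvar) (centered k)) \<in> relations D"
proof (induction s)
  case (Gen b)
  then have b: "b \<in> arcs D" by (simp add: qterms_iffs)
  then have i: "fst b < ncomp D" by (simp add: arcs_iff)
  obtain k where "coeff_sum k = 0" "qclass (Gen b) = H k (qclass (Gen (base (fst b))))"
    "gen b - (gen (base (fst b)) + lscale (1 - tvar) k) \<in> relations D"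
    using component_class(2)[OF i _ _ b HOL.refl, of "base (fst b)"] base[OF i] by auto
  then show ?case using i by (intro exI[of _ "fst b"] conjI exI[of _ k]) (simp_all add: centered_def lscale_zero_left)
next
  case (Op s u)
  then have su: "s \<in> arc_terms" "u \<in> arc_terms" by (simp_all add: qterms_iffs)
  obtain i k where ik: "i < ncomp D" "qclass s = H k (qclass (Gen (base i)))"
    "alexander_value s - (gen (base i) + lscale (1 - tvar) (centered k)) \<in> relations D"
    using Op.IH(1)[OF su(1)] by blast
  let ?a = "Gen (base i)" and ?u = "alexander_value u"
  have a: "?a \<in> arc_terms" using base[OF ik(1)] by (simp add: qterms_iffs)
  \<comment> \<open>Translating by \<open>u\<close> is acting with its value after the translation
    of \<open>z\<close>; moving the latter past \<open>k\<close> multiplies \<open>k\<close> by t,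
    and on the base class it acts as minus the base arc.\<close>
  let ?k = "?u + lscale tvar k - gen (base i)"
  have "H (- gen (base i)) (qclass ?a) = T (Gen z) (qclass ?a)"
    using H_alexander_value[OF a, of "qclass ?a"] H_minus(1)[of "gen (base i)" "T (Gen z) (qclass ?a)"]
    by (simp add: T_idem a)
  then have "H ?k (qclass ?a) = H ?u (H (lscale tvar k) (T (Gen z) (qclass ?a)))"
    using H_add[of "?u + lscale tvar k" "- gen (base i)"] by (simp add: H_add)
  also have "\<dots> = T u (qclass s)"
    by (simp add: H_tvar' T_inv Gen_z ik(2) H_alexander_value su)
  also have "\<dots> = qclass (Op s u)" by (simp add: T_qclass su)
  finally have H: "qclass (Op s u) = H ?k (qclass ?a)" ..
  have "coeff_sum ?k = tvar * coeff_sum k"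
    by (simp add: coeff_sum_diff coeff_sum_add coeff_sum_alexander_value coeff_sum_lscale coeff_sum_single)
  then have "alexander_value (Op s u) - (gen (base i) + lscale (1 - tvar) (centered ?k)) =
     lscale tvar (alexander_value s - (gen (base i) + lscale (1 - tvar) (centered k)))"
    by (simp add: centered_def lscale_simps algebra_simps)
  then have "alexander_value (Op s u) - (gen (base i) + lscale (1 - tvar) (centered ?k)) \<in> relations D"
    using relations.lscale_mem[OF ik(3)] by simp
  then show ?case using H ik(1) by blast
next
  case (Inv s u)
  then have su: "s \<in> arc_terms" "u \<in> arc_terms" by (simp_all add: qterms_iffs)
  obtain i k where ik: "i < ncomp D" "qclass s = H k (qclass (Gen (base i)))"
    "alexander_value s - (gen (base i) + lscale (1 - tvar) (centered k)) \<in> relations D"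
    using Inv.IH(1)[OF su(1)] by blast
  let ?a = "Gen (base i)" and ?u = "alexander_value u" and ?v = "Inv s u"
  have a: "?a \<in> arc_terms" using base[OF ik(1)] by (simp add: qterms_iffs)
  \<comment> \<open>Obtained by solving the formula of the previous case for the displacement of the
    inverse term.\<close>
  let ?k = "lscale (tpow (-1)) (k - ?u + gen (base i))"
  have tk: "lscale tvar ?k = - ?u + k + gen (base i)"
    by (simp add: lscale_lscale tvar_inverse lscale_one)
  have "T (Gen z) (H ?k (qclass ?a)) = H (lscale tvar ?k) (T (Gen z) (qclass ?a))"
    by (simp add: H_tvar' T_inv Gen_z)
  also have "\<dots> = H (- ?u) (H k (H (gen (base i)) (T (Gen z) (qclass ?a))))"
    unfolding tk by (simp only: H_add)
  also have "H (gen (base i)) (T (Gen z) (qclass ?a)) = qclass ?a"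
    using H_alexander_value[OF a, of "qclass ?a"] by (simp add: T_idem a)
  also have "H (- ?u) (H k (qclass ?a)) = H (- ?u) (T u (qclass ?v))"
    using mq_eq_imp_class[OF mq_eq.Op_Inv[OF su]] T_qclass[OF Inv.prems su(2)] ik(2) by simp
  also have "\<dots> = T (Gen z) (qclass ?v)"
    unfolding H_alexander_value[OF su(2), symmetric] by (rule H_minus)
  finally have H: "qclass ?v = H ?k (qclass ?a)" by (rule T_inject[OF Gen_z, THEN HOL.sym])
  have "coeff_sum ?k = tpow (-1) * coeff_sum k"
    by (simp add: coeff_sum_diff coeff_sum_add coeff_sum_alexander_value coeff_sum_lscale coeff_sum_single)
  then have ck: "centered ?k = lscale (tpow (-1)) (centered k - ?u + gen (base i))"
    by (simp add: centered_def lscale_simps)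
  have inner: "alexander_value s - lscale (1 - tvar) ?u -
      (lscale tvar (gen (base i)) + lscale (1 - tvar) (centered k - ?u + gen (base i))) =
     alexander_value s - (gen (base i) + lscale (1 - tvar) (centered k))"
    by (simp add: lscale_simps)
  have "gen (base i) = lscale (tpow (-1)) (lscale tvar (gen (base i)))"
    by (simp add: lscale_lscale tvar_inverse lscale_one)
  then have "alexander_value ?v - (gen (base i) + lscale (1 - tvar) (centered ?k)) =
     lscale (tpow (-1)) (alexander_value s - lscale (1 - tvar) ?u -
      (lscale tvar (gen (base i)) + lscale (1 - tvar) (centered k - ?u + gen (base i))))"
    unfolding ck alexander_value.simps lscale_commute[of "1 - tvar" "tpow (-1)"]
    by (simp only: lscale_diff_right lscale_add_right)
  then have "alexander_value ?v - (gen (base i) + lscale (1 - tvar) (centered ?k)) =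
     lscale (tpow (-1)) (alexander_value s - (gen (base i) + lscale (1 - tvar) (centered k)))"
    unfolding inner .
  then have "alexander_value ?v - (gen (base i) + lscale (1 - tvar) (centered ?k)) \<in> relations D"
    using relations.lscale_mem[OF ik(3)] by simp
  then show ?case using H ik(1) by blast
qed

end

section \<open>Links with two components\<close>

text \<open>The total coefficient at t = 1 on the arcs of component 1. On the kernel for two
  components it is the coordinate modulo (1 - t) times the kernel.\<close>

definition component_weight :: "(arc \<Rightarrow>\<^sub>0 laurent) \<Rightarrow> int" where
  "component_weight = psum (\<lambda>a r. if fst a = 1 then augmentation r else 0)"

lemma
  shows component_weight_add: "component_weight (f + g) = component_weight f + component_weight g"
    and component_weight_single: "component_weight (Poly_Mapping.single a r) = (if fst a = 1 then augmentation r else 0)"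
    and component_weight_zero: "component_weight 0 = 0"
  unfolding component_weight_def by (simp_all add: psum_add psum_single augmentation_simps)

lemma component_weight_diff: "component_weight (f - g) = component_weight f - component_weight g"
  using component_weight_add[of "f - g" g] by simp

lemma component_weight_lscale: "component_weight (lscale r f) = augmentation r * component_weight f"
  by (rule poly_mapping_additive_induct[of f UNIV])
    (auto simp: component_weight_add component_weight_single component_weight_zero lscale_simps lscale_single
      augmentation_simps algebra_simps)

lemmas component_weight_simps = component_weight_add component_weight_single component_weight_zero
  component_weight_diff component_weight_lscale augmentation_simps

section \<open>Invariance of the weight and realization of translations by quandle terms\<close>

context link
begin

text \<open>At t = 1 a relator is the difference of two underpassing arcs, which belong to the same
  component.\<close>

lemma component_weight_relations: "f \<in> relations D \<Longrightarrow> component_weight f = 0"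
proof -
  assume "f \<in> relations D"
  then obtain r where f: "f = (\<Sum>c\<in>crossings D. lscale (r c) (relator D c))" by (auto simp: relations_iff)
  have "component_weight (relator D c) = 0" if "c \<in> crossings D" for c
    using right_left_arcs[OF that] by (simp add: relator_def component_weight_simps)
  then have "component_weight (\<Sum>c\<in>X. lscale (r c) (relator D c)) = 0" if "X \<subseteq> crossings D" for X
    using that by (induction X rule: infinite_finite_induct) (simp_all add: component_weight_simps)
  then show ?thesis using f by simp
qed

lemma coeff_sum_cong: "f - g \<in> relations D \<Longrightarrow> coeff_sum f = coeff_sum g"
  using coeff_sum_relations[of "f - g" D] by (simp add: coeff_sum_diff)

lemma component_weight_cong: "f - g \<in> relations D \<Longrightarrow> component_weight f = component_weight g"
  using component_weight_relations[of "f - g"] by (simp add: component_weight_diff)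

text \<open>Applying \<open>Inv\<close> with one arc and then \<open>Op\<close> with another adds 1
  - t times their difference; sandwiching a shift between the two operations with \<open>z\<close>
  multiplies it by t or its inverse. These shifts generate all the others additively.\<close>

lemma shift_term:
  assumes z: "z \<in> arcs D" and k: "Poly_Mapping.keys k \<subseteq> arcs D"
  shows "\<forall>s\<in>arc_terms. \<exists>s'\<in>arc_terms. alexander_value s' = alexander_value s + lscale (1 - tvar) (k - lscale (coeff_sum k) (gen z))"
proof -
  let ?P = "\<lambda>k. \<forall>s\<in>arc_terms. \<exists>s'\<in>arc_terms. alexander_value s' = alexander_value s + lscale (1 - tvar) (k - lscale (coeff_sum k) (gen z))"
  have zt: "Gen z \<in> arc_terms" using z by (simp add: qterms_iffs)
  have cancel: "lscale tvar (lscale (tpow (-1)) f) = f" "lscale (tpow (-1)) (lscale tvar f) = f" for f :: "arc \<Rightarrow>\<^sub>0 laurent"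
    by (simp_all add: lscale_lscale tvar_inverse lscale_one)
  have up: "?P (lscale tvar k)" if P: "?P k" for k
  proof
    fix s assume "s \<in> arc_terms"
    then obtain s' where s': "s' \<in> arc_terms" "alexander_value s' = alexander_value (Inv s (Gen z)) + lscale (1 - tvar) (k - lscale (coeff_sum k) (gen z))"
      using P zt by (metis Inv_qterms)
    have "alexander_value (Op s' (Gen z)) = alexander_value s + lscale tvar (lscale (1 - tvar) (k - lscale (coeff_sum k) (gen z)))"
      unfolding alexander_value.simps s'(2) lscale_add_right cancel by simp
    also have "\<dots> = alexander_value s + lscale (1 - tvar) (lscale tvar k - lscale (coeff_sum (lscale tvar k)) (gen z))"
      unfolding lscale_commute[of tvar "1 - tvar"] by (simp add: lscale_diff_right lscale_lscale coeff_sum_lscale)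
    finally show "\<exists>s'\<in>arc_terms. alexander_value s' = alexander_value s + lscale (1 - tvar) (lscale tvar k - lscale (coeff_sum (lscale tvar k)) (gen z))"
      using s'(1) zt by (intro bexI[of _ "Op s' (Gen z)"]) (simp_all add: qterms_iffs)
  qed
  have down: "?P (lscale (tpow (-1)) k)" if P: "?P k" for k
  proof
    fix s assume "s \<in> arc_terms"
    then obtain s' where s': "s' \<in> arc_terms" "alexander_value s' = alexander_value (Op s (Gen z)) + lscale (1 - tvar) (k - lscale (coeff_sum k) (gen z))"
      using P zt by (metis Op_qterms)
    have "alexander_value (Inv s' (Gen z)) = lscale (tpow (-1)) (lscale tvar (alexander_value s) + lscale (1 - tvar) (k - lscale (coeff_sum k) (gen z)))"
      unfolding alexander_value.simps s'(2) by (simp add: algebra_simps)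
    also have "\<dots> = alexander_value s + lscale (1 - tvar) (lscale (tpow (-1)) k - lscale (coeff_sum (lscale (tpow (-1)) k)) (gen z))"
      unfolding lscale_add_right cancel lscale_commute[of "tpow (-1)" "1 - tvar"]
      by (simp add: lscale_diff_right lscale_lscale coeff_sum_lscale)
    finally show "\<exists>s'\<in>arc_terms. alexander_value s' = alexander_value s + lscale (1 - tvar) (lscale (tpow (-1)) k - lscale (coeff_sum (lscale (tpow (-1)) k)) (gen z))"
      using s'(1) zt by (intro bexI[of _ "Inv s' (Gen z)"]) (simp_all add: qterms_iffs)
  qed
  have powers: "?P (lscale (tpow n) k)" if P: "?P k" for n k
  proof (induction n rule: int_induct[where k = 0])
    case base
    then show ?case using P by (simp add: lscale_one)
  next
    case (step1 n)
    have "lscale tvar (lscale (tpow n) k) = lscale (tpow (n + 1)) k"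
      by (simp add: lscale_lscale tvar_def mult_single add.commute)
    then show ?case using up[OF step1(2)] by simp
  next
    case (step2 n)
    have "lscale (tpow (-1)) (lscale (tpow n) k) = lscale (tpow (n - 1)) k"
      by (simp add: lscale_lscale mult_single)
    then show ?case using down[OF step2(2)] by simp
  qed
  have plus: "?P (gen a)" if "a \<in> arcs D" for a
  proof
    fix s assume "s \<in> arc_terms"
    then show "\<exists>s'\<in>arc_terms. alexander_value s' = alexander_value s + lscale (1 - tvar) (gen a - lscale (coeff_sum (gen a)) (gen z))"
      using that z by (intro bexI[of _ "Op (Inv s (Gen z)) (Gen a)"])
        (simp_all add: qterms_iffs cancel coeff_sum_single lscale_one lscale_diff_right)
  qed
  have minus: "?P (- gen a)" if "a \<in> arcs D" for a
  proof
    have cs: "coeff_sum (- gen a) = - 1"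
      using coeff_sum_add[of "- gen a" "gen a"] by (simp add: coeff_sum_single coeff_sum_zero eq_neg_iff_add_eq_0)
    fix s assume "s \<in> arc_terms"
    then show "\<exists>s'\<in>arc_terms. alexander_value s' = alexander_value s + lscale (1 - tvar) (- gen a - lscale (coeff_sum (- gen a)) (gen z))"
      using that z unfolding cs by (intro bexI[of _ "Op (Inv s (Gen a)) (Gen z)"])
        (simp_all add: qterms_iffs cancel lscale_one lscale_minus_left lscale_minus_right lscale_diff_right lscale_add_right)
  qed
  show "?P k"
  proof (rule laurent_module_induct[OF k])
    show "?P 0" by (auto simp: coeff_sum_zero lscale_simps)
  next
    fix f g assume P: "?P f" "?P g"
    show "?P (f + g)"
    proof
      fix s assume "s \<in> arc_terms"
      then obtain s' where s': "s' \<in> arc_terms" "alexander_value s' = alexander_value s + lscale (1 - tvar) (f - lscale (coeff_sum f) (gen z))"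
        using P(1) by blast
      obtain s'' where s'': "s'' \<in> arc_terms" "alexander_value s'' = alexander_value s' + lscale (1 - tvar) (g - lscale (coeff_sum g) (gen z))"
        using P(2) s'(1) by blast
      have "alexander_value s'' = alexander_value s + lscale (1 - tvar) (f + g - lscale (coeff_sum (f + g)) (gen z))"
        unfolding s''(2) s'(2) by (simp add: coeff_sum_add lscale_add_left lscale_add_right lscale_diff_right)
      then show "\<exists>s'\<in>arc_terms. alexander_value s' = alexander_value s + lscale (1 - tvar) (f + g - lscale (coeff_sum (f + g)) (gen z))"
        using s''(1) by blast
    qed
  next
    fix a n assume a: "a \<in> arcs D"
    show "?P (Poly_Mapping.single a (tpow n))" using powers[OF plus[OF a], of n] by (simp add: lscale_single)
    show "?P (- Poly_Mapping.single a (tpow n))" using powers[OF minus[OF a], of n] by (simp add: lscale_single lscale_minus_right)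
  qed
qed

lemma link_action_exists:
  assumes "z \<in> arcs D"
  obtains H where "link_action D z H"
proof -
  have q: "qclass (Gen b) \<in> carrier (MQ D)" if "b \<in> arcs D" for b
    using that by (intro qclass_carrier) (simp add: qterms_iffs)
  show thesis
  proof (rule MQ.displacement_action[OF q[OF assms] q])
    fix H :: "(arc \<Rightarrow>\<^sub>0 laurent) \<Rightarrow> arc qterm set \<Rightarrow> arc qterm set"
    assume "additive_action H"
      "\<And>b. b \<in> arcs D \<Longrightarrow> H (Poly_Mapping.single b 1) = MQ.displacement (qclass (Gen b)) (qclass (Gen z))"
      "\<And>f. H (lscale tvar f) = MQ.translation (qclass (Gen z)) \<circ> H f \<circ> inv_into UNIV (MQ.translation (qclass (Gen z)))"
    then have "link_action D z H"
      by (intro link_action.intro link_axioms link_action_axioms.intro assms)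
    then show thesis by (rule that)
  qed
qed

end

section \<open>The Alexander value as an embedding for two components\<close>

locale two_component_link = link +
  fixes base :: "nat \<Rightarrow> arc"
  assumes two: "ncomp D = 2" and base: "i < 2 \<Longrightarrow> base i \<in> arcs D \<and> fst (base i) = i"
begin

lemma base_arcs: "base 0 \<in> arcs D" "base 1 \<in> arcs D" "fst (base 0) = 0" "fst (base 1) = 1"
  using base[of 0] base[of 1] by auto

lemma obtain_action: obtains H where "link_action D (base 0) H"
  by (rule link_action_exists[OF base_arcs(1)])

lemma component_weight_alexander_value:
  assumes "s \<in> arc_terms"
  shows "component_weight (alexander_value s) \<in> {0, 1}"
proof -
  obtain H where "link_action D (base 0) H" by (rule obtain_action)
  then interpret link_action D "base 0" H .
  obtain i k where "alexander_value s - (gen (base i) + lscale (1 - tvar) (centered k)) \<in> relations D"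
    using normal_form[of base, OF _ assms] base two by auto
  from component_weight_cong[OF this] show ?thesis by (simp add: component_weight_simps)
qed

text \<open>Equal Alexander values force the same base arc and displacements that differ by
  something annihilated by 1 - t. For two components this is a multiple of the longitude of that
  very component, which fixes the base class.\<close>

lemma mq_eq_iff:
  assumes s: "s \<in> arc_terms" and u: "u \<in> arc_terms"
  shows "mq_eq (arcs D) mq_relations s u \<longleftrightarrow> alexander_value s - alexander_value u \<in> relations D"
proof
  assume eq: "alexander_value s - alexander_value u \<in> relations D"
  obtain H where "link_action D (base 0) H" by (rule obtain_action)
  then interpret link_action D "base 0" H .
  obtain i k where ik: "i < 2" "qclass s = H k (qclass (Gen (base i)))"
    "alexander_value s - (gen (base i) + lscale (1 - tvar) (centered k)) \<in> relations D"
    using normal_form[of base, OF _ s] base two by auto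
  obtain j l where jl: "j < 2" "qclass u = H l (qclass (Gen (base j)))"
    "alexander_value u - (gen (base j) + lscale (1 - tvar) (centered l)) \<in> relations D"
    using normal_form[of base, OF _ u] base two by auto
  have wi: "component_weight (alexander_value s) = int i"
    using component_weight_cong[OF ik(3)] base[OF ik(1)] ik(1) by (auto simp: component_weight_simps)
  have wj: "component_weight (alexander_value u) = int j"
    using component_weight_cong[OF jl(3)] base[OF jl(1)] jl(1) by (auto simp: component_weight_simps)
  \<comment> \<open>The weight distinguishes the two base arcs, so both normal forms start at the
    same one.\<close>
  have ij: "j = i" using component_weight_cong[OF eq] wi wj by simp
  have "(gen (base i) + lscale (1 - tvar) (centered k)) - (gen (base i) + lscale (1 - tvar) (centered l)) \<in> relations D"
    using relations.cong_trans[OF relations.cong_trans[OF relations.cong_sym[OF ik(3)] eq] jl(3)] ij by simp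
  then have "lscale (1 - tvar) (centered k - centered l) \<in> relations D" by (simp add: lscale_diff_right)
  from annihilator_two_components[OF two ik(1) this]
  obtain n :: int where n: "centered k - centered l - lscale (of_int n) (longitude i) \<in> relations D" by blast
  have i: "i < ncomp D" using ik(1) two by simp
  let ?q = "qclass (Gen (base i))"
  have fixed: "H (longitude i) ?q = ?q" using component_class(1)[OF i] base[OF ik(1)] by blast
  \<comment> \<open>Only integer multiples are claimed: multiplication by t conjugates the action,
    so fixing this class is not preserved by arbitrary Laurent coefficients for free.\<close>
  have fixed': "H (lscale (of_int m) (longitude i)) ?q = ?q" for m
  proof (induction m rule: int_induct[where k = 0])
    case base
    then show ?case by (simp add: lscale_zero_left H_0)
  next
    case (step1 m)
    then show ?case using H_add[of "lscale (of_int m) (longitude i)" "longitude i"]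
      by (simp add: lscale_add_left lscale_one fixed)
  next
    case (step2 m)
    have "H (- longitude i) ?q = ?q" using H_minus(1)[of "longitude i" ?q] by (simp add: fixed)
    then show ?case using step2 H_add[of "lscale (of_int m) (longitude i)" "- longitude i"]
      by (simp add: lscale_diff_left lscale_one)
  qed
  have "centered k = centered l + (centered k - centered l - lscale (of_int n) (longitude i)) + lscale (of_int n) (longitude i)"
    by simp
  from arg_cong[OF this, of "\<lambda>f. H f ?q"]
  have "H (centered k) ?q = H (centered l) (H (centered k - centered l - lscale (of_int n) (longitude i)) (H (lscale (of_int n) (longitude i)) ?q))"
    unfolding H_add .
  then have "H (centered k) ?q = H (centered l) ?q" unfolding fixed' H_relations[OF n] .
  then have "qclass s = qclass u" unfolding ik(2) jl(2) ij H_centered .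
  then show "mq_eq (arcs D) mq_relations s u" using mq_class_eq_iff[OF s u] by blast
qed (rule alexander_value_cong)

text \<open>Modulo 1 - t every power of t is 1 and all arcs of a component agree with its base
  arc.\<close>

lemma decompose:
  assumes "Poly_Mapping.keys f \<subseteq> arcs D"
  shows "\<exists>k m n. Poly_Mapping.keys k \<subseteq> arcs D \<and>
    f - (lscale (1 - tvar) k + lscale (of_int m) (gen (base 0)) + lscale (of_int n) (gen (base 1))) \<in> relations D"
proof -
  let ?P = "\<lambda>f. \<exists>k m n. Poly_Mapping.keys k \<subseteq> arcs D \<and>
    f - (lscale (1 - tvar) k + lscale (of_int m) (gen (base 0)) + lscale (of_int n) (gen (base 1))) \<in> relations D"
  obtain H where "link_action D (base 0) H" by (rule obtain_action)
  then interpret link_action D "base 0" H .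
  have mono: "?P (Poly_Mapping.single a (tpow n))" if a: "a \<in> arcs D" for a n
  proof -
    have i: "fst a < 2" using a two by (simp add: arcs_iff)
    obtain k where k: "Poly_Mapping.keys k \<subseteq> arcs D" "gen a - (gen (base (fst a)) + lscale (1 - tvar) k) \<in> relations D"
      using component_class(2)[of "fst a" "base (fst a)" a] base[OF i] i a two by auto
    obtain w where w: "tpow n = 1 + (1 - tvar) * w" using tpow_divide by blast
    have "Poly_Mapping.single a (tpow n) = gen a + lscale (1 - tvar) (lscale w (gen a))"
      unfolding w by (simp add: lscale_single single_add)
    then have "Poly_Mapping.single a (tpow n) - (lscale (1 - tvar) (k + lscale w (gen a)) + gen (base (fst a))) \<in> relations D"
      using k(2) by (simp add: lscale_add_right algebra_simps)
    moreover have "Poly_Mapping.keys (k + lscale w (gen a)) \<subseteq> arcs D" using k(1) a by (simp add: keys_subset)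
    moreover have "fst a = 0 \<or> fst a = 1" using i by auto
    ultimately show ?thesis
    proof (elim disjE)
      assume *: "fst a = 0" "Poly_Mapping.single a (tpow n) - (lscale (1 - tvar) (k + lscale w (gen a)) + gen (base (fst a))) \<in> relations D"
        "Poly_Mapping.keys (k + lscale w (gen a)) \<subseteq> arcs D"
      show ?thesis by (intro exI[of _ "k + lscale w (gen a)"] exI[of _ 1] exI[of _ 0])
        (use * in \<open>simp add: lscale_one lscale_zero_left\<close>)
    next
      assume *: "fst a = 1" "Poly_Mapping.single a (tpow n) - (lscale (1 - tvar) (k + lscale w (gen a)) + gen (base (fst a))) \<in> relations D"
        "Poly_Mapping.keys (k + lscale w (gen a)) \<subseteq> arcs D"
      show ?thesis by (intro exI[of _ "k + lscale w (gen a)"] exI[of _ 0] exI[of _ 1])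
        (use * in \<open>simp add: lscale_one lscale_zero_left\<close>)
    qed
  qed
  have neg: "?P (- f)" if Pf: "?P f" for f
  proof -
    obtain k m n where k: "Poly_Mapping.keys k \<subseteq> arcs D"
      "f - (lscale (1 - tvar) k + lscale (of_int m) (gen (base 0)) + lscale (of_int n) (gen (base 1))) \<in> relations D"
      using Pf by blast
    show ?thesis
      by (intro exI[of _ "- k"] exI[of _ "- m"] exI[of _ "- n"])
        (use k(1) relations.minus_mem[OF k(2)] in \<open>simp add: lscale_minus_left lscale_minus_right algebra_simps\<close>)
  qed
  show "?P f"
  proof (rule laurent_module_induct[OF assms])
    show "?P 0" by (intro exI[of _ 0]) (simp add: lscale_simps relations.zero_mem)
  next
    fix f g assume "?P f" "?P g"
    then obtain k m n k' m' n' where k: "Poly_Mapping.keys k \<subseteq> arcs D" "Poly_Mapping.keys k' \<subseteq> arcs D"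
      "f - (lscale (1 - tvar) k + lscale (of_int m) (gen (base 0)) + lscale (of_int n) (gen (base 1))) \<in> relations D"
      "g - (lscale (1 - tvar) k' + lscale (of_int m') (gen (base 0)) + lscale (of_int n') (gen (base 1))) \<in> relations D"
      by blast
    show "?P (f + g)"
      by (intro exI[of _ "k + k'"] exI[of _ "m + m'"] exI[of _ "n + n'"])
        (use k(1,2) relations.add_mem[OF k(3,4)] in \<open>simp add: keys_subset lscale_add_left lscale_add_right algebra_simps\<close>)
  qed (use mono neg[OF mono] in auto)
qed

abbreviation "generator \<equiv> gen (base 1) - gen (base 0)"

lemma generator_kernel: "generator \<in> kernel_elements" "component_weight generator = 1"
  using base_arcs by (simp_all add: keys_subset coeff_sum_diff coeff_sum_single component_weight_simps)

lemma kernel_decompose: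
  assumes f: "f \<in> kernel_elements"
  obtains k where "k \<in> kernel_elements"
    "f - (lscale (1 - tvar) k + lscale (of_int (component_weight f)) generator) \<in> relations D"
proof -
  have keys: "Poly_Mapping.keys f \<subseteq> arcs D" and cs: "coeff_sum f = 0" using f by simp_all
  obtain k m n where k: "Poly_Mapping.keys k \<subseteq> arcs D"
    "f - (lscale (1 - tvar) k + lscale (of_int m) (gen (base 0)) + lscale (of_int n) (gen (base 1))) \<in> relations D"
    using decompose[OF keys] by blast
  have n: "n = component_weight f"
    using component_weight_cong[OF k(2)] base_arcs by (simp add: component_weight_simps)
  have sum: "0 = (1 - tvar) * coeff_sum k + of_int m + of_int n"
    using coeff_sum_cong[OF k(2)] cs by (simp add: coeff_sum_add coeff_sum_lscale coeff_sum_single)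
  from arg_cong[OF this, of augmentation] have m: "m = - n" by (simp add: augmentation_simps)
  \<comment> \<open>With m = - n the sum reads (1 - t) times the coefficient sum equals 0 in a
    domain; this is what puts \<open>k\<close> into the kernel.\<close>
  then have "coeff_sum k = 0" using sum one_minus_tvar_nonzero by simp
  then show thesis
    using that[of k] k m n by (simp add: lscale_minus_left lscale_diff_right algebra_simps)
qed

text \<open>After subtracting the base arc of component 0, the kernel decomposition leaves a base
  arc shifted by 1 - t times a kernel element, and \<open>shift_term\<close> realizes such a
  shift.\<close>

lemma alexander_value_surj:
  assumes f: "Poly_Mapping.keys f \<subseteq> arcs D" "coeff_sum f = 1" "component_weight f \<in> {0, 1}"
  obtains s where "s \<in> arc_terms" "alexander_value s - f \<in> relations D"
proof -
  have mem: "f - gen (base 0) \<in> kernel_elements"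
    using f base_arcs by (simp add: keys_subset coeff_sum_diff coeff_sum_single)
  have w: "component_weight (f - gen (base 0)) = component_weight f"
    using base_arcs by (simp add: component_weight_simps)
  obtain k where k: "k \<in> kernel_elements"
    "f - gen (base 0) - (lscale (1 - tvar) k + lscale (of_int (component_weight f)) generator) \<in> relations D"
    using kernel_decompose[OF mem] unfolding w by blast
  define i :: nat where "i = (if component_weight f = 0 then 0 else 1)"
  have i: "gen (base i) = gen (base 0) + lscale (of_int (component_weight f)) generator"
    using f(3) by (auto simp: i_def lscale_zero_left lscale_one)
  have "Gen (base i) \<in> arc_terms" using base[of i] by (simp add: i_def qterms_iffs)
  then obtain s where s: "s \<in> arc_terms" "alexander_value s = gen (base i) + lscale (1 - tvar) k"
    using shift_term[OF base_arcs(1), of k] k(1) by (auto simp: lscale_zero_left)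
  have "alexander_value s - f \<in> relations D"
    using relations.minus_mem[OF k(2)] unfolding s(2) i by (simp add: algebra_simps)
  then show thesis using that s(1) by blast
qed

end

section \<open>From modules back to quandles\<close>

locale two_component_links = two_links D D' + A: two_component_link D base + A': two_component_link D' base'
  for D D' base base'
begin

text \<open>The operation is an affine combination with coefficients t and 1 - t, so it is respected
  by any affine extension of an isomorphism of the kernels. What remains is to match the weights 0
  and 1 that mark the images of the quandles.\<close>

lemma quandle_isomorphic_if_module_isomorphic:
  assumes "module_isomorphic (reduced_alexander_invariant D) (reduced_alexander_invariant D')"
  shows "quandle_isomorphic (MQ D) (MQ D')"
proof -
  let ?Z = "L.kernel_elements" and ?Z' = "L'.kernel_elements"
  let ?N = "relations D" and ?N' = "relations D'"
  let ?w = component_weight and ?v = alexander_value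
  obtain p where p: "\<And>f. f \<in> ?Z \<Longrightarrow> p f \<in> ?Z'"
    and inj: "\<And>f g. f \<in> ?Z \<Longrightarrow> g \<in> ?Z \<Longrightarrow> f - g \<in> ?N \<longleftrightarrow> p f - p g \<in> ?N'"
    and surj: "\<And>h. h \<in> ?Z' \<Longrightarrow> \<exists>f\<in>?Z. p f - h \<in> ?N'"
    and add: "\<And>f g. f \<in> ?Z \<Longrightarrow> g \<in> ?Z \<Longrightarrow> p (f + g) - (p f + p g) \<in> ?N'"
    and smult: "\<And>r f. f \<in> ?Z \<Longrightarrow> p (lscale r f) - lscale r (p f) \<in> ?N'"
    by (rule representatives_from_module_isomorphic[OF assms]) (rule that)
  have cl: "f + g \<in> ?Z" "lscale r f \<in> ?Z" if "f \<in> ?Z" "g \<in> ?Z" for f g r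
    using that by (simp_all add: coeff_sum_add coeff_sum_lscale keys_subset)
  \<comment> \<open>The factor by which the isomorphism multiplies weights; surjectivity makes it a
    unit of the integers.\<close>
  define n where "n = ?w (p A.generator)"
  have weight: "?w (p f) = ?w f * n" if f: "f \<in> ?Z" for f
  proof -
    obtain k where k: "k \<in> ?Z" "f - (lscale (1 - tvar) k + lscale (of_int (?w f)) A.generator) \<in> ?N"
      by (rule A.kernel_decompose[OF f])
    let ?g = "lscale (1 - tvar) k" and ?h = "lscale (of_int (?w f)) A.generator"
    have gh: "?g \<in> ?Z" "?h \<in> ?Z" using cl(2)[OF k(1) k(1)] cl(2)[OF A.generator_kernel(1) A.generator_kernel(1)] by blast+
    have "?w (p f) = ?w (p (?g + ?h))"
      using L'.component_weight_cong inj[OF f cl(1)[OF gh]] k(2) by blast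
    also have "\<dots> = ?w (p ?g + p ?h)" by (rule L'.component_weight_cong[OF add[OF gh]])
    also have "\<dots> = ?w (p ?g) + ?w (p ?h)" by (rule component_weight_add)
    also have "?w (p ?g) = ?w (lscale (1 - tvar) (p k))" by (rule L'.component_weight_cong[OF smult[OF k(1)]])
    also have "?w (p ?h) = ?w (lscale (of_int (?w f)) (p A.generator))"
      by (rule L'.component_weight_cong[OF smult[OF A.generator_kernel(1)]])
    finally show ?thesis by (simp add: component_weight_lscale augmentation_simps n_def)
  qed
  have n: "n = 1 \<or> n = -1"
  proof -
    obtain f where f: "f \<in> ?Z" "p f - A'.generator \<in> ?N'" using surj[OF A'.generator_kernel(1)] by blast
    have "?w f * n = 1" using L'.component_weight_cong[OF f(2)] weight[OF f(1)] A'.generator_kernel(2) by simp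
    then show ?thesis unfolding zmult_eq_1_iff by blast
  qed
  \<comment> \<open>For n = -1 the weights 0 and 1 turn into 0 and -1; an origin of weight 1 brings
    them back to 1 and 0.\<close>
  define c where "c = (if n = 1 then L'.gen (base' 0) else L'.gen (base' 1))"
  have c: "Poly_Mapping.keys c \<subseteq> arcs D'" "coeff_sum c = 1" "?w c = (if n = 1 then 0 else 1)"
    using A'.base_arcs by (auto simp: c_def coeff_sum_single component_weight_simps)
  let ?a = "L.gen (base 0)"
  define \<Phi> where "\<Phi> f = p (f - ?a) + c" for f
  have affine: "f - ?a \<in> ?Z" if "Poly_Mapping.keys f \<subseteq> arcs D" "coeff_sum f = 1" for f
    using that A.base_arcs by (simp add: keys_subset coeff_sum_diff coeff_sum_single)
  have wa: "?w (f - ?a) = ?w f" for f using A.base_arcs by (simp add: component_weight_simps)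
  have v: "?v s - ?a \<in> ?Z" if "s \<in> L.arc_terms" for s
    by (rule affine[OF keys_alexander_value[OF that] coeff_sum_alexander_value])
  have "\<exists>s'. s' \<in> L'.arc_terms \<and> ?v s' - \<Phi> (?v s) \<in> ?N'" if s: "s \<in> L.arc_terms" for s
  proof -
    have "p (?v s - ?a) \<in> ?Z'" by (rule p[OF v[OF s]])
    then have 1: "Poly_Mapping.keys (\<Phi> (?v s)) \<subseteq> arcs D'" "coeff_sum (\<Phi> (?v s)) = 1"
      using c by (simp_all add: \<Phi>_def keys_subset coeff_sum_add)
    have "?w (\<Phi> (?v s)) = ?w (?v s) * n + ?w c"
      by (simp add: \<Phi>_def component_weight_add weight[OF v[OF s]] wa)
    then have 2: "?w (\<Phi> (?v s)) \<in> {0, 1}"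
      using A.component_weight_alexander_value[OF s] n c(3) by auto
    show ?thesis by (rule A'.alexander_value_surj[OF 1 2]) blast
  qed
  then have "\<exists>\<theta>. \<forall>s. s \<in> L.arc_terms \<longrightarrow> \<theta> s \<in> L'.arc_terms \<and> ?v (\<theta> s) - \<Phi> (?v s) \<in> ?N'"
    by (intro choice allI) blast
  then obtain \<theta> where \<theta>: "\<And>s. s \<in> L.arc_terms \<Longrightarrow> \<theta> s \<in> L'.arc_terms"
    "\<And>s. s \<in> L.arc_terms \<Longrightarrow> ?v (\<theta> s) - \<Phi> (?v s) \<in> ?N'" by blast
  have cong: "?v s - ?v u \<in> ?N \<longleftrightarrow> \<Phi> (?v s) - \<Phi> (?v u) \<in> ?N'" if "s \<in> L.arc_terms" "u \<in> L.arc_terms" for s u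
    using inj[OF v[OF that(1)] v[OF that(2)]] by (simp add: \<Phi>_def)
  show ?thesis
  proof (rule quandle_isomorphic_from_representatives[of \<theta>])
    show "\<theta> s \<in> L'.arc_terms" if "s \<in> L.arc_terms" for s using \<theta>(1)[OF that] .
    show "mq_eq (arcs D) L.mq_relations s u \<longleftrightarrow> mq_eq (arcs D') L'.mq_relations (\<theta> s) (\<theta> u)"
      if su: "s \<in> L.arc_terms" "u \<in> L.arc_terms" for s u
      unfolding A.mq_eq_iff[OF su] A'.mq_eq_iff[OF \<theta>(1)[OF su(1)] \<theta>(1)[OF su(2)]] cong[OF su]
    proof
      assume "\<Phi> (?v s) - \<Phi> (?v u) \<in> ?N'"
      then show "?v (\<theta> s) - ?v (\<theta> u) \<in> ?N'"
        using \<theta>(2)[OF su(1)] L'.relations.cong_sym[OF \<theta>(2)[OF su(2)]] L'.relations.cong_trans by blast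
    next
      assume "?v (\<theta> s) - ?v (\<theta> u) \<in> ?N'"
      then show "\<Phi> (?v s) - \<Phi> (?v u) \<in> ?N'"
        using L'.relations.cong_sym[OF \<theta>(2)[OF su(1)]] \<theta>(2)[OF su(2)] L'.relations.cong_trans by blast
    qed
  next
    fix s' assume s': "s' \<in> L'.arc_terms"
    have "?v s' - c \<in> ?Z'"
      using keys_alexander_value[OF s'] c by (simp add: keys_subset coeff_sum_diff coeff_sum_alexander_value)
    then obtain k where k: "k \<in> ?Z" "p k - (?v s' - c) \<in> ?N'" using surj by blast
    let ?f = "k + ?a"
    have f: "Poly_Mapping.keys ?f \<subseteq> arcs D" "coeff_sum ?f = 1"
      using k(1) A.base_arcs by (simp_all add: keys_subset coeff_sum_add coeff_sum_single)
    have "?w k * n = ?w (?v s') - ?w c"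
      using L'.component_weight_cong[OF k(2)] weight[OF k(1)] by (simp add: component_weight_diff)
    moreover have "?w (?v s') \<in> {0, 1}" by (rule A'.component_weight_alexander_value[OF s'])
    moreover have "?w ?f = ?w k" using A.base_arcs by (simp add: component_weight_simps)
    ultimately have wf: "?w ?f \<in> {0, 1}" using n c(3) by auto
    obtain s where s: "s \<in> L.arc_terms" "?v s - ?f \<in> ?N" by (rule A.alexander_value_surj[OF f wf])
    have "p (?v s - ?a) - p k \<in> ?N'"
      using inj[OF v[OF s(1)] k(1)] s(2) by (simp add: algebra_simps)
    from L'.relations.cong_trans[OF this k(2)] have "\<Phi> (?v s) - ?v s' \<in> ?N'" by (simp add: \<Phi>_def algebra_simps)
    then have "?v (\<theta> s) - ?v s' \<in> ?N'" by (rule L'.relations.cong_trans[OF \<theta>(2)[OF s(1)]])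
    then show "\<exists>s\<in>L.arc_terms. mq_eq (arcs D') L'.mq_relations (\<theta> s) s'"
      using s(1) A'.mq_eq_iff[OF \<theta>(1)[OF s(1)] s'] by blast
  next
    fix s u assume su: "s \<in> L.arc_terms" "u \<in> L.arc_terms"
    have op: "Op s u \<in> L.arc_terms" "Op (\<theta> s) (\<theta> u) \<in> L'.arc_terms" using su \<theta>(1) by (simp_all add: qterms_iffs)
    let ?g = "lscale tvar (?v s - ?a)" and ?h = "lscale (1 - tvar) (?v u - ?a)"
    have gh: "?g \<in> ?Z" "?h \<in> ?Z" using cl(2) v su by blast+
    have "?v (Op s u) - ?a = ?g + ?h" by (simp add: lscale_simps)
    then have "p (?v (Op s u) - ?a) - (p ?g + p ?h) \<in> ?N'" using add[OF gh] by (simp only:)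
    from L'.relations.cong_trans[OF this L'.relations.cong_add[OF smult[OF v[OF su(1)]] smult[OF v[OF su(2)]]]]
    have "\<Phi> (?v (Op s u)) - (lscale tvar (\<Phi> (?v s)) + lscale (1 - tvar) (\<Phi> (?v u))) \<in> ?N'"
      by (simp add: \<Phi>_def lscale_add_right lscale_diff_left lscale_one algebra_simps)
    from L'.relations.cong_trans[OF \<theta>(2)[OF op(1)] this]
    have "?v (\<theta> (Op s u)) - (lscale tvar (\<Phi> (?v s)) + lscale (1 - tvar) (\<Phi> (?v u))) \<in> ?N'" .
    from L'.relations.cong_trans[OF this L'.relations.cong_add[OF L'.relations.cong_lscale[OF L'.relations.cong_sym[OF \<theta>(2)[OF su(1)]]]
        L'.relations.cong_lscale[OF L'.relations.cong_sym[OF \<theta>(2)[OF su(2)]]]]]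
    have "?v (\<theta> (Op s u)) - ?v (Op (\<theta> s) (\<theta> u)) \<in> ?N'" by simp
    then show "mq_eq (arcs D') L'.mq_relations (\<theta> (Op s u)) (Op (\<theta> s) (\<theta> u))"
      using A'.mq_eq_iff[OF \<theta>(1)[OF op(1)] op(2)] by blast
  qed
qed

end

theorem theorem12:
  fixes D D' :: diagram
  assumes "link_diagram D" and "link_diagram D'"
    and "ncomp D = 2" and "ncomp D' = 2"
  shows "quandle_isomorphic (MQ D) (MQ D') \<longleftrightarrow>
    module_isomorphic (reduced_alexander_invariant D) (reduced_alexander_invariant D')"
proof -
  interpret two_links D D' by (intro two_links.intro link.intro assms)
  have "\<exists>b. \<forall>i. i < 2 \<longrightarrow> b i \<in> arcs D \<and> fst (b i) = i"
    by (intro choice allI) (metis L.arc_exists assms(3))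
  then obtain b where b: "i < 2 \<Longrightarrow> b i \<in> arcs D \<and> fst (b i) = i" for i by blast
  have "\<exists>b. \<forall>i. i < 2 \<longrightarrow> b i \<in> arcs D' \<and> fst (b i) = i"
    by (intro choice allI) (metis L'.arc_exists assms(4))
  then obtain b' where b': "i < 2 \<Longrightarrow> b' i \<in> arcs D' \<and> fst (b' i) = i" for i by blast
  interpret two_component_links D D' b b'
    by (intro two_component_links.intro two_links_axioms two_component_link.intro two_component_link_axioms.intro
        L.link_axioms L'.link_axioms assms b b')
  show ?thesis
    using module_isomorphic_if_quandle_isomorphic quandle_isomorphic_if_module_isomorphic by blast
qed

end
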